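(* Almost all Latin squares, Steiner triple systems, or edge-parallelisms of complete graphs have no non-trivial automorphisms. Precisely, each of the following three statements holds. (1) For an integer $n\ge1$, let $L_n$ be the set of Latin squares of order $n$ with rows, columns and symbols indexed by fixed $n$-sets, and let $L_n^*\subseteq L_n$ be the set of those admitting a non-identity automorphism. Then $|L_n^*|/|L_n|\to0$ as $n\to\infty$. (2) For admissible $n$ (i.e. $n\equiv1$ or $3\pmod 6$), let $T_n$ be the set of Steiner triple systems on a fixed $n$-element point set and $T_n^*\subseteq T_n$ those admitting a non-identity automorphism. Then $|T_n^*|/|T_n|\to0$ as $n\to\infty$ through admissible values. (3) For admissible $n$ (i.e. $n$ even), let $P_n$ be the set of edge-parallelisms of the complete graph on a fixed $n$-element set and $P_n^*\subseteq P_n$ those admitting a non-identity automorphism. Then $|P_n^*|/|P_n|\to0$ as $n\to\infty$ through even values.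
   Context: A Latin square of order $n$ is an $n\times n$ array in which each of $n$ symbols occurs exactly once in each row and each column. Index the rows by $R=\{r_1,\dots,r_n\}$, columns by $C=\{c_1,\dots,c_n\}$ and symbols by $E=\{e_1,\dots,e_n\}$ (three disjoint sets); a cell is a triple $(r_i,c_j,e_k)$ such that the $(i,j)$ entry of the square is $e_k$. An automorphism of a Latin square is (in the most general sense) a permutation of $R\cup C\cup E$ which preserves the partition $\{R,C,E\}$ (possibly permuting the three parts among themselves) and maps the set of cells onto itself (with the entries of a triple permuted accordingly when the parts are permuted). A Steiner triple system of order $n$ is a set of $3$-element subsets (blocks) of an $n$-set such that every $2$-subset lies in exactly one block; an automorphism is a permutation of the points mapping blocks to blocks. An edge-parallelism (1-factorisation) of the complete graph on an $n$-set $X$ is a partition of the set of $2$-subsets of $X$ into parallel classes, each of which is a partition of $X$ into $2$-subsets (a perfect matching); an automorphism is a permutation of $X$ mapping each parallel class onto a parallel class. A non-trivial automorphism is one different from the identity. *)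

theory Defs
  imports Complex_Main
begin

text \<open>Rows, columns and symbols are all indexed by {0..<n}. A Latin square is
given by its set of cells (i,j,k): entry (i,j) is symbol k.\<close>

definition latin_squares :: "nat \<Rightarrow> (nat \<times> nat \<times> nat) set set" where
  "latin_squares n = {S. S \<subseteq> {0..<n} \<times> {0..<n} \<times> {0..<n} \<and>
      (\<forall>i<n. \<forall>j<n. \<exists>!k. (i,j,k) \<in> S) \<and>
      (\<forall>i<n. \<forall>k<n. \<exists>!j. (i,j,k) \<in> S) \<and>
      (\<forall>j<n. \<forall>k<n. \<exists>!i. (i,j,k) \<in> S)}"

text \<open>The disjoint union R \<union> C \<union> E is modelled as {0,1,2} \<times> {0..<n}:
(0,i) is row r_i, (1,j) is column c_j, (2,k) is symbol e_k.\<close>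

definition ls_points :: "nat \<Rightarrow> (nat \<times> nat) set" where
  "ls_points n = {0..<3} \<times> {0..<n}"

definition ls_part :: "nat \<Rightarrow> nat \<Rightarrow> (nat \<times> nat) set" where
  "ls_part n p = {p} \<times> {0..<n}"

definition ls_cells :: "(nat \<times> nat \<times> nat) set \<Rightarrow> (nat \<times> nat) set set" where
  "ls_cells S = {{(0,i),(1,j),(2,k)} | i j k. (i,j,k) \<in> S}"

text \<open>Automorphism in the most general sense (autoparatopism).\<close>
definition ls_automorphism :: "nat \<Rightarrow> (nat \<times> nat \<times> nat) set \<Rightarrow> (nat \<times> nat \<Rightarrow> nat \<times> nat) \<Rightarrow> bool" where
  "ls_automorphism n S f \<longleftrightarrow>
     bij_betw f (ls_points n) (ls_points n) \<and>
     (\<forall>p<3. \<exists>q<3. f ` ls_part n p = ls_part n q) \<and>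
     (\<lambda>c. f ` c) ` ls_cells S = ls_cells S"

definition latin_squares_nontriv_aut :: "nat \<Rightarrow> (nat \<times> nat \<times> nat) set set" where
  "latin_squares_nontriv_aut n = {S \<in> latin_squares n.
      \<exists>f. ls_automorphism n S f \<and> (\<exists>x \<in> ls_points n. f x \<noteq> x)}"

definition steiner_triple_systems :: "nat \<Rightarrow> nat set set set" where
  "steiner_triple_systems n = {B. (\<forall>b \<in> B. b \<subseteq> {0..<n} \<and> card b = 3) \<and>
      (\<forall>e. e \<subseteq> {0..<n} \<and> card e = 2 \<longrightarrow> (\<exists>!b \<in> B. e \<subseteq> b))}"

definition sts_automorphism :: "nat \<Rightarrow> nat set set \<Rightarrow> (nat \<Rightarrow> nat) \<Rightarrow> bool" where
  "sts_automorphism n B f \<longleftrightarrow>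
     bij_betw f {0..<n} {0..<n} \<and> (\<lambda>b. f ` b) ` B = B"

definition sts_nontriv_aut :: "nat \<Rightarrow> nat set set set" where
  "sts_nontriv_aut n = {B \<in> steiner_triple_systems n.
      \<exists>f. sts_automorphism n B f \<and> (\<exists>x \<in> {0..<n}. f x \<noteq> x)}"

definition perfect_matching :: "nat \<Rightarrow> nat set set \<Rightarrow> bool" where
  "perfect_matching n M \<longleftrightarrow>
     (\<forall>e \<in> M. e \<subseteq> {0..<n} \<and> card e = 2) \<and>
     (\<forall>x \<in> {0..<n}. \<exists>!e \<in> M. x \<in> e)"

definition edge_parallelisms :: "nat \<Rightarrow> nat set set set set" where
  "edge_parallelisms n = {P. (\<forall>M \<in> P. perfect_matching n M \<and> M \<noteq> {}) \<and>
      (\<forall>e. e \<subseteq> {0..<n} \<and> card e = 2 \<longrightarrow> (\<exists>!M \<in> P. e \<in> M))}"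

definition par_automorphism :: "nat \<Rightarrow> nat set set set \<Rightarrow> (nat \<Rightarrow> nat) \<Rightarrow> bool" where
  "par_automorphism n P f \<longleftrightarrow>
     bij_betw f {0..<n} {0..<n} \<and> (\<forall>M \<in> P. (\<lambda>e. f ` e) ` M \<in> P)"

definition par_nontriv_aut :: "nat \<Rightarrow> nat set set set set" where
  "par_nontriv_aut n = {P \<in> edge_parallelisms n.
      \<exists>f. par_automorphism n P f \<and> (\<exists>x \<in> {0..<n}. f x \<noteq> x)}"

end

theory Submission
  imports Defs "HOL-Library.FuncSet" "HOL-Real_Asymp.Real_Asymp"
begin

text \<open>
  A structure with a nontrivial automorphism is a linear family of triples invariant under a
  permutation with few fixed triples, so it is generated by little more than half of its triples
  and there are few such structures: at most \<open>n powr (c * n\<^sup>2 * (1 + o(1)))\<close> with \<open>c = 5/8\<close>, \<open>5/48\<close>, \<open>5/16\<close>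
  for Latin squares, triple systems and parallelisms respectively.

  In the other direction, let \<open>E\<close> be a bipartite graph on \<open>n + n\<close> vertices, regular of degree \<open>N = 2 ^ j\<close>,
  and let the colours form an elementary abelian group of order \<open>N\<close>. A pair of colourings, one
  proper at the rows and the other proper at the columns, is a row-proper colouring together with a
  shift that makes it column-proper. For every shift there are at most as many such colourings
  as for the zero shift, because one coordinate of the shift at a time can be set to zero: the
  colourings with all other coordinates given are the 2-colourings of a union of two perfect
  matchings. Hence \<open>E\<close> has at least \<open>fact N ^ (2 * n) / N ^ (n * N)\<close> proper colourings. Cutting the cyclic
  Latin square into bands gives at least \<open>n powr (7/8 * n\<^sup>2 * (1 - o(1)))\<close> Latin squares; doubling
  constructions turn this into a bound for symmetric Latin squares with a prescribed diagonal, that is,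
  for parallelisms, and the constructions of Bose and Skolem into one for triple systems. The
  exponents \<open>7/8\<close>, \<open>1/8\<close>, \<open>3/8\<close> obtained exceed those of the upper bounds.
\<close>

text \<open>The usual lower bound for Latin squares rests on van der Waerden's permanent inequality;
  here a count of 2-colourings takes its place. The price is that degrees must be powers of 2:
  removing one bit of the shift compares two affine systems over the two-element field with the same
  homogeneous part, and the unshifted one is solvable because two perfect matchings form even
  cycles.

  The exponents are chosen as follows. The structures have about n^2, n^2/6 and n^2/2 triples. At
  most a quarter as many are pointwise fixed, since a moved point sends fixed points injectively to
  moved ones, so that at most half of the points concerned are fixed. A generating set thus has
  about 1/2 * (1 + 1/4) = 5/8 of the triples, whence 5/8, 5/48, 5/16. On the other side 7/8 for
  Latin squares leaves room for the doublings, which keep the fraction 3/4: 3/8 = 3/4 * 1/2 and 1/8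
  = 3/4 * 1/6. All other losses (choice of the permutation, normalisations, factorial estimates) are
  factors exp(O(n^2)), negligible against a gap of the form exp(c * n^2 * ln n).\<close>

lemma card_le_by_fibres:
  assumes "finite A" "finite B"
    and "\<And>k. card {a\<in>A. h a = k} \<le> card {b\<in>B. h b = k}"
  shows "card A \<le> card B"
proof -
  let ?K = "h ` A \<union> h ` B"
  have fK: "finite ?K" using assms by simp
  have *: "card C = (\<Sum>k\<in>?K. card {a\<in>C. h a = k})" if "C = A \<or> C = B" for C
  proof -
    have "finite C" "h ` C \<subseteq> ?K" using that assms by auto
    then show ?thesis using sum.group[OF \<open>finite C\<close> fK, of h "\<lambda>_. 1::nat"] by simp
  qed
  show ?thesis using *[of A] *[of B] assms(3) by (simp add: sum_mono)
qed

subsection \<open>Counting proper edge colourings of regular bipartite graphs\<close>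

text \<open>The orbits of the product of the two involutions are the colour classes: neither involution
  maps a point into its own orbit, and both swap an orbit with the same partner orbit.\<close>

lemma two_involutions_2_colourable:
  assumes a: "\<And>e. e \<in> E \<Longrightarrow> \<alpha> e \<in> E \<and> \<alpha> (\<alpha> e) = e \<and> \<alpha> e \<noteq> e"
    and b: "\<And>e. e \<in> E \<Longrightarrow> \<beta> e \<in> E \<and> \<beta> (\<beta> e) = e \<and> \<beta> e \<noteq> e"
  shows "\<exists>x :: 'e \<Rightarrow> bool. \<forall>e\<in>E. x (\<alpha> e) \<noteq> x e \<and> x (\<beta> e) \<noteq> x e"
proof -
  define t where "t = (\<lambda>e. \<alpha> (\<beta> e))"
  have tE: "t e \<in> E" if "e \<in> E" for e using a b that by (simp add: t_def)
  have tmE: "(t ^^ m) e \<in> E" if "e \<in> E" for e m using that tE by (induction m) auto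
  have t_inj: "e = e'" if "t e = t e'" "e \<in> E" "e' \<in> E" for e e'
    using that a b unfolding t_def by metis
  \<comment> \<open>A reflection is never a rotation. If \<open>\<alpha> e = t z\<close> with
    \<open>z = (t ^^ k) (t e)\<close>, then \<open>z = \<beta> e = \<alpha> (t e)\<close>, the same
    situation at \<open>t e\<close> with exponent smaller by two. The exponents 0 and 1 would give
    fixed points of \<alpha> and \<beta>.\<close>
  have no: "\<alpha> e \<noteq> (t ^^ m) e" if "e \<in> E" for e m
    using that
  proof (induction m arbitrary: e rule: less_induct)
    case (less m)
    consider "m = 0" | "m = 1" | k where "m = Suc (Suc k)"
      by (metis One_nat_def not0_implies_Suc)
    then show ?case
    proof cases
      case 1 then show ?thesis using a less.prems by simp
    next
      case 2 then show ?thesis using a b less.prems by (simp add: t_def) metis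
    next
      case 3
      have "\<alpha> (t e) \<noteq> (t ^^ k) (t e)" using less.IH[of k "t e"] 3 less.prems tE by simp
      moreover have "\<alpha> (t e) = \<beta> e" using a b less.prems by (simp add: t_def)
      moreover have "(t ^^ m) e = t ((t ^^ k) (t e))"
        unfolding 3 by (simp add: funpow_swap1)
      moreover have "t z = \<alpha> (\<beta> z)" for z by (simp add: t_def)
      ultimately show ?thesis using a b less.prems tmE[OF tE[OF less.prems], of k] by metis
    qed
  qed
  \<comment> \<open>Both directions are allowed because E may be infinite, so that t need not be
    periodic.\<close>
  define Orb where "Orb e = {y\<in>E. \<exists>m. y = (t ^^ m) e \<or> e = (t ^^ m) y}" for e
  have self: "e \<in> Orb e" if "e \<in> E" for e
    unfolding Orb_def using that by (auto intro: exI[of _ 0])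
  have orb_t: "Orb (t e) = Orb e" if e: "e \<in> E" for e
  proof (intro set_eqI iffI)
    fix y assume "y \<in> Orb (t e)"
    then obtain m where y: "y \<in> E" and "y = (t ^^ m) (t e) \<or> t e = (t ^^ m) y"
      by (auto simp: Orb_def)
    then have "y = (t ^^ Suc m) e \<or> (m = 0 \<and> y = (t ^^ 1) e) \<or> (\<exists>k. m = Suc k \<and> t e = t ((t ^^ k) y))"
      by (cases m) (auto simp: funpow_swap1)
    then show "y \<in> Orb e" unfolding Orb_def using y e t_inj tmE by blast
  next
    fix y assume "y \<in> Orb e"
    then obtain m where y: "y \<in> E" and "y = (t ^^ m) e \<or> e = (t ^^ m) y"
      by (auto simp: Orb_def)
    then have "(m = 0 \<and> t e = (t ^^ 1) y) \<or> (\<exists>k. y = (t ^^ k) (t e)) \<or> t e = (t ^^ Suc m) y"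
      by (cases m) (auto simp: funpow_swap1)
    then show "y \<in> Orb (t e)" unfolding Orb_def using y by blast
  qed
  have ab: "Orb (\<alpha> e) = Orb (\<beta> e)" if e: "e \<in> E" for e
    using orb_t[of "\<beta> e"] a b e by (simp add: t_def)
  have ne: "Orb (\<alpha> e) \<noteq> Orb e" if e: "e \<in> E" for e
  proof
    assume "Orb (\<alpha> e) = Orb e"
    then have "\<alpha> e \<in> Orb e" using self[of "\<alpha> e"] a e by simp
    then obtain m where "\<alpha> e = (t ^^ m) e \<or> e = (t ^^ m) (\<alpha> e)" by (auto simp: Orb_def)
    then show False using no[of e m] no[of "\<alpha> e" m] a e by auto
  qed
  \<comment> \<open>One orbit is chosen from each pair of partner orbits. The choice is consistent
    because e, \<open>\<alpha> e\<close> and \<open>\<beta> e\<close> give the same unordered pair,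
    to which \<open>SOME\<close> is applied.\<close>
  define x where "x e \<longleftrightarrow> Orb e = (SOME s. s \<in> {Orb e, Orb (\<alpha> e)})" for e
  have some: "(SOME s. s \<in> {p, q}) \<in> {p, q}" for p q :: "'e set"
    by (rule someI_ex) auto
  have "x (\<alpha> e) \<noteq> x e \<and> x (\<beta> e) \<noteq> x e" if e: "e \<in> E" for e
  proof -
    have 1: "Orb (\<alpha> (\<alpha> e)) = Orb e" using a e by simp
    have 2: "Orb (\<alpha> (\<beta> e)) = Orb e" using orb_t[OF e] by (simp add: t_def)
    have sw: "{Orb (\<alpha> e), Orb e} = {Orb e, Orb (\<alpha> e)}" by auto
    show ?thesis
      unfolding x_def 1 2 ab[OF e, symmetric] sw
      using some[of "Orb e" "Orb (\<alpha> e)"] ne[OF e] by auto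
  qed
  then show ?thesis by blast
qed

text \<open>Colours are subsets of \<open>J\<close>, that is, elements of an elementary abelian 2-group.\<close>

definition shifted_colourings ::
    "'e set \<Rightarrow> ('e \<Rightarrow> 'a) \<Rightarrow> ('e \<Rightarrow> 'b) \<Rightarrow> 'i set \<Rightarrow> ('e \<Rightarrow> 'i set) \<Rightarrow> ('e \<Rightarrow> 'i set) set" where
  "shifted_colourings E r c J g = {\<rho> \<in> E \<rightarrow>\<^sub>E Pow J.
     (\<forall>e\<in>E. \<forall>e'\<in>E. r e = r e' \<and> \<rho> e = \<rho> e' \<longrightarrow> e = e') \<and>
     (\<forall>e\<in>E. \<forall>e'\<in>E. c e = c e' \<and> sym_diff (\<rho> e) (g e) = sym_diff (\<rho> e') (g e') \<longrightarrow> e = e')}"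

lemma finite_shifted_colourings:
  "finite E \<Longrightarrow> finite J \<Longrightarrow> finite (shifted_colourings E r c J g)"
  unfolding shifted_colourings_def by (simp add: finite_PiE)

text \<open>A vertex has as many edges as there are colours, so a proper colouring uses every colour
  at it. This supplies the partner edges \<alpha> and \<beta> whose colours differ in the bit i
  alone.\<close>

lemma inj_on_fibre_onto_Pow:
  assumes "finite E" "finite J" "e \<in> E" "card {e'\<in>E. r e' = r e} = 2 ^ card J"
    and "\<And>e'. e' \<in> E \<Longrightarrow> h e' \<subseteq> J"
    and "\<And>e' e''. e' \<in> E \<Longrightarrow> e'' \<in> E \<Longrightarrow> r e' = r e'' \<Longrightarrow> h e' = h e'' \<Longrightarrow> e' = e''"
    and "a \<subseteq> J"
  shows "\<exists>e'\<in>E. r e' = r e \<and> h e' = a"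
proof -
  let ?F = "{e'\<in>E. r e' = r e}"
  have inj: "inj_on h ?F" using assms(6) by (auto intro!: inj_onI)
  have "h ` ?F = Pow J"
    by (rule card_subset_eq) (use assms in \<open>auto simp: card_image[OF inj] card_Pow\<close>)
  then have "a \<in> h ` ?F" using assms(7) by simp
  then show ?thesis by auto
qed

text \<open>With all bits other than i prescribed by k, edges in a common row or column can clash
  only in pairs, and properness prescribes the sum of the i-bits over each pair. The colourings in a
  fibre are therefore the solutions of an affine system over the two-element field; dropping i from
  the shift changes only its right-hand side. A nonempty fibre before is a coset of the homogeneous
  solutions; the new system is solvable by \<open>two_involutions_2_colourable\<close>, so the fibre
  after has at least as many elements.\<close>

lemma card_shifted_colourings_drop_bit:
  fixes E :: "'e set"
  assumes fin: "finite E" "finite J" and i: "i \<in> J" and g: "\<And>e. e \<in> E \<Longrightarrow> g e \<subseteq> J"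
    and row: "\<And>e. e \<in> E \<Longrightarrow> card {e'\<in>E. r e' = r e} = 2 ^ card J"
    and col: "\<And>e. e \<in> E \<Longrightarrow> card {e'\<in>E. c e' = c e} = 2 ^ card J"
  shows "card (shifted_colourings E r c J g) \<le> card (shifted_colourings E r c J (\<lambda>e. g e - {i}))"
    (is "card ?A \<le> card ?B")
proof (rule card_le_by_fibres[where h = "\<lambda>\<rho>. \<lambda>e\<in>E. \<rho> e - {i}"])
  show "finite ?A" "finite ?B" using fin by (auto intro: finite_shifted_colourings)
  fix k
  let ?h = "\<lambda>\<rho>. \<lambda>e\<in>E. \<rho> e - {i}"
  let ?Ak = "{\<rho>\<in>?A. ?h \<rho> = k}" and ?Bk = "{\<rho>\<in>?B. ?h \<rho> = k}"
  show "card ?Ak \<le> card ?Bk"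
  proof (cases "?Ak = {}")
    case False
    then obtain y where y: "y \<in> ?A" and yk: "?h y = k" by blast
    have k: "k e = y e - {i}" if "e \<in> E" for e using yk that by (metis restrict_apply')
    have yJ: "y e \<subseteq> J" if "e \<in> E" for e
      using y that by (auto simp: shifted_colourings_def PiE_iff)
    have yr: "e = e'" if "e \<in> E" "e' \<in> E" "r e = r e'" "y e = y e'" for e e'
      using y that unfolding shifted_colourings_def by blast
    have yc: "e = e'" if "e \<in> E" "e' \<in> E" "c e = c e'"
      "sym_diff (y e) (g e) = sym_diff (y e') (g e')" for e e'
      using y that unfolding shifted_colourings_def by blast
    have "\<forall>e\<in>E. \<exists>e'\<in>E. r e' = r e \<and> y e' = sym_diff (y e) {i}"
    proof
      fix e assume e: "e \<in> E"
      show "\<exists>e'\<in>E. r e' = r e \<and> y e' = sym_diff (y e) {i}"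
        by (rule inj_on_fibre_onto_Pow[OF fin e row[OF e] yJ yr]) (use yJ[OF e] i in auto)
    qed
    \<comment> \<open>\<alpha> pairs the edges of a row, \<beta> those of a column. Both are defined
      through one colouring y of the fibre, but serve all its colourings, since these agree outside
      the bit i.\<close>
    then obtain \<alpha> where al: "\<And>e. e \<in> E \<Longrightarrow> \<alpha> e \<in> E \<and> r (\<alpha> e) = r e \<and> y (\<alpha> e) = sym_diff (y e) {i}"
      by metis
    have "\<forall>e\<in>E. \<exists>e'\<in>E. c e' = c e \<and>
        sym_diff (y e') (g e') = sym_diff (sym_diff (y e) (g e)) {i}"
    proof
      fix e assume e: "e \<in> E"
      show "\<exists>e'\<in>E. c e' = c e \<and> sym_diff (y e') (g e') = sym_diff (sym_diff (y e) (g e)) {i}"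
        by (rule inj_on_fibre_onto_Pow[OF fin e col[OF e] _ yc])
          (use yJ g i e in \<open>force+\<close>)
    qed
    then obtain \<beta> where be: "\<And>e. e \<in> E \<Longrightarrow> \<beta> e \<in> E \<and> c (\<beta> e) = c e \<and>
        sym_diff (y (\<beta> e)) (g (\<beta> e)) = sym_diff (sym_diff (y e) (g e)) {i}"
      by metis
    have a_inv: "\<alpha> e \<in> E \<and> \<alpha> (\<alpha> e) = e \<and> \<alpha> e \<noteq> e" if e: "e \<in> E" for e
    proof -
      have "\<alpha> (\<alpha> e) = e" using al[OF e] al[of "\<alpha> e"] e by (intro yr) auto
      moreover have "\<alpha> e \<noteq> e"
      proof
        assume "\<alpha> e = e"
        then have "y e = sym_diff (y e) {i}" using al[OF e] by (simp only:)
        then show False by blast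
      qed
      ultimately show ?thesis using al[OF e] by blast
    qed
    have b_inv: "\<beta> e \<in> E \<and> \<beta> (\<beta> e) = e \<and> \<beta> e \<noteq> e" if e: "e \<in> E" for e
    proof -
      have "\<beta> (\<beta> e) = e"
      proof (rule yc)
        show "sym_diff (y (\<beta> (\<beta> e))) (g (\<beta> (\<beta> e))) = sym_diff (y e) (g e)"
          using be[OF e] be[of "\<beta> e"] by (simp only:) blast
      qed (use be[OF e] be[of "\<beta> e"] e in auto)
      moreover have "\<beta> e \<noteq> e"
      proof
        assume "\<beta> e = e"
        then have "sym_diff (y e) (g e) = sym_diff (sym_diff (y e) (g e)) {i}"
          using be[OF e] by (simp only:)
        then show False by blast
      qed
      ultimately show ?thesis using be[OF e] by blast
    qed
    have "\<exists>x :: 'e \<Rightarrow> bool. \<forall>e\<in>E. x (\<alpha> e) \<noteq> x e \<and> x (\<beta> e) \<noteq> x e"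
      by (rule two_involutions_2_colourable) (erule a_inv, erule b_inv)
    then obtain x :: "'e \<Rightarrow> bool" where x: "\<And>e. e \<in> E \<Longrightarrow> x (\<alpha> e) \<noteq> x e \<and> x (\<beta> e) \<noteq> x e"
      by blast
    \<comment> \<open>In the i-bit this is the translation \<rho> + y + x over the two-element
      field: it carries the solution y of the old system to the solution x of the new one.\<close>
    define \<Phi> where "\<Phi> \<rho> = (\<lambda>e\<in>E. if ((i \<in> \<rho> e) = (i \<in> y e)) = x e then insert i (\<rho> e) else \<rho> e - {i})" for \<rho>
    have Phi_i: "i \<in> \<Phi> \<rho> e \<longleftrightarrow> ((i \<in> \<rho> e) = (i \<in> y e)) = x e" if "e \<in> E" for \<rho> e
      using that by (auto simp: \<Phi>_def)
    have Phi_k: "\<Phi> \<rho> e - {i} = \<rho> e - {i}" if "e \<in> E" for \<rho> e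
      using that by (auto simp: \<Phi>_def)
    have "\<Phi> \<rho> \<in> ?Bk" if \<rho>: "\<rho> \<in> ?Ak" for \<rho>
    proof -
      have rk: "\<rho> e - {i} = y e - {i}" if "e \<in> E" for e
        using \<rho> k that by (metis (mono_tags, lifting) mem_Collect_eq restrict_apply')
      have rr: "e = e'" if "e \<in> E" "e' \<in> E" "r e = r e'" "\<rho> e = \<rho> e'" for e e'
        using \<rho> that unfolding shifted_colourings_def by blast
      have rc: "e = e'" if "e \<in> E" "e' \<in> E" "c e = c e'"
        "sym_diff (\<rho> e) (g e) = sym_diff (\<rho> e') (g e')" for e e'
        using \<rho> that unfolding shifted_colourings_def by blast
      have "\<Phi> \<rho> \<in> E \<rightarrow>\<^sub>E Pow J"
        using \<rho> i by (auto simp: shifted_colourings_def PiE_iff \<Phi>_def)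
      \<comment> \<open>Clashing edges of a row would be partners under \<alpha>. There the i-bits
        of \<rho>, y and x all differ, and a sum of three differences is again a difference.\<close>
      moreover have "e = e'" if e: "e \<in> E" "e' \<in> E" "r e = r e'" "\<Phi> \<rho> e = \<Phi> \<rho> e'" for e e'
      proof (rule ccontr)
        assume ne: "e \<noteq> e'"
        have eqk: "y e - {i} = y e' - {i}" using Phi_k rk e by metis
        have "y e' \<noteq> y e" using yr e ne by metis
        then have "y e' = sym_diff (y e) {i}" using eqk by blast
        then have e': "e' = \<alpha> e" using al e by (intro yr) auto
        have "\<rho> e - {i} = \<rho> e' - {i}" "\<rho> e' \<noteq> \<rho> e" using rk eqk e rr ne by metis+
        then have "(i \<in> \<rho> e) \<noteq> (i \<in> \<rho> e')" by blast
        moreover have "(i \<in> y e) \<noteq> (i \<in> y e')" using \<open>y e' = sym_diff (y e) {i}\<close> by blast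
        moreover have "x e \<noteq> x e'" using x e e' by metis
        ultimately have "(i \<in> \<Phi> \<rho> e) \<noteq> (i \<in> \<Phi> \<rho> e')" unfolding Phi_i[OF e(1)] Phi_i[OF e(2)] by blast
        then show False using e by metis
      qed
      \<comment> \<open>In a column the i-bits of \<rho> + g and of y + g differ between partners; g
        cancels in \<rho> + y, which is how the bit i disappears from the shift.\<close>
      moreover have "e = e'" if e: "e \<in> E" "e' \<in> E" "c e = c e'"
        "sym_diff (\<Phi> \<rho> e) (g e - {i}) = sym_diff (\<Phi> \<rho> e') (g e' - {i})" for e e'
      proof (rule ccontr)
        assume ne: "e \<noteq> e'"
        have "sym_diff (\<Phi> \<rho> e - {i}) (g e - {i}) = sym_diff (\<Phi> \<rho> e' - {i}) (g e' - {i})"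
          using e(4) by blast
        then have eqk: "sym_diff (y e - {i}) (g e - {i}) = sym_diff (y e' - {i}) (g e' - {i})"
          using Phi_k rk e by metis
        have "sym_diff (y e') (g e') \<noteq> sym_diff (y e) (g e)" using yc e ne by metis
        then have yi: "(i \<in> sym_diff (y e') (g e')) \<noteq> (i \<in> sym_diff (y e) (g e))"
          using eqk by blast
        then have *: "sym_diff (y e') (g e') = sym_diff (sym_diff (y e) (g e)) {i}" using eqk by blast
        have e': "e' = \<beta> e"
          by (rule yc) (use be[OF e(1)] e * in \<open>simp_all only:\<close>)
        have "sym_diff (\<rho> e - {i}) (g e - {i}) = sym_diff (\<rho> e' - {i}) (g e' - {i})"
          using eqk rk e by metis
        moreover have "sym_diff (\<rho> e') (g e') \<noteq> sym_diff (\<rho> e) (g e)" using rc e ne by metis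
        ultimately have ri: "(i \<in> sym_diff (\<rho> e') (g e')) \<noteq> (i \<in> sym_diff (\<rho> e) (g e))" by blast
        have "x e \<noteq> x e'" using x e e' by metis
        then have "(i \<in> \<Phi> \<rho> e) \<noteq> (i \<in> \<Phi> \<rho> e')"
          unfolding Phi_i[OF e(1)] Phi_i[OF e(2)] using yi ri by blast
        moreover have "(i \<in> \<Phi> \<rho> e) = (i \<in> \<Phi> \<rho> e')" using e(4) by blast
        ultimately show False by simp
      qed
      moreover have "?h (\<Phi> \<rho>) = k"
      proof -
        have "?h (\<Phi> \<rho>) = ?h \<rho>" by (intro restrict_ext Phi_k)
        then show ?thesis using \<rho> by simp
      qed
      ultimately show ?thesis unfolding shifted_colourings_def by blast
    qed
    moreover have "inj_on \<Phi> ?Ak"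
    proof (rule inj_onI)
      fix \<rho> \<sigma> assume r: "\<rho> \<in> ?Ak" "\<sigma> \<in> ?Ak" and eq: "\<Phi> \<rho> = \<Phi> \<sigma>"
      show "\<rho> = \<sigma>"
      proof (rule PiE_ext)
        show "\<rho> \<in> E \<rightarrow>\<^sub>E Pow J" "\<sigma> \<in> E \<rightarrow>\<^sub>E Pow J" using r by (auto simp: shifted_colourings_def)
        fix e assume e: "e \<in> E"
        have "\<rho> e - {i} = \<sigma> e - {i}" using Phi_k[OF e] eq by metis
        moreover have "(i \<in> \<rho> e) = (i \<in> \<sigma> e)" using Phi_i[OF e, of \<rho>] Phi_i[OF e, of \<sigma>] eq by auto
        ultimately show "\<rho> e = \<sigma> e" by blast
      qed
    qed
    ultimately show ?thesis
      by (intro card_inj_on_le[of \<Phi>]) (use finite_shifted_colourings[OF fin, of r c "\<lambda>e. g e - {i}"] in auto)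
  qed (simp only: card.empty le0)
qed

lemma shifted_colourings_cong:
  "(\<And>e. e \<in> E \<Longrightarrow> g e = g' e) \<Longrightarrow> shifted_colourings E r c J g = shifted_colourings E r c J g'"
  unfolding shifted_colourings_def by simp

lemma card_shifted_colourings_le_unshifted:
  assumes fin: "finite E" "finite J" and g: "\<And>e. e \<in> E \<Longrightarrow> g e \<subseteq> J"
    and row: "\<And>e. e \<in> E \<Longrightarrow> card {e'\<in>E. r e' = r e} = 2 ^ card J"
    and col: "\<And>e. e \<in> E \<Longrightarrow> card {e'\<in>E. c e' = c e} = 2 ^ card J"
  shows "card (shifted_colourings E r c J g) \<le> card (shifted_colourings E r c J (\<lambda>_. {}))"
proof -
  have "card (shifted_colourings E r c J g) \<le> card (shifted_colourings E r c J (\<lambda>e. g e - K))"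
    if "finite K" "K \<subseteq> J" for K
    using that
  proof (induction K rule: finite_induct)
    case (insert i K)
    have "card (shifted_colourings E r c J (\<lambda>e. g e - K))
        \<le> card (shifted_colourings E r c J (\<lambda>e. (g e - K) - {i}))"
      by (rule card_shifted_colourings_drop_bit[OF fin _ _ row col]) (use insert g in auto)
    also have "(\<lambda>e. (g e - K) - {i}) = (\<lambda>e. g e - insert i K)" by auto
    finally show ?case using insert by simp
  qed simp
  from this[OF fin(2)] show ?thesis
    using shifted_colourings_cong[of E "\<lambda>e. g e - J" "\<lambda>_. {}"] g by (metis Diff_eq_empty_iff order_refl)
qed

section \<open>The number of proper colourings\<close>

lemma fact_power_le_card_row_colourings:
  fixes r :: "'e \<Rightarrow> 'a"
  assumes fin: "finite E" "finite J"
    and row: "\<And>e. e \<in> E \<Longrightarrow> card {e'\<in>E. r e' = r e} = 2 ^ card J"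
  shows "fact (2 ^ card J) ^ card (r ` E) \<le>
    card {\<rho> \<in> E \<rightarrow>\<^sub>E Pow J. \<forall>e\<in>E. \<forall>e'\<in>E. r e = r e' \<and> \<rho> e = \<rho> e' \<longrightarrow> e = e'}"
    (is "_ \<le> card ?RB")
proof -
  define F where "F u = {e\<in>E. r e = u}" for u
  define I where "I u = {h \<in> F u \<rightarrow>\<^sub>E Pow J. inj_on h (F u)}" for u
  have finF: "finite (F u)" for u using fin by (simp add: F_def)
  have cardI: "card (I u) = fact (2 ^ card J)" if "u \<in> r ` E" for u
  proof -
    have "card (F u) = 2 ^ card J" using row that by (auto simp: F_def)
    then have "card (I u) = prod ((-) (2 ^ card J)) {0..<2 ^ card J}"
      using card_inj_on_subset_funcset[of "F u" "Pow J" "F u"] fin finF[of u]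
      by (simp add: card_Pow I_def)
    then show ?thesis by (simp add: fact_prod_rev)
  qed
  have "fact (2 ^ card J) ^ card (r ` E) = card (PiE (r ` E) I)"
    using fin cardI by (simp add: card_PiE)
  also have "\<dots> \<le> card ?RB"
  proof (rule card_inj_on_le)
    let ?\<Phi> = "\<lambda>H. \<lambda>e\<in>E. H (r e) e"
    show "finite ?RB" using fin by (simp add: finite_PiE)
    show "?\<Phi> ` PiE (r ` E) I \<subseteq> ?RB"
    proof (rule image_subsetI)
      fix H assume H: "H \<in> PiE (r ` E) I"
      have HI: "H (r e) \<in> I (r e)" if "e \<in> E" for e using H that by (auto simp: PiE_iff)
      have "e = e'" if "e \<in> E" "e' \<in> E" "r e = r e'" "H (r e) e = H (r e) e'" for e e'
      proof (rule inj_onD)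
        show "inj_on (H (r e)) (F (r e))" using HI[OF that(1)] by (simp add: I_def)
      qed (use that in \<open>auto simp: F_def\<close>)
      moreover have "H (r e) e \<subseteq> J" if "e \<in> E" for e
        using HI[OF that] that by (auto simp: I_def PiE_iff F_def)
      ultimately show "?\<Phi> H \<in> ?RB"
        by auto
    qed
    show "inj_on ?\<Phi> (PiE (r ` E) I)"
    proof (rule inj_onI)
      fix H H' assume H: "H \<in> PiE (r ` E) I" "H' \<in> PiE (r ` E) I" and eq: "?\<Phi> H = ?\<Phi> H'"
      show "H = H'"
      proof (rule PiE_ext[OF H])
        fix u assume u: "u \<in> r ` E"
        have "H u \<in> F u \<rightarrow>\<^sub>E Pow J" "H' u \<in> F u \<rightarrow>\<^sub>E Pow J"
          using PiE_mem[OF H(1) u] PiE_mem[OF H(2) u] by (simp_all add: I_def)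
        then show "H u = H' u"
        proof (rule PiE_ext)
          fix e assume "e \<in> F u"
          then have "e \<in> E" "r e = u" by (auto simp: F_def)
          then show "H u e = H' u e" using fun_cong[OF eq, of e] by simp
        qed
      qed
    qed
  qed
  finally show ?thesis .
qed

text \<open>A row-proper \<rho> and a column-proper \<gamma> are recorded as \<rho> together with
  the shift \<rho> + \<gamma>. There are \<open>(2 ^ card J) ^ card E\<close> shifts, and none has
  more colourings than the zero shift.\<close>

lemma fact_power_le_card_colourings:
  fixes r :: "'e \<Rightarrow> 'a" and c :: "'e \<Rightarrow> 'b"
  assumes fin: "finite E" "finite J"
    and row: "\<And>e. e \<in> E \<Longrightarrow> card {e'\<in>E. r e' = r e} = 2 ^ card J"
    and col: "\<And>e. e \<in> E \<Longrightarrow> card {e'\<in>E. c e' = c e} = 2 ^ card J"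
  shows "fact (2 ^ card J) ^ card (r ` E) * fact (2 ^ card J) ^ card (c ` E) \<le>
    (2 ^ card J) ^ card E * card (shifted_colourings E r c J (\<lambda>_. {}))"
proof -
  let ?RB = "{\<rho> \<in> E \<rightarrow>\<^sub>E Pow J. \<forall>e\<in>E. \<forall>e'\<in>E. r e = r e' \<and> \<rho> e = \<rho> e' \<longrightarrow> e = e'}"
  let ?CB = "{\<rho> \<in> E \<rightarrow>\<^sub>E Pow J. \<forall>e\<in>E. \<forall>e'\<in>E. c e = c e' \<and> \<rho> e = \<rho> e' \<longrightarrow> e = e'}"
  let ?S = "shifted_colourings E r c J"
  have "fact (2 ^ card J) ^ card (r ` E) * fact (2 ^ card J) ^ card (c ` E) \<le> card ?RB * card ?CB"
    by (intro mult_mono fact_power_le_card_row_colourings fin row col) auto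
  also have "\<dots> = card (?RB \<times> ?CB)" by (simp add: card_cartesian_product)
  also have "\<dots> \<le> card (SIGMA g:E \<rightarrow>\<^sub>E Pow J. ?S g)"
  proof (rule card_inj_on_le)
    let ?\<Phi> = "\<lambda>(\<rho>,\<gamma>). (\<lambda>e\<in>E. sym_diff (\<rho> e) (\<gamma> e), \<rho>)"
    show "finite (SIGMA g:E \<rightarrow>\<^sub>E Pow J. ?S g)"
      using fin by (intro finite_SigmaI finite_PiE finite_shifted_colourings) auto
    show "?\<Phi> ` (?RB \<times> ?CB) \<subseteq> (SIGMA g:E \<rightarrow>\<^sub>E Pow J. ?S g)"
    proof (intro image_subsetI)
      fix p assume "p \<in> ?RB \<times> ?CB"
      then obtain \<rho> \<gamma> where p: "p = (\<rho>, \<gamma>)" and r: "\<rho> \<in> E \<rightarrow>\<^sub>E Pow J" "\<forall>e\<in>E. \<forall>e'\<in>E. r e = r e' \<and> \<rho> e = \<rho> e' \<longrightarrow> e = e'"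
        and c: "\<gamma> \<in> E \<rightarrow>\<^sub>E Pow J" "\<forall>e\<in>E. \<forall>e'\<in>E. c e = c e' \<and> \<gamma> e = \<gamma> e' \<longrightarrow> e = e'"
        by auto
      have "(\<lambda>e\<in>E. sym_diff (\<rho> e) (\<gamma> e)) \<in> E \<rightarrow>\<^sub>E Pow J" using r(1) c(1) by (auto simp: PiE_iff)
      moreover have "sym_diff (\<rho> e) (sym_diff (\<rho> e) (\<gamma> e)) = \<gamma> e" for e by blast
      then have "\<rho> \<in> ?S (\<lambda>e\<in>E. sym_diff (\<rho> e) (\<gamma> e))"
        using r c unfolding shifted_colourings_def by auto
      ultimately show "?\<Phi> p \<in> (SIGMA g:E \<rightarrow>\<^sub>E Pow J. ?S g)" unfolding p by auto
    qed
    show "inj_on ?\<Phi> (?RB \<times> ?CB)"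
    proof (rule inj_onI)
      fix p q assume "p \<in> ?RB \<times> ?CB" "q \<in> ?RB \<times> ?CB" and pq: "?\<Phi> p = ?\<Phi> q"
      then obtain \<rho> \<gamma> \<gamma>' where p: "p = (\<rho>, \<gamma>)" "q = (\<rho>, \<gamma>')"
        and g: "\<gamma> \<in> E \<rightarrow>\<^sub>E Pow J" "\<gamma>' \<in> E \<rightarrow>\<^sub>E Pow J" by auto
      have eq: "(\<lambda>e\<in>E. sym_diff (\<rho> e) (\<gamma> e)) = (\<lambda>e\<in>E. sym_diff (\<rho> e) (\<gamma>' e))"
        using pq p by simp
      have "\<gamma> = \<gamma>'"
      proof (rule PiE_ext[OF g])
        fix e assume "e \<in> E"
        then have "sym_diff (\<rho> e) (\<gamma> e) = sym_diff (\<rho> e) (\<gamma>' e)" using fun_cong[OF eq, of e] by simp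
        then show "\<gamma> e = \<gamma>' e" by blast
      qed
      then show "p = q" using p by simp
    qed
  qed
  also have "\<dots> = (\<Sum>g\<in>E \<rightarrow>\<^sub>E Pow J. card (?S g))"
    using fin by (intro card_SigmaI) (auto intro!: finite_PiE finite_shifted_colourings)
  also have "\<dots> \<le> (\<Sum>g\<in>E \<rightarrow>\<^sub>E Pow J. card (?S (\<lambda>_. {})))"
    by (intro sum_mono card_shifted_colourings_le_unshifted fin row col) (auto simp: PiE_iff)
  also have "\<dots> = (2 ^ card J) ^ card E * card (?S (\<lambda>_. {}))"
    using fin by (simp add: card_funcsetE card_Pow)
  finally show ?thesis .
qed

text \<open>A single term of the exponential series at n, together with e <= 3.\<close>

lemma power_le_3_power_fact: "real n ^ n \<le> 3 ^ n * fact n"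
proof -
  have "inverse (fact n) *\<^sub>R real n ^ n = (\<Sum>k\<in>{n}. inverse (fact k) *\<^sub>R real n ^ k)" by simp
  also have "\<dots> \<le> (\<Sum>k. inverse (fact k) *\<^sub>R real n ^ k)"
    by (intro sum_le_suminf summable_exp_generic) auto
  also have "\<dots> = exp (real n)" by (simp add: exp_def)
  also have "\<dots> = exp 1 ^ n" by (simp flip: exp_of_nat_mult)
  also have "\<dots> \<le> 3 ^ n" by (intro power_mono exp_le) auto
  finally show ?thesis by (simp add: field_simps)
qed

text \<open>By \<open>fact N\<close> >= (N/3)^N, the quotient of (N!)^(2n) by N^(nN) is at least
  (N/3)^(2nN) / N^(nN) = (N/9)^(nN).\<close>

lemma card_colourings_ge:
  fixes r :: "'e \<Rightarrow> 'a" and c :: "'e \<Rightarrow> 'b"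
  assumes fin: "finite E" "finite J" and N: "N = 2 ^ card J"
    and row: "\<And>e. e \<in> E \<Longrightarrow> card {e'\<in>E. r e' = r e} = N"
    and col: "\<And>e. e \<in> E \<Longrightarrow> card {e'\<in>E. c e' = c e} = N"
    and n: "card (r ` E) = n" "card (c ` E) = n" "card E = n * N"
  shows "(real N / 9) ^ (n * N) \<le> card (shifted_colourings E r c J (\<lambda>_. {}))"
proof -
  let ?C = "card (shifted_colourings E r c J (\<lambda>_. {}))"
  have N0: "real N > 0" using N by simp
  have "fact N ^ n * fact N ^ n \<le> N ^ (n * N) * ?C"
    using fact_power_le_card_colourings[OF fin row[unfolded N] col[unfolded N]] n N by simp
  then have "real (fact N ^ n * fact N ^ n) \<le> real (N ^ (n * N) * ?C)" by (rule of_nat_mono)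
  then have 1: "(fact N ^ n)\<^sup>2 \<le> real N ^ (n * N) * ?C" by (simp add: power2_eq_square)
  have "(real N ^ (n * N))\<^sup>2 = ((real N ^ N) ^ n)\<^sup>2" by (simp add: mult.commute flip: power_mult)
  also have "\<dots> \<le> ((3 ^ N * fact N) ^ n)\<^sup>2"
    by (intro power_mono power_le_3_power_fact) auto
  also have "\<dots> = 9 ^ (n * N) * (fact N ^ n)\<^sup>2"
  proof -
    have "(((3::real) ^ N) ^ n)\<^sup>2 = (3\<^sup>2) ^ (n * N)" by (simp only: mult_ac flip: power_mult)
    then show ?thesis by (simp add: power_mult_distrib)
  qed
  also have "\<dots> \<le> 9 ^ (n * N) * (real N ^ (n * N) * ?C)" using 1 by (intro mult_left_mono) auto
  finally have "(real N ^ (n * N))\<^sup>2 \<le> 9 ^ (n * N) * (real N ^ (n * N) * ?C)" .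
  moreover have "0 < real N ^ (n * N)" by (rule zero_less_power[OF N0])
  ultimately have "real N ^ (n * N) \<le> 9 ^ (n * N) * real ?C"
    by (simp add: power2_eq_square mult.left_commute[of "9 ^ (n * N)"])
  then show ?thesis by (simp add: power_divide field_simps)
qed

subsection \<open>Latin squares\<close>

definition latin_funs :: "nat \<Rightarrow> (nat \<times> nat \<Rightarrow> nat) set" where
  "latin_funs n = {M \<in> {..<n} \<times> {..<n} \<rightarrow>\<^sub>E {..<n}.
     (\<forall>x<n. inj_on (\<lambda>y. M (x, y)) {..<n}) \<and> (\<forall>y<n. inj_on (\<lambda>x. M (x, y)) {..<n})}"

lemma finite_latin_funs [simp]: "finite (latin_funs n)"
  unfolding latin_funs_def by (simp add: finite_PiE)

lemma cyclic_shift_inj: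
  fixes n :: nat
  assumes "(x + y) mod n = (x + y') mod n" "y < n" "y' < n"
  shows "y = y'"
proof -
  have *: "a = b" if "(x + a) mod n = (x + b) mod n" "a \<le> b" "b < n" for a b
  proof -
    have "n dvd b - a" using that mod_eq_dvd_iff_nat[of "x + a" "x + b" n] by simp
    moreover have "b - a < n" using that by simp
    ultimately have "b - a = 0" by (meson dvd_imp_le linorder_not_less not_gr0)
    then show ?thesis using that by simp
  qed
  show ?thesis using *[of y y'] *[of y' y] assms by (metis nat_le_linear)
qed

text \<open>Hence the cells of the cyclic square whose symbol lies in one band form a bipartite
  graph that is regular of degree N; since x + y is symmetric, the same count serves rows and
  columns.\<close>

lemma card_cyclic_band:
  fixes n N :: nat
  assumes x: "x < n" and i: "Suc i * N \<le> n" and N: "N > 0"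
  shows "card {y. y < n \<and> ((x + y) mod n) div N = i} = N"
proof -
  let ?f = "\<lambda>y. (x + y) mod n"
  have inj: "inj_on ?f {..<n}" by (auto intro!: inj_onI dest: cyclic_shift_inj)
  have im: "?f ` {..<n} = {..<n}"
    by (rule card_subset_eq) (use x in \<open>auto simp: card_image[OF inj]\<close>)
  have "?f ` {y. y < n \<and> ((x + y) mod n) div N = i} = {s\<in>?f ` {..<n}. s div N = i}" by auto
  also have "\<dots> = {s. s < n \<and> s div N = i}" unfolding im by auto
  also have "\<dots> = {i * N..<Suc i * N}"
  proof (intro set_eqI iffI)
    fix s assume "s \<in> {i * N..<Suc i * N}"
    then show "s \<in> {s. s < n \<and> s div N = i}" using i N by (auto simp: div_nat_eqI mult.commute)
  next
    fix s assume "s \<in> {s. s < n \<and> s div N = i}"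
    then show "s \<in> {i * N..<Suc i * N}" using N
      by (auto simp: dividend_less_times_div mult.commute[of _ N])
  qed
  finally have "card (?f ` {y. y < n \<and> ((x + y) mod n) div N = i}) = N" by simp
  moreover have "inj_on ?f {y. y < n \<and> ((x + y) mod n) div N = i}"
    using inj by (rule inj_on_subset) auto
  ultimately show ?thesis by (simp add: card_image)
qed

text \<open>The cyclic square is cut into bands of \<open>2 ^ j\<close> consecutive symbols, and the symbols inside
  each band are redistributed independently.\<close>

lemma card_latin_funs_ge_bands:
  assumes N: "N = 2 ^ j" and q: "q * N \<le> n" and n: "n > 0"
  shows "(real N / 9) ^ (n * N * q) \<le> card (latin_funs n)"
proof -
  have N0: "N > 0" using N by simp
  define E where "E i = {(x, y). x < n \<and> y < n \<and> ((x + y) mod n) div N = i}" for i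
  let ?S = "\<lambda>i. shifted_colourings (E i) fst snd {..<j} (\<lambda>_. {})"
  have E_sub: "E i \<subseteq> {..<n} \<times> {..<n}" for i by (auto simp: E_def)
  have finE: "finite (E i)" for i using E_sub by (rule finite_subset) auto
  have S_ge: "(real N / 9) ^ (n * N) \<le> card (?S i)" if i: "i < q" for i
  proof (rule card_colourings_ge)
    have iN: "Suc i * N \<le> n" using i q by (meson Suc_leI le_trans mult_le_mono1)
    show "finite (E i)" "finite {..<j}" "N = 2 ^ card {..<j}" using finE N by auto
    have row: "card {e'\<in>E i. fst e' = x} = N" if "x < n" for x
    proof -
      have "{e'\<in>E i. fst e' = x} = Pair x ` {y. y < n \<and> ((x + y) mod n) div N = i}"
        using that by (auto simp: E_def)
      then show ?thesis using card_cyclic_band[OF that iN N0] by (simp add: card_image inj_on_def)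
    qed
    have col: "card {e'\<in>E i. snd e' = y} = N" if "y < n" for y
    proof -
      have "{e'\<in>E i. snd e' = y} = (\<lambda>x. (x, y)) ` {x. x < n \<and> ((y + x) mod n) div N = i}"
        using that by (auto simp: E_def add.commute)
      then show ?thesis using card_cyclic_band[OF that iN N0] by (simp add: card_image inj_on_def)
    qed
    show "card {e'\<in>E i. fst e' = fst e} = N" if "e \<in> E i" for e
      using that by (intro row) (auto simp: E_def)
    show "card {e'\<in>E i. snd e' = snd e} = N" if "e \<in> E i" for e
      using that by (intro col) (auto simp: E_def)
    have "fst ` E i = {..<n}"
    proof
      show "{..<n} \<subseteq> fst ` E i"
      proof
        fix x assume "x \<in> {..<n}"
        then have "{e'\<in>E i. fst e' = x} \<noteq> {}" using row[of x] N0 by (metis card.empty lessThan_iff not_gr0)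
        then show "x \<in> fst ` E i" by force
      qed
    qed (auto simp: E_def)
    then show "card (fst ` E i) = n" by simp
    have "snd ` E i = {..<n}"
    proof
      show "{..<n} \<subseteq> snd ` E i"
      proof
        fix x assume "x \<in> {..<n}"
        then have "{e'\<in>E i. snd e' = x} \<noteq> {}" using col[of x] N0 by (metis card.empty lessThan_iff not_gr0)
        then show "x \<in> snd ` E i" by force
      qed
    qed (auto simp: E_def)
    then show "card (snd ` E i) = n" by simp
    have "E i = (SIGMA x:{..<n}. {y. y < n \<and> ((x + y) mod n) div N = i})" by (auto simp: E_def)
    then show "card (E i) = n * N" using card_cyclic_band[OF _ iN N0] by (simp add: card_SigmaI)
  qed
  have "card (Pow {..<j}) = card {..<N}" by (simp add: card_Pow N)
  then obtain h where h: "bij_betw h (Pow {..<j}) {..<N}"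
    using finite_same_card_bij[of "Pow {..<j}" "{..<N}"] by auto
  \<comment> \<open>Cells with a cyclic symbol from \<open>q * N\<close> on keep it. Inside band i
    the new symbol is the colour of the cell, numbered by h and moved to the band.\<close>
  define \<Phi> where "\<Phi> \<rho> = (\<lambda>(x, y)\<in>{..<n} \<times> {..<n}. let s = (x + y) mod n in
      if s div N < q then N * (s div N) + h (\<rho> (s div N) (x, y)) else s)" for \<rho>
  have "(real N / 9) ^ (n * N * q) = (\<Prod>i<q. (real N / 9) ^ (n * N))"
    by (simp add: power_mult)
  also have "\<dots> \<le> (\<Prod>i<q. real (card (?S i)))"
    using S_ge by (intro prod_mono) auto
  also have "\<dots> = real (card (PiE {..<q} ?S))" by (simp add: card_PiE)
  also have "card (PiE {..<q} ?S) \<le> card (latin_funs n)"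
  proof (rule card_inj_on_le)
    have props: "h (\<rho> i e) < N"
        "e' \<in> E i \<Longrightarrow> h (\<rho> i e) = h (\<rho> i e') \<Longrightarrow> fst e = fst e' \<or> snd e = snd e' \<Longrightarrow> e = e'"
      if \<rho>: "\<rho> \<in> PiE {..<q} ?S" and i: "i < q" and e: "e \<in> E i" for \<rho> i e e'
    proof -
      have S: "\<rho> i \<in> ?S i" using \<rho> i by auto
      then have P: "\<rho> i e \<in> Pow {..<j}" if "e \<in> E i" for e
        using that by (auto simp: shifted_colourings_def PiE_iff)
      then show "h (\<rho> i e) < N" using bij_betw_apply[OF h P[OF e]] by simp
      assume e': "e' \<in> E i" "h (\<rho> i e) = h (\<rho> i e')" "fst e = fst e' \<or> snd e = snd e'"
      then have "\<rho> i e = \<rho> i e'" using inj_onD[OF bij_betw_imp_inj_on[OF h] _ P P] e by blast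
      then show "e = e'" using S e e' by (auto simp: shifted_colourings_def)
    qed
    have val: "\<Phi> \<rho> (x, y) = (if (x + y) mod n div N < q
        then N * ((x + y) mod n div N) + h (\<rho> ((x + y) mod n div N) (x, y)) else (x + y) mod n)"
      if "x < n" "y < n" for \<rho> x y using that by (simp add: \<Phi>_def Let_def)
    \<comment> \<open>No cell leaves its band, so two cells with equal new symbols lie in the same
      band, where properness of one colouring, or the cyclic square itself, separates them.\<close>
    have div: "\<Phi> \<rho> (x, y) div N = (x + y) mod n div N" and lt: "\<Phi> \<rho> (x, y) < n"
      if \<rho>: "\<rho> \<in> PiE {..<q} ?S" and xy: "x < n" "y < n" for \<rho> x y
    proof -
      let ?i = "(x + y) mod n div N"
      have e: "(x, y) \<in> E ?i" using xy by (simp add: E_def)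
      have "\<Phi> \<rho> (x, y) div N = ?i \<and> \<Phi> \<rho> (x, y) < n"
      proof (cases "?i < q")
        case True
        have "h (\<rho> ?i (x, y)) < N" by (rule props(1)[OF \<rho> True e])
        moreover have "N * ?i + N \<le> n"
          using True q by (metis Suc_leI le_trans mult.commute mult_Suc_right mult_le_mono2 add.commute)
        ultimately show ?thesis using True xy N0 by (simp add: val)
      qed (use xy n in \<open>simp add: val\<close>)
      then show "\<Phi> \<rho> (x, y) div N = ?i" "\<Phi> \<rho> (x, y) < n" by auto
    qed
    show "\<Phi> ` PiE {..<q} ?S \<subseteq> latin_funs n"
    proof (rule image_subsetI)
      fix \<rho> assume \<rho>: "\<rho> \<in> PiE {..<q} ?S"
      have key: "x = x' \<and> y = y'" if xy: "x < n" "y < n" "x' < n" "y' < n" and eq: "\<Phi> \<rho> (x, y) = \<Phi> \<rho> (x', y')"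
        and or: "x = x' \<or> y = y'" for x y x' y'
      proof -
        let ?i = "(x + y) mod n div N"
        have i: "(x' + y') mod n div N = ?i" using div[OF \<rho> xy(1,2)] div[OF \<rho> xy(3,4)] eq by simp
        have e: "(x, y) \<in> E ?i" "(x', y') \<in> E ?i" using xy i by (auto simp: E_def)
        show ?thesis
        proof (cases "?i < q")
          case True
          then have "h (\<rho> ?i (x, y)) = h (\<rho> ?i (x', y'))" using eq xy i by (simp add: val)
          then show ?thesis using props(2)[OF \<rho> True e] or by auto
        next
          case False
          then have "(x + y) mod n = (x' + y') mod n" using eq xy i by (simp add: val)
          then have "x = x' \<Longrightarrow> y = y'" "y = y' \<Longrightarrow> x = x'"
            using xy cyclic_shift_inj[of x y n y'] cyclic_shift_inj[of y x n x']
            by (simp_all add: add.commute)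
          then show ?thesis using or by blast
        qed
      qed
      have "\<Phi> \<rho> \<in> {..<n} \<times> {..<n} \<rightarrow>\<^sub>E {..<n}"
        using lt[OF \<rho>] by (auto simp: PiE_iff) (simp add: \<Phi>_def)
      then show "\<Phi> \<rho> \<in> latin_funs n"
        using key unfolding latin_funs_def by (auto intro!: inj_onI)
    qed
    show "inj_on \<Phi> (PiE {..<q} ?S)"
    proof (rule inj_onI)
      fix \<rho> \<sigma> assume \<rho>: "\<rho> \<in> PiE {..<q} ?S" and \<sigma>: "\<sigma> \<in> PiE {..<q} ?S" and eq: "\<Phi> \<rho> = \<Phi> \<sigma>"
      show "\<rho> = \<sigma>"
      proof (rule PiE_ext[OF \<rho> \<sigma>])
        fix i assume "i \<in> {..<q}"
        then have i: "i < q" by simp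
        have S: "\<rho> i \<in> E i \<rightarrow>\<^sub>E Pow {..<j}" "\<sigma> i \<in> E i \<rightarrow>\<^sub>E Pow {..<j}"
          using PiE_mem[OF \<rho>, of i] PiE_mem[OF \<sigma>, of i] i by (auto simp: shifted_colourings_def)
        show "\<rho> i = \<sigma> i"
        proof (rule PiE_ext[OF S])
          fix e assume e: "e \<in> E i"
          obtain x y where xy: "e = (x, y)" "x < n" "y < n" "(x + y) mod n div N = i"
            using e by (auto simp: E_def)
          have "h (\<rho> i e) = h (\<sigma> i e)" using fun_cong[OF eq, of e] xy i by (simp add: val)
          moreover have "\<rho> i e \<in> Pow {..<j}" "\<sigma> i e \<in> Pow {..<j}"
            using PiE_mem[OF S(1) e] PiE_mem[OF S(2) e] by auto
          ultimately show "\<rho> i e = \<sigma> i e" using inj_onD[OF bij_betw_imp_inj_on[OF h]] by blast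
        qed
      qed
    qed
  qed simp
  finally show ?thesis by simp
qed

text \<open>144 = 16 * 9: the band width chosen below exceeds n/16, and each cell contributes a
  factor N/9.\<close>

lemma ln_144_le: "ln (144::real) \<le> 6"
proof -
  have "(144::real) \<le> (1 + 1 + 1\<^sup>2 / 2) ^ 6" by (simp add: eval_nat_numeral)
  also have "\<dots> \<le> exp 1 ^ 6" by (intro power_mono exp_lower_Taylor_quadratic) auto
  also have "\<dots> = exp (6::real)" by (simp flip: exp_of_nat_mult)
  finally show ?thesis by (metis exp_gt_zero ln_exp ln_le_cancel_iff zero_less_numeral)
qed

text \<open>The band width N is the power of 2 with n/16 < N <= n/8. The bands leave out fewer than
  N <= n/8 symbols, so at least 7/8 of all n^2 cells contribute a factor N/9 >= n/144 each. Smaller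
  bands would bring the exponent closer to 1 at the cost of a worse constant.\<close>

lemma card_latin_funs_ge:
  assumes n: "n \<ge> 1"
  shows "exp (7/8 * (real n)\<^sup>2 * (ln n - 6)) \<le> card (latin_funs n)"
proof (cases "n < 144")
  case True
  have "ln (real n) \<le> ln 144" using n True by (intro ln_mono) auto
  also have "\<dots> \<le> 6" by (rule ln_144_le)
  finally have "exp (7/8 * (real n)\<^sup>2 * (ln n - 6)) \<le> exp 0"
    by (simp add: mult_le_0_iff)
  \<comment> \<open>Here the asserted bound is at most 1, and the band estimate with q = 0 bands
    gives just the existence of the cyclic square.\<close>
  also have "\<dots> \<le> real (card (latin_funs n))"
    using card_latin_funs_ge_bands[of 1 0 0 n] n by simp
  finally show ?thesis .
next
  case False
  define j where "j = (LEAST j. n < 16 * 2 ^ j)"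
  have ex: "\<exists>j. n < 16 * 2 ^ j"
    by (rule exI[of _ n]) (metis less_exp less_le_trans mult.commute mult_le_mono2 mult_1_right
      one_le_numeral)
  have j1: "n < 16 * 2 ^ j" unfolding j_def by (rule LeastI_ex[OF ex])
  have j0: "j > 0" using j1 False by (cases j) auto
  have "\<not> n < 16 * 2 ^ (j - 1)" using not_less_Least[of "j - 1" "\<lambda>j. n < 16 * 2 ^ j"] j0
    by (simp add: j_def)
  then have j2: "8 * 2 ^ j \<le> n" using j0 by (cases j) auto
  define N :: nat where "N = 2 ^ j"
  define q where "q = n div N"
  have N: "n < 16 * N" "8 * N \<le> n" "N > 0" using j1 j2 by (auto simp: N_def)
  have "N * q + n mod N = n" "n mod N < N" using N(3) by (simp_all add: q_def)
  then have qN: "N * q \<le> n" "n < N * q + N" by linarith+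
  have "7 * n \<le> 8 * (N * q)" using qN N by linarith
  then have qN': "7/8 * real n \<le> real (N * q)" by linarith
  have base: "real n / 144 \<le> real N / 9" "1 \<le> real n / 144" using N False by auto
  have "7/8 * (real n)\<^sup>2 * (ln n - 6) \<le> 7/8 * (real n)\<^sup>2 * (ln n - ln 144)"
    using ln_144_le by (intro mult_left_mono) auto
  also have "\<dots> = (7/8 * real n) * (real n * ln (real n / 144))"
    using n by (simp add: ln_div power2_eq_square)
  also have "\<dots> \<le> real (N * q) * (real n * ln (real n / 144))"
    using qN' base by (intro mult_right_mono) auto
  also have "\<dots> = real (n * N * q) * ln (real n / 144)" by simp
  finally have "exp (7/8 * (real n)\<^sup>2 * (ln n - 6)) \<le> exp (real (n * N * q) * ln (real n / 144))"
    by simp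
  also have "\<dots> = (real n / 144) ^ (n * N * q)"
    using base by (subst exp_of_nat_mult) auto
  also have "\<dots> \<le> (real N / 9) ^ (n * N * q)" using base by (intro power_mono) auto
  also have "\<dots> \<le> card (latin_funs n)"
    using qN n by (intro card_latin_funs_ge_bands[OF N_def]) (auto simp: mult.commute)
  finally show ?thesis .
qed

lemma card_le_mult_by_inj:
  assumes "inj_on f A" "f ` A \<subseteq> B \<times> C" "finite B" "finite C"
  shows "card A \<le> card B * card C"
  using card_inj_on_le[OF assms(1,2)] assms(3,4) by (simp add: card_cartesian_product)

lemma card_self_maps: "card ({..<n::nat} \<rightarrow>\<^sub>E {..<n}) = n ^ n"
  by (simp add: card_funcsetE)

lemma latin_funsD:
  assumes "M \<in> latin_funs n"
  shows "M \<in> {..<n} \<times> {..<n} \<rightarrow>\<^sub>E {..<n}"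
    "\<And>x y. x < n \<Longrightarrow> y < n \<Longrightarrow> M (x, y) < n"
    "\<And>x y y'. x < n \<Longrightarrow> y < n \<Longrightarrow> y' < n \<Longrightarrow> M (x, y) = M (x, y') \<Longrightarrow> y = y'"
    "\<And>x x' y. x < n \<Longrightarrow> x' < n \<Longrightarrow> y < n \<Longrightarrow> M (x, y) = M (x', y) \<Longrightarrow> x = x'"
proof -
  show *: "M \<in> {..<n} \<times> {..<n} \<rightarrow>\<^sub>E {..<n}" using assms by (simp add: latin_funs_def)
  show "\<And>x y. x < n \<Longrightarrow> y < n \<Longrightarrow> M (x, y) < n" using PiE_mem[OF *] by simp
  show "y = y'" if "x < n" "y < n" "y' < n" "M (x, y) = M (x, y')" for x y y'
    using assms that inj_onD[of "\<lambda>y. M (x, y)" "{..<n}" y y'] by (simp add: latin_funs_def)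
  show "x = x'" if "x < n" "x' < n" "y < n" "M (x, y) = M (x', y)" for x x' y
    using assms that inj_onD[of "\<lambda>x. M (x, y)" "{..<n}" x x'] by (simp add: latin_funs_def)
qed

lemma latin_funsI:
  assumes "M \<in> {..<n} \<times> {..<n} \<rightarrow>\<^sub>E {..<n}"
    "\<And>x y y'. x < n \<Longrightarrow> y < n \<Longrightarrow> y' < n \<Longrightarrow> M (x, y) = M (x, y') \<Longrightarrow> y = y'"
    "\<And>x x' y. x < n \<Longrightarrow> x' < n \<Longrightarrow> y < n \<Longrightarrow> M (x, y) = M (x', y) \<Longrightarrow> x = x'"
  shows "M \<in> latin_funs n"
  unfolding latin_funs_def using assms by (simp add: inj_on_def)

lemma square_fun_ext:
  assumes "M \<in> {..<n::nat} \<times> {..<n} \<rightarrow>\<^sub>E B" "M' \<in> {..<n} \<times> {..<n} \<rightarrow>\<^sub>E B"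
    "\<And>x y. x < n \<Longrightarrow> y < n \<Longrightarrow> M (x, y) = M' (x, y)"
  shows "M = M'"
proof (rule PiE_ext[OF assms(1,2)])
  fix p assume "p \<in> {..<n} \<times> {..<n}"
  then show "M p = M' p" using assms(3)[of "fst p" "snd p"] by (simp add: mem_Times_iff)
qed

lemma inj_self_map_bij:
  fixes n :: nat
  assumes "\<And>x. x < n \<Longrightarrow> f x < n" "\<And>x x'. x < n \<Longrightarrow> x' < n \<Longrightarrow> f x = f x' \<Longrightarrow> x = x'"
  shows "bij_betw f {..<n} {..<n}"
proof -
  have "inj_on f {..<n}" using assms(2) by (simp add: inj_on_def)
  moreover have "f ` {..<n} = {..<n}"
    by (rule endo_inj_surj) (use assms(1) calculation in auto)
  ultimately show ?thesis by (simp add: bij_betw_def)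
qed

lemma inj_self_map_surj:
  fixes n :: nat
  assumes "\<And>x. x < n \<Longrightarrow> f x < n" "\<And>x x'. x < n \<Longrightarrow> x' < n \<Longrightarrow> f x = f x' \<Longrightarrow> x = x'" "y < n"
  shows "\<exists>x<n. f x = y"
  using bij_betw_imp_surj_on[OF inj_self_map_bij[of n f, OF assms(1,2)]] assms(3)
  by (metis imageE lessThan_iff)

subsection \<open>Symmetric Latin squares with prescribed diagonal\<close>

definition sym_latin :: "nat \<Rightarrow> (nat \<Rightarrow> nat) \<Rightarrow> (nat \<times> nat \<Rightarrow> nat) set" where
  "sym_latin n d = {M \<in> {..<n} \<times> {..<n} \<rightarrow>\<^sub>E {..<n}.
     (\<forall>x<n. \<forall>y<n. \<forall>y'<n. M (x, y) = M (x, y') \<longrightarrow> y = y') \<and>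
     (\<forall>x<n. \<forall>y<n. M (x, y) = M (y, x)) \<and> (\<forall>x<n. M (x, x) = d x)}"

lemma finite_sym_latin [simp]: "finite (sym_latin n d)"
  unfolding sym_latin_def by (simp add: finite_PiE)

lemma sym_latinD:
  assumes "M \<in> sym_latin n d"
  shows "M \<in> {..<n} \<times> {..<n} \<rightarrow>\<^sub>E {..<n}"
    "\<And>x y. x < n \<Longrightarrow> y < n \<Longrightarrow> M (x, y) < n"
    "\<And>x y y'. x < n \<Longrightarrow> y < n \<Longrightarrow> y' < n \<Longrightarrow> M (x, y) = M (x, y') \<Longrightarrow> y = y'"
    "\<And>x y. x < n \<Longrightarrow> y < n \<Longrightarrow> M (x, y) = M (y, x)"
    "\<And>x. x < n \<Longrightarrow> M (x, x) = d x"
proof -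
  show *: "M \<in> {..<n} \<times> {..<n} \<rightarrow>\<^sub>E {..<n}" using assms by (simp add: sym_latin_def)
  show "\<And>x y. x < n \<Longrightarrow> y < n \<Longrightarrow> M (x, y) < n" using PiE_mem[OF *] by simp
qed (use assms in \<open>simp_all add: sym_latin_def\<close>)

section \<open>Doubling: symmetric block matrices with rows (A, B) and (B^T, C)\<close>

definition sym_block :: "nat \<Rightarrow> (nat \<times> nat \<Rightarrow> nat) \<Rightarrow> (nat \<times> nat \<Rightarrow> nat) \<Rightarrow> (nat \<times> nat \<Rightarrow> nat)
    \<Rightarrow> nat \<times> nat \<Rightarrow> nat" where
  "sym_block m A B C = (\<lambda>(x, y)\<in>{..<2 * m} \<times> {..<2 * m}.
     if x < m then (if y < m then A (x, y) else B (x, y - m))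
     else (if y < m then B (y, x - m) else C (x - m, y - m)))"

lemma sym_block_simps:
  assumes "x < m" "y < m"
  shows "sym_block m A B C (x, y) = A (x, y)" "sym_block m A B C (x, m + y) = B (x, y)"
    "sym_block m A B C (m + x, y) = B (y, x)" "sym_block m A B C (m + x, m + y) = C (x, y)"
  using assms by (auto simp: sym_block_def)

lemma less_double_cases:
  fixes x m :: nat
  assumes "x < 2 * m"
  obtains "x < m" | z where "z < m" "x = m + z"
proof (cases "x < m")
  case False
  then have "x - m < m" "x = m + (x - m)" using assms by linarith+
  then show ?thesis using that(2) by blast
qed (use that(1) in blast)

lemma sym_block_in_sym_latin:
  assumes bound: "\<And>x y. x < m \<Longrightarrow> y < m \<Longrightarrow> A (x, y) < 2 * m \<and> B (x, y) < 2 * m \<and> C (x, y) < 2 * m"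
    and sym: "\<And>x y. x < m \<Longrightarrow> y < m \<Longrightarrow> A (x, y) = A (y, x) \<and> C (x, y) = C (y, x)"
    and inj: "\<And>x y z. x < m \<Longrightarrow> y < m \<Longrightarrow> z < m \<Longrightarrow> y \<noteq> z \<Longrightarrow>
      A (x, y) \<noteq> A (x, z) \<and> B (x, y) \<noteq> B (x, z) \<and> B (y, x) \<noteq> B (z, x) \<and> C (x, y) \<noteq> C (x, z)"
    and disj: "\<And>x y z. x < m \<Longrightarrow> y < m \<Longrightarrow> z < m \<Longrightarrow> A (x, y) \<noteq> B (x, z) \<and> C (x, y) \<noteq> B (z, x)"
    and diag: "\<And>x. x < m \<Longrightarrow> A (x, x) = d x \<and> C (x, x) = d (m + x)"
  shows "sym_block m A B C \<in> sym_latin (2 * m) d"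
proof -
  let ?M = "sym_block m A B C"
  have "?M (x, y) < 2 * m" if "x < 2 * m" "y < 2 * m" for x y
    using that by (elim less_double_cases) (use bound in \<open>auto simp: sym_block_simps\<close>)
  then have "?M \<in> {..<2 * m} \<times> {..<2 * m} \<rightarrow>\<^sub>E {..<2 * m}"
    by (auto simp: PiE_iff) (simp add: sym_block_def)
  moreover have "y = z" if "x < 2 * m" "y < 2 * m" "z < 2 * m" "?M (x, y) = ?M (x, z)" for x y z
  proof (rule ccontr)
    assume ne: "y \<noteq> z"
    have "?M (x, y) \<noteq> ?M (x, z)"
      using that(1)
    proof (cases rule: less_double_cases)
      case 1
      from that(2) show ?thesis
      proof (cases rule: less_double_cases)
        case y: 1
        from that(3) show ?thesis
        proof (cases rule: less_double_cases)
          case z: 1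
          show ?thesis using inj[OF 1 y z] ne by (simp add: sym_block_simps 1 y z)
        next
          case z: (2 z')
          show ?thesis using disj[OF 1 y z(1)] by (simp add: sym_block_simps 1 y z)
        qed
      next
        case y: (2 y')
        from that(3) show ?thesis
        proof (cases rule: less_double_cases)
          case z: 1
          show ?thesis using disj[OF 1 z y(1)] by (simp add: sym_block_simps 1 y z)
        next
          case z: (2 z')
          show ?thesis using inj[OF 1 y(1) z(1)] ne by (simp add: sym_block_simps 1 y z)
        qed
      qed
    next
      case x: (2 x')
      from that(2) show ?thesis
      proof (cases rule: less_double_cases)
        case y: 1
        from that(3) show ?thesis
        proof (cases rule: less_double_cases)
          case z: 1
          show ?thesis using inj[OF x(1) y z] ne by (simp add: sym_block_simps x y z)
        next
          case z: (2 z')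
          show ?thesis using disj[OF x(1) z(1) y] by (simp add: sym_block_simps x y z)
        qed
      next
        case y: (2 y')
        from that(3) show ?thesis
        proof (cases rule: less_double_cases)
          case z: 1
          show ?thesis using disj[OF x(1) y(1) z] by (simp add: sym_block_simps x y z)
        next
          case z: (2 z')
          show ?thesis using inj[OF x(1) y(1) z(1)] ne by (simp add: sym_block_simps x y z)
        qed
      qed
    qed
    then show False using that(4) by blast
  qed
  moreover have "?M (x, y) = ?M (y, x)" if "x < 2 * m" "y < 2 * m" for x y
    using that by (elim less_double_cases) (use sym in \<open>auto simp: sym_block_simps\<close>)
  moreover have "?M (x, x) = d x" if "x < 2 * m" for x
    using that by (elim less_double_cases) (use diag in \<open>auto simp: sym_block_simps\<close>)
  ultimately show ?thesis unfolding sym_latin_def by blast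
qed

lemma sym_block_eqD:
  assumes "sym_block m A B C = sym_block m A' B' C'" "x < m" "y < m"
  shows "A (x, y) = A' (x, y)" "B (x, y) = B' (x, y)" "C (x, y) = C' (x, y)"
  using sym_block_simps[OF assms(2,3), of A B C] sym_block_simps[OF assms(2,3), of A' B' C'] assms(1)
  by simp_all

text \<open>Off the diagonal, each symbol of a symmetric square occurs an even number of times.
  Idempotent symmetric squares therefore need odd order, unipotent ones of order at least 2 need
  even order, and this forces separate doublings for the two parities. The half-idempotent squares,
  in which each symbol below t occurs twice on the diagonal, are those needed for Skolem's
  construction. Constant diagonal and reduced squares need not be symmetric; they supply
  off-diagonal blocks.\<close>

abbreviation "idempotent_latin n \<equiv> sym_latin n (\<lambda>x. x)"
abbreviation "unipotent_latin n \<equiv> sym_latin n (\<lambda>_. n - 1)"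
abbreviation "constant_diagonal_latin m \<equiv> {l \<in> latin_funs m. \<forall>x<m. l (x, x) = m - 1}"
abbreviation "reduced_latin t \<equiv> {l \<in> latin_funs (Suc t). \<forall>x\<le>t. l (x, t) = x \<and> l (t, x) = x}"
abbreviation "half_idempotent_latin t \<equiv> sym_latin (2 * t) (\<lambda>x. x mod t)"

text \<open>Counting step shared by the four doublings: two independent diagonal blocks from U, one
  off-diagonal block from L, and all three can be read off the result.\<close>

lemma card_sym_block_le:
  assumes T: "finite T"
    and mem: "\<And>k k' l. k \<in> U \<Longrightarrow> k' \<in> U \<Longrightarrow> l \<in> L \<Longrightarrow> sym_block m (a k) (b l) (a k') \<in> T"
    and a: "\<And>k j. k \<in> U \<Longrightarrow> j \<in> U \<Longrightarrow> (\<And>x y. x < m \<Longrightarrow> y < m \<Longrightarrow> a k (x, y) = a j (x, y)) \<Longrightarrow> k = j"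
    and b: "\<And>l i. l \<in> L \<Longrightarrow> i \<in> L \<Longrightarrow> (\<And>x y. x < m \<Longrightarrow> y < m \<Longrightarrow> b l (x, y) = b i (x, y)) \<Longrightarrow> l = i"
  shows "card U * card U * card L \<le> card T"
proof -
  let ?f = "\<lambda>((k, k'), l). sym_block m (a k) (b l) (a k')"
  have "card ((U \<times> U) \<times> L) \<le> card T"
  proof (rule card_inj_on_le)
    show "?f ` ((U \<times> U) \<times> L) \<subseteq> T" using mem by auto
    show "inj_on ?f ((U \<times> U) \<times> L)"
    proof (rule inj_onI)
      fix p p' assume P: "p \<in> (U \<times> U) \<times> L" "p' \<in> (U \<times> U) \<times> L" and f: "?f p = ?f p'"
      obtain k k' l j j' i where p: "p = ((k, k'), l)" "p' = ((j, j'), i)" by (metis surj_pair)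
      have eq: "sym_block m (a k) (b l) (a k') = sym_block m (a j) (b i) (a j')"
        using f unfolding p by simp
      have "k = j" using P unfolding p by (intro a sym_block_eqD(1)[OF eq]) simp_all
      moreover have "k' = j'" using P unfolding p by (intro a sym_block_eqD(3)[OF eq]) simp_all
      moreover have "l = i" using P unfolding p by (intro b sym_block_eqD(2)[OF eq]) simp_all
      ultimately show "p = p'" unfolding p by blast
    qed
  qed (rule T)
  then show ?thesis by (simp add: card_cartesian_product)
qed

text \<open>The off-diagonal block is an arbitrary Latin square on the symbols below m, the diagonal
  blocks use the symbols from m on. The shift by m turns the diagonal symbol m - 1 into 2m -
  1.\<close>

lemma card_unipotent_double_even:
  assumes "m > 0"
  shows "card (unipotent_latin m) * card (unipotent_latin m) * card (latin_funs m)
    \<le> card (unipotent_latin (2 * m))"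
proof (rule card_sym_block_le[where a = "\<lambda>k p. m + k p" and b = "\<lambda>l. l"])
  let ?U = "unipotent_latin m"
  fix k k' l assume k: "k \<in> ?U" and k': "k' \<in> ?U" and l: "l \<in> latin_funs m"
  note ks = sym_latinD[OF k] sym_latinD[OF k'] and ls = latin_funsD[OF l]
  show "sym_block m (\<lambda>p. m + k p) l (\<lambda>p. m + k' p) \<in> unipotent_latin (2 * m)"
  proof (rule sym_block_in_sym_latin)
    fix x y assume xy: "x < m" "y < m"
    show "m + k (x, y) < 2 * m \<and> l (x, y) < 2 * m \<and> m + k' (x, y) < 2 * m"
      using ks(2)[OF xy] ks(7)[OF xy] ls(2)[OF xy] by simp
    show "m + k (x, y) = m + k (y, x) \<and> m + k' (x, y) = m + k' (y, x)"
      using ks(4)[OF xy] ks(9)[OF xy] by simp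
    fix z assume z: "z < m"
    show "y \<noteq> z \<Longrightarrow> m + k (x, y) \<noteq> m + k (x, z) \<and> l (x, y) \<noteq> l (x, z) \<and> l (y, x) \<noteq> l (z, x) \<and>
        m + k' (x, y) \<noteq> m + k' (x, z)"
      using ks(3)[OF xy z] ks(8)[OF xy z] ls(3)[OF xy z] ls(4)[OF xy(2) z xy(1)] by auto
    show "m + k (x, y) \<noteq> l (x, z) \<and> m + k' (x, y) \<noteq> l (z, x)"
      using ls(2)[OF xy(1) z] ls(2)[OF z xy(1)] by simp
  next
    fix x assume "x < m"
    then show "m + k (x, x) = 2 * m - 1 \<and> m + k' (x, x) = 2 * m - 1"
      using ks(5,10)[of x] by simp
  qed
next
  show "k = j" if "k \<in> unipotent_latin m" "j \<in> unipotent_latin m"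
      "\<And>x y. x < m \<Longrightarrow> y < m \<Longrightarrow> m + k (x, y) = m + j (x, y)" for k j
    by (rule square_fun_ext[OF that(1,2)[THEN sym_latinD(1)]]) (use that(3) in simp)
  show "l = i" if "l \<in> latin_funs m" "i \<in> latin_funs m"
      "\<And>x y. x < m \<Longrightarrow> y < m \<Longrightarrow> l (x, y) = i (x, y)" for l i
    by (rule square_fun_ext[OF that(1,2)[THEN latin_funsD(1)] that(3)])
qed simp

text \<open>Unipotent blocks of odd order m > 1 do not exist, so the diagonal blocks are idempotent
  squares with every diagonal entry replaced by 2m - 1. This frees the symbol x in row x, and the
  off-diagonal block takes it at (x, x), giving up its own diagonal symbol there, which after the
  shift would be m + (m - 1) = 2m - 1.\<close>

lemma card_unipotent_double_odd:
  "card (idempotent_latin m) * card (idempotent_latin m) * card (constant_diagonal_latin m)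
    \<le> card (unipotent_latin (2 * m))"
proof -
  let ?a = "\<lambda>k (x, y). if x = y then 2 * m - 1 else k (x, y)"
  let ?b = "\<lambda>l (x, y). if x = y then x else m + l (x, y)"
  let ?U = "idempotent_latin m" and ?D = "constant_diagonal_latin m"
  show ?thesis
  proof (rule card_sym_block_le[where a = ?a and b = ?b])
    fix k k' l assume k: "k \<in> ?U" and k': "k' \<in> ?U" and "l \<in> ?D"
    then have l: "l \<in> latin_funs m" and di: "\<forall>x<m. l (x, x) = m - 1" by simp_all
    note ks = sym_latinD[OF k] sym_latinD[OF k'] and ls = latin_funsD[OF l]
    have off: "k (x, y) \<noteq> x" "k' (x, y) \<noteq> x" "l (x, y) < m - 1" if "x < m" "y < m" "x \<noteq> y" for x y
    proof -
      show "k (x, y) \<noteq> x" using ks(3)[of x x y] ks(5)[of x] that by auto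
      show "k' (x, y) \<noteq> x" using ks(8)[of x x y] ks(10)[of x] that by auto
      have "l (x, y) \<noteq> m - 1" using ls(3)[of x x y] di that by auto
      then show "l (x, y) < m - 1" using ls(2)[of x y] that by linarith
    qed
    show "sym_block m (?a k) (?b l) (?a k') \<in> unipotent_latin (2 * m)"
    proof (rule sym_block_in_sym_latin)
      fix x y assume xy: "x < m" "y < m"
      show "?a k (x, y) < 2 * m \<and> ?b l (x, y) < 2 * m \<and> ?a k' (x, y) < 2 * m"
        using ks(2)[OF xy] ks(7)[OF xy] ls(2)[OF xy] xy by auto
      show "?a k (x, y) = ?a k (y, x) \<and> ?a k' (x, y) = ?a k' (y, x)"
        using ks(4)[OF xy] ks(9)[OF xy] by simp
      fix z assume z: "z < m"
      show "y \<noteq> z \<Longrightarrow> ?a k (x, y) \<noteq> ?a k (x, z) \<and> ?b l (x, y) \<noteq> ?b l (x, z) \<and> ?b l (y, x) \<noteq> ?b l (z, x) \<and>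
          ?a k' (x, y) \<noteq> ?a k' (x, z)"
        using ks(3)[OF xy z] ks(8)[OF xy z] ls(3)[OF xy z] ls(4)[OF xy(2) z xy(1)]
          ks(2)[OF xy] ks(7)[OF xy] ks(2)[OF xy(1) z] ks(7)[OF xy(1) z] xy z by auto
      show "?a k (x, y) \<noteq> ?b l (x, z) \<and> ?a k' (x, y) \<noteq> ?b l (z, x)"
        using off[of x y] off[of x z] off[of z x] ks(2)[OF xy] ks(7)[OF xy] xy z by auto
    next
      fix x assume "x < m"
      then show "?a k (x, x) = 2 * m - 1 \<and> ?a k' (x, x) = 2 * m - 1" by simp
    qed
  next
    fix k j assume k: "k \<in> ?U" "j \<in> ?U" and eq: "\<And>x y. x < m \<Longrightarrow> y < m \<Longrightarrow> ?a k (x, y) = ?a j (x, y)"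
    show "k = j"
    proof (rule square_fun_ext[OF k[THEN sym_latinD(1)]])
      fix x y assume "x < m" "y < m"
      then show "k (x, y) = j (x, y)"
        using eq[of x y] k[THEN sym_latinD(5), of x] by (cases "x = y") simp_all
    qed
  next
    fix l i assume l: "l \<in> ?D" "i \<in> ?D" and eq: "\<And>x y. x < m \<Longrightarrow> y < m \<Longrightarrow> ?b l (x, y) = ?b i (x, y)"
    then have "l \<in> latin_funs m" "i \<in> latin_funs m" by simp_all
    from this[THEN latin_funsD(1)] show "l = i"
    proof (rule square_fun_ext)
      fix x y assume "x < m" "y < m"
      then show "l (x, y) = i (x, y)" using eq[of x y] l by (cases "x = y") simp_all
    qed
  qed simp
qed

lemma card_half_idempotent_odd:
  "card (idempotent_latin t) * card (idempotent_latin t) * card (latin_funs t)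
    \<le> card (half_idempotent_latin t)"
proof (rule card_sym_block_le[where a = "\<lambda>k. k" and b = "\<lambda>l p. t + l p"])
  let ?U = "idempotent_latin t"
  fix k k' l assume k: "k \<in> ?U" and k': "k' \<in> ?U" and l: "l \<in> latin_funs t"
  note ks = sym_latinD[OF k] sym_latinD[OF k'] and ls = latin_funsD[OF l]
  show "sym_block t k (\<lambda>p. t + l p) k' \<in> half_idempotent_latin t"
  proof (rule sym_block_in_sym_latin)
    fix x y assume xy: "x < t" "y < t"
    show "k (x, y) < 2 * t \<and> t + l (x, y) < 2 * t \<and> k' (x, y) < 2 * t"
      using ks(2)[OF xy] ks(7)[OF xy] ls(2)[OF xy] by simp
    show "k (x, y) = k (y, x) \<and> k' (x, y) = k' (y, x)"
      using ks(4)[OF xy] ks(9)[OF xy] by simp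
    fix z assume z: "z < t"
    show "y \<noteq> z \<Longrightarrow> k (x, y) \<noteq> k (x, z) \<and> t + l (x, y) \<noteq> t + l (x, z) \<and> t + l (y, x) \<noteq> t + l (z, x) \<and>
        k' (x, y) \<noteq> k' (x, z)"
      using ks(3)[OF xy z] ks(8)[OF xy z] ls(3)[OF xy z] ls(4)[OF xy(2) z xy(1)] by auto
    show "k (x, y) \<noteq> t + l (x, z) \<and> k' (x, y) \<noteq> t + l (z, x)"
      using ks(2)[OF xy] ks(7)[OF xy] by simp
  next
    fix x assume "x < t"
    then show "k (x, x) = x mod t \<and> k' (x, x) = (t + x) mod t"
      using ks(5,10)[of x] by simp
  qed
next
  show "k = j" if "k \<in> idempotent_latin t" "j \<in> idempotent_latin t"
      "\<And>x y. x < t \<Longrightarrow> y < t \<Longrightarrow> k (x, y) = j (x, y)" for k j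
    by (rule square_fun_ext[OF that(1,2)[THEN sym_latinD(1)] that(3)])
  show "l = i" if "l \<in> latin_funs t" "i \<in> latin_funs t"
      "\<And>x y. x < t \<Longrightarrow> y < t \<Longrightarrow> t + l (x, y) = t + i (x, y)" for l i
    by (rule square_fun_ext[OF that(1,2)[THEN latin_funsD(1)]]) (use that(3) in simp)
qed simp

text \<open>Idempotent blocks of even order t do not exist. Unipotent ones, with x put at (x, x) and
  their other t - 1 symbols moved to t + 1, ..., 2t - 1, replace them. The off-diagonal block must
  then use the symbols 0, ..., t and avoid x in row x and in column x; this is what remains of a
  reduced square of order t + 1 when its last row and column are deleted.\<close>

lemma card_half_idempotent_even:
  assumes "t > 0"
  shows "card (unipotent_latin t) * card (unipotent_latin t) *
      card (reduced_latin t)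
    \<le> card (half_idempotent_latin t)"
proof -
  let ?a = "\<lambda>k (x, y). if x = y then x else Suc t + k (x, y)"
  let ?U = "unipotent_latin t" and ?R = "reduced_latin t"
  show ?thesis
  proof (rule card_sym_block_le[where a = ?a and b = "\<lambda>l. l"])
    fix k k' l assume k: "k \<in> ?U" and k': "k' \<in> ?U" and "l \<in> ?R"
    then have l: "l \<in> latin_funs (Suc t)" and bo: "\<forall>x\<le>t. l (x, t) = x \<and> l (t, x) = x" by simp_all
    note ks = sym_latinD[OF k] sym_latinD[OF k'] and ls = latin_funsD[OF l]
    have off: "k (x, y) < t - 1" "k' (x, y) < t - 1" if "x < t" "y < t" "x \<noteq> y" for x y
    proof -
      have "k (x, y) \<noteq> t - 1" using ks(3)[of x x y] ks(5)[of x] that by auto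
      then show "k (x, y) < t - 1" using ks(2)[of x y] that by linarith
      have "k' (x, y) \<noteq> t - 1" using ks(8)[of x x y] ks(10)[of x] that by auto
      then show "k' (x, y) < t - 1" using ks(7)[of x y] that by linarith
    qed
    have lne: "l (x, y) \<noteq> x" "l (y, x) \<noteq> x" if "x < t" "y < t" for x y
    proof -
      show "l (x, y) \<noteq> x" using ls(3)[of x y t] bo that by auto
      show "l (y, x) \<noteq> x" using ls(4)[of y t x] bo that by auto
    qed
    show "sym_block t (?a k) l (?a k') \<in> half_idempotent_latin t"
    proof (rule sym_block_in_sym_latin)
      fix x y assume xy: "x < t" "y < t"
      show "?a k (x, y) < 2 * t \<and> l (x, y) < 2 * t \<and> ?a k' (x, y) < 2 * t"
        using off[of x y] ls(2)[of x y] xy by auto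
      show "?a k (x, y) = ?a k (y, x) \<and> ?a k' (x, y) = ?a k' (y, x)"
        using ks(4)[OF xy] ks(9)[OF xy] by simp
      fix z assume z: "z < t"
      show "y \<noteq> z \<Longrightarrow> ?a k (x, y) \<noteq> ?a k (x, z) \<and> l (x, y) \<noteq> l (x, z) \<and> l (y, x) \<noteq> l (z, x) \<and>
          ?a k' (x, y) \<noteq> ?a k' (x, z)"
        using ks(3)[OF xy z] ks(8)[OF xy z] ls(3)[of x y z] ls(4)[of y z x] xy z by auto
      show "?a k (x, y) \<noteq> l (x, z) \<and> ?a k' (x, y) \<noteq> l (z, x)"
        using lne[of x z] lne[of x z] ls(2)[of x z] ls(2)[of z x] xy z by auto
    next
      fix x assume "x < t"
      then show "?a k (x, x) = x mod t \<and> ?a k' (x, x) = (t + x) mod t" by simp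
    qed
  next
    fix k j assume k: "k \<in> ?U" "j \<in> ?U" and eq: "\<And>x y. x < t \<Longrightarrow> y < t \<Longrightarrow> ?a k (x, y) = ?a j (x, y)"
    show "k = j"
    proof (rule square_fun_ext[OF k[THEN sym_latinD(1)]])
      fix x y assume "x < t" "y < t"
      then show "k (x, y) = j (x, y)"
        using eq[of x y] k[THEN sym_latinD(5), of x] by (cases "x = y") simp_all
    qed
  next
    fix l i assume l: "l \<in> ?R" "i \<in> ?R" and eq: "\<And>x y. x < t \<Longrightarrow> y < t \<Longrightarrow> l (x, y) = i (x, y)"
    then have "l \<in> latin_funs (Suc t)" "i \<in> latin_funs (Suc t)" by simp_all
    from this[THEN latin_funsD(1)] show "l = i"
    proof (rule square_fun_ext)
      fix x y assume "x < Suc t" "y < Suc t"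
      then consider "x < t" "y < t" | "x = t" "y \<le> t" | "y = t" "x \<le> t" by linarith
      then show "l (x, y) = i (x, y)" by cases (use eq l in auto)
    qed
  qed simp
qed

section \<open>Normal forms and their cost\<close>

lemma sym_latinI:
  assumes "M \<in> {..<n} \<times> {..<n} \<rightarrow>\<^sub>E {..<n}"
    "\<And>x y y'. x < n \<Longrightarrow> y < n \<Longrightarrow> y' < n \<Longrightarrow> M (x, y) = M (x, y') \<Longrightarrow> y = y'"
    "\<And>x y. x < n \<Longrightarrow> y < n \<Longrightarrow> M (x, y) = M (y, x)"
    "\<And>x. x < n \<Longrightarrow> M (x, x) = d x"
  shows "M \<in> sym_latin n d"
  unfolding sym_latin_def using assms by blast

lemma latin_funs_surj:
  assumes M: "M \<in> latin_funs n" and "x < n" "z < n"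
  shows "\<exists>y<n. M (x, y) = z" "\<exists>y<n. M (y, x) = z"
  by (rule inj_self_map_surj, erule latin_funsD(2)[OF M \<open>x < n\<close>],
      erule (2) latin_funsD(3)[OF M \<open>x < n\<close>], fact)
    (rule inj_self_map_surj, erule latin_funsD(2)[OF M _ \<open>x < n\<close>],
      erule (1) latin_funsD(4)[OF M _ _ \<open>x < n\<close>], assumption, fact)

text \<open>Delete the last row and column. Row x then lacks its last entry \<open>b M x\<close>;
  renaming the symbols by the inverse of \<open>b M\<close> makes the missing symbol x itself, which
  is written on the diagonal in place of m. Only the renaming \<open>b M\<close> is lost, hence the
  factor \<open>m ^ m\<close>.\<close>

lemma card_unipotent_le_idempotent:
  "card (unipotent_latin (Suc m)) \<le> m ^ m * card (idempotent_latin m)"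
proof -
  define b where "b M = (\<lambda>x\<in>{..<m}. M (x, m))" for M :: "nat \<times> nat \<Rightarrow> nat"
  define k where "k M = (\<lambda>(x, y)\<in>{..<m} \<times> {..<m}. if x = y then x else inv_into {..<m} (b M) (M (x, y)))"
    for M :: "nat \<times> nat \<Rightarrow> nat"
  let ?U = "unipotent_latin (Suc m)"
  have off: "M (x, y) < m" if M: "M \<in> ?U" and xy: "x < Suc m" "y < Suc m" "x \<noteq> y" for M x y
  proof -
    have "M (x, y) \<noteq> m"
    proof
      assume "M (x, y) = m"
      then have "M (x, x) = M (x, y)" using sym_latinD(5)[OF M xy(1)] by simp
      then show False using sym_latinD(3)[OF M xy(1) xy(1) xy(2)] xy(3) by blast
    qed
    then show ?thesis using sym_latinD(2)[OF M xy(1,2)] by simp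
  qed
  have bM: "b M \<in> {..<m} \<rightarrow>\<^sub>E {..<m}" if "M \<in> ?U" for M
    using off[OF that] by (auto simp: b_def)
  have b_inj: "inj_on (b M) {..<m}" if M: "M \<in> ?U" for M
  proof (rule inj_onI)
    fix x x' assume x: "x \<in> {..<m}" "x' \<in> {..<m}" and "b M x = b M x'"
    then have "M (m, x) = M (m, x')" using sym_latinD(4)[OF M, of m] by (simp add: b_def)
    then show "x = x'" using sym_latinD(3)[OF M, of m x x'] x by simp
  qed
  have b_surj: "b M ` {..<m} = {..<m}" if M: "M \<in> ?U" for M
    by (rule endo_inj_surj) (use b_inj[OF M] bM[OF M] in auto)
  have bk: "b M (k M (x, y)) = M (x, y)" "k M (x, y) < m" if M: "M \<in> ?U" and xy: "x < m" "y < m" "x \<noteq> y" for M x y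
  proof -
    have *: "M (x, y) \<in> b M ` {..<m}" using b_surj[OF M] off[OF M, of x y] xy by simp
    show "b M (k M (x, y)) = M (x, y)" using f_inv_into_f[OF *] xy by (simp add: k_def)
    show "k M (x, y) < m" using inv_into_into[OF *] xy by (simp add: k_def)
  qed
  have diag: "k M (x, x) = x" if "x < m" for M x using that by (simp add: k_def)
  have "card ?U \<le> card ({..<m} \<rightarrow>\<^sub>E {..<m}) * card (idempotent_latin m)"
  proof (rule card_le_mult_by_inj[where f = "\<lambda>M. (b M, k M)"])
    show "(\<lambda>M. (b M, k M)) ` ?U \<subseteq> ({..<m} \<rightarrow>\<^sub>E {..<m}) \<times> idempotent_latin m"
    proof (intro image_subsetI SigmaI)
      fix M assume M: "M \<in> ?U"
      show "b M \<in> {..<m} \<rightarrow>\<^sub>E {..<m}" by (rule bM[OF M])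
      have lt: "k M (x, y) < m" if "x < m" "y < m" for x y
        using bk(2)[OF M that] diag[OF that(1)] that by (cases "x = y") auto
      have no: "k M (x, y) \<noteq> x" if "x < m" "y < m" "x \<noteq> y" for x y
      proof
        assume "k M (x, y) = x"
        then have "M (x, m) = M (x, y)" using bk(1)[OF M that] that by (simp add: b_def)
        then show False using sym_latinD(3)[OF M, of x m y] that by simp
      qed
      show "k M \<in> idempotent_latin m"
      proof (rule sym_latinI)
        show "k M \<in> {..<m} \<times> {..<m} \<rightarrow>\<^sub>E {..<m}"
          using lt by (auto simp: PiE_iff) (simp add: k_def)
        show "y = y'" if "x < m" "y < m" "y' < m" "k M (x, y) = k M (x, y')" for x y y'
        proof (cases "x = y \<or> x = y'")
          case True
          then show ?thesis using that no[of x y] no[of x y'] diag[of x] by metis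
        next
          case False
          then have "M (x, y) = M (x, y')" using bk(1)[OF M, of x y] bk(1)[OF M, of x y'] that by metis
          then show ?thesis using sym_latinD(3)[OF M, of x y y'] that by simp
        qed
        show "k M (x, y) = k M (y, x)" if "x < m" "y < m" for x y
          using sym_latinD(4)[OF M, of x y] that by (simp add: k_def)
        show "k M (x, x) = x" if "x < m" for x by (rule diag[OF that])
      qed
    qed
    show "inj_on (\<lambda>M. (b M, k M)) ?U"
    proof (rule inj_onI)
      fix M M' assume M: "M \<in> ?U" and M': "M' \<in> ?U" and eq: "(b M, k M) = (b M', k M')"
      show "M = M'"
      proof (rule square_fun_ext[OF sym_latinD(1)[OF M] sym_latinD(1)[OF M']])
        have last: "M (x, m) = M' (x, m)" if "x < m" for x
        proof -
          have "b M x = b M' x" using eq by simp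
          then show ?thesis using that by (simp add: b_def)
        qed
        fix x y assume xy: "x < Suc m" "y < Suc m"
        consider "x = y" | "x < m" "y < m" "x \<noteq> y" | "x < m" "y = m" | "x = m" "y < m"
          using xy by linarith
        then show "M (x, y) = M' (x, y)"
        proof cases
          case 1 then show ?thesis using sym_latinD(5)[OF M, of x] sym_latinD(5)[OF M', of x] xy by simp
        next
          case 2 then show ?thesis using bk(1)[OF M 2] bk(1)[OF M' 2] eq by simp
        next
          case 3 then show ?thesis using last by simp
        next
          case 4 then show ?thesis
            using last[of y] sym_latinD(4)[OF M, of x y] sym_latinD(4)[OF M', of x y] by simp
        qed
      qed
    qed
  qed (auto intro: finite_PiE)
  then show ?thesis by (simp add: card_self_maps)
qed

text \<open>A square is recovered from its normal form and the row and column permutations leading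
  to it. The loss n^(2n) is negligible against exponents of order n^2 * ln n.\<close>

lemma card_latin_le_isotopic:
  assumes D: "finite D"
    and iso: "\<And>M. M \<in> latin_funs n \<Longrightarrow> \<exists>a b. bij_betw a {..<n} {..<n} \<and> bij_betw b {..<n} {..<n} \<and>
      (\<lambda>(x, y)\<in>{..<n} \<times> {..<n}. M (a x, b y)) \<in> D"
  shows "card (latin_funs n) \<le> n ^ n * (n ^ n * card D)"
proof -
  obtain a b where a: "\<And>M. M \<in> latin_funs n \<Longrightarrow> bij_betw (a M) {..<n} {..<n}"
    and b: "\<And>M. M \<in> latin_funs n \<Longrightarrow> bij_betw (b M) {..<n} {..<n}"
    and k: "\<And>M. M \<in> latin_funs n \<Longrightarrow> (\<lambda>(x, y)\<in>{..<n} \<times> {..<n}. M (a M x, b M y)) \<in> D"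
    using iso by metis
  let ?I = "{..<n}" and ?F = "{..<n} \<rightarrow>\<^sub>E {..<n}"
  let ?k = "\<lambda>M. \<lambda>(x, y)\<in>{..<n} \<times> {..<n}. M (a M x, b M y)"
  let ?g = "\<lambda>M. (restrict (a M) ?I, restrict (b M) ?I, ?k M)"
  have finF: "finite ?F" by (simp add: finite_PiE)
  have "card (latin_funs n) \<le> card ?F * card (?F \<times> D)"
  proof (rule card_le_mult_by_inj)
    show "?g ` latin_funs n \<subseteq> ?F \<times> ?F \<times> D"
    proof (intro image_subsetI SigmaI)
      fix M assume M: "M \<in> latin_funs n"
      show "restrict (a M) ?I \<in> ?F" using bij_betw_apply[OF a[OF M]] by auto
      show "restrict (b M) ?I \<in> ?F" using bij_betw_apply[OF b[OF M]] by auto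
      show "?k M \<in> D" by (rule k[OF M])
    qed
    show "inj_on ?g (latin_funs n)"
    proof (rule inj_onI)
      fix M M' assume M: "M \<in> latin_funs n" and M': "M' \<in> latin_funs n" and eq: "?g M = ?g M'"
      then have eqs: "restrict (a M) ?I = restrict (a M') ?I" "restrict (b M) ?I = restrict (b M') ?I" "?k M = ?k M'"
        by (simp_all only: prod.inject)
      show "M = M'"
      proof (rule square_fun_ext[OF latin_funsD(1)[OF M] latin_funsD(1)[OF M']])
        fix x y assume "x < n" "y < n"
        then have "x \<in> a M ` ?I" "y \<in> b M ` ?I"
          using bij_betw_imp_surj_on[OF a[OF M]] bij_betw_imp_surj_on[OF b[OF M]] by simp_all
        then obtain u w where "u < n" "x = a M u" "w < n" "y = b M w" by blast
        then show "M (x, y) = M' (x, y)"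
          using fun_cong[OF eqs(1), of u] fun_cong[OF eqs(2), of w] fun_cong[OF eqs(3), of "(u, w)"] by simp
      qed
    qed
  qed (use finF D in simp_all)
  then show ?thesis by (simp add: card_cartesian_product card_self_maps)
qed

lemma isotopic_latin_fun:
  assumes M: "M \<in> latin_funs n" and a: "bij_betw a {..<n} {..<n}" and b: "bij_betw b {..<n} {..<n}"
  shows "(\<lambda>(x, y)\<in>{..<n} \<times> {..<n}. M (a x, b y)) \<in> latin_funs n" (is "?k \<in> _")
proof (rule latin_funsI)
  have lt: "a x < n" "b x < n" if "x < n" for x
    using bij_betw_apply[OF a] bij_betw_apply[OF b] that by simp_all
  show "?k \<in> {..<n} \<times> {..<n} \<rightarrow>\<^sub>E {..<n}" using latin_funsD(2)[OF M] lt by auto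
  show "y = y'" if "x < n" "y < n" "y' < n" "?k (x, y) = ?k (x, y')" for x y y'
  proof -
    have "b y = b y'" by (rule latin_funsD(3)[OF M lt(1)[OF that(1)] lt(2)[OF that(2)] lt(2)[OF that(3)]]) (use that in simp)
    then show ?thesis using inj_onD[OF bij_betw_imp_inj_on[OF b]] that by simp
  qed
  show "x = x'" if "x < n" "x' < n" "y < n" "?k (x, y) = ?k (x', y)" for x x' y
  proof -
    have "a x = a x'" by (rule latin_funsD(4)[OF M lt(1)[OF that(1)] lt(1)[OF that(2)] lt(2)[OF that(3)]]) (use that in simp)
    then show ?thesis using inj_onD[OF bij_betw_imp_inj_on[OF a]] that by simp
  qed
qed

lemma card_latin_le_constant_diagonal:
  assumes "m > 0"
  shows "card (latin_funs m) \<le> m ^ m * (m ^ m * card (constant_diagonal_latin m))"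
proof (rule card_latin_le_isotopic)
  fix M assume M: "M \<in> latin_funs m"
  have "\<forall>x. \<exists>y. x < m \<longrightarrow> y < m \<and> M (x, y) = m - 1"
    using latin_funs_surj(1)[OF M] assms by (metis diff_less zero_less_one)
  then obtain b where b: "\<And>x. x < m \<Longrightarrow> b x < m \<and> M (x, b x) = m - 1" by metis
  have "x = x'" if "x < m" "x' < m" "b x = b x'" for x x'
    using latin_funsD(4)[OF M that(1,2), of "b x"] b that by metis
  then have bij: "bij_betw b {..<m} {..<m}" using b by (intro inj_self_map_bij) simp_all
  have id: "bij_betw (\<lambda>x. x) {..<m} {..<m}" by (simp add: bij_betw_def)
  have "(\<lambda>(x, y)\<in>{..<m} \<times> {..<m}. M (x, b y)) \<in> constant_diagonal_latin m"
    using isotopic_latin_fun[OF M id bij] b by simp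
  then show "\<exists>a b. bij_betw a {..<m} {..<m} \<and> bij_betw b {..<m} {..<m} \<and>
      (\<lambda>(x, y)\<in>{..<m} \<times> {..<m}. M (a x, b y)) \<in> constant_diagonal_latin m"
    using id bij by blast
qed simp

lemma card_latin_le_reduced:
  "card (latin_funs (Suc t)) \<le> Suc t ^ Suc t *
    (Suc t ^ Suc t * card (reduced_latin t))"
proof (rule card_latin_le_isotopic)
  let ?n = "Suc t" and ?R = "reduced_latin t"
  fix M assume M: "M \<in> latin_funs ?n"
  have "\<forall>x. \<exists>y. x < ?n \<longrightarrow> y < ?n \<and> M (t, y) = x" using latin_funs_surj(1)[OF M] by (metis lessI)
  then obtain b where b: "\<And>x. x < ?n \<Longrightarrow> b x < ?n \<and> M (t, b x) = x" by metis
  have bij_b: "bij_betw b {..<?n} {..<?n}"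
    by (rule inj_self_map_bij) (use b in \<open>blast, metis\<close>)
  have "\<forall>x. \<exists>y. x < ?n \<longrightarrow> y < ?n \<and> M (y, b t) = x" using latin_funs_surj(2)[OF M] b by (metis lessI)
  then obtain a where a: "\<And>x. x < ?n \<Longrightarrow> a x < ?n \<and> M (a x, b t) = x" by metis
  have bij_a: "bij_betw a {..<?n} {..<?n}"
    by (rule inj_self_map_bij) (use a in \<open>blast, metis\<close>)
  \<comment> \<open>The column permutation b was chosen to sort row t. It still does so after the
    rows are permuted, because a leaves row t in place.\<close>
  have "a t = t"
    using latin_funsD(4)[OF M, of "a t" t "b t"] a[of t] b[of t] by simp
  then have "(\<lambda>(x, y)\<in>{..<?n} \<times> {..<?n}. M (a x, b y)) \<in> ?R"
    using isotopic_latin_fun[OF M bij_a bij_b] a b by simp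
  then show "\<exists>a b. bij_betw a {..<?n} {..<?n} \<and> bij_betw b {..<?n} {..<?n} \<and>
      (\<lambda>(x, y)\<in>{..<?n} \<times> {..<?n}. M (a x, b y)) \<in> ?R"
    using bij_a bij_b by blast
qed simp

section \<open>Explicit lower bounds for symmetric squares\<close>

lemma exp_le_weaken: "exp b \<le> c \<Longrightarrow> a \<le> b \<Longrightarrow> exp a \<le> c" for a b c :: real
  by (rule order_trans[of _ "exp b"]) simp_all

lemma self_power_eq_exp: "m > 0 \<Longrightarrow> real (m ^ m) = exp (m * ln m)"
  by (simp add: exp_of_nat_mult)

lemma exp_le_card_factor:
  assumes "exp a \<le> real A" "A \<le> m ^ m * B" "m > 0"
  shows "exp (a - m * ln m) \<le> real B"
proof -
  have "exp a \<le> real (m ^ m * B)" using assms(1,2) by (meson of_nat_mono order_trans)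
  also have "\<dots> = exp (m * ln m) * real B" using self_power_eq_exp[OF assms(3)] by simp
  finally show ?thesis by (simp add: exp_diff divide_le_eq mult.commute)
qed

lemma exp_le_card_mult3:
  assumes "exp a \<le> real A" "exp b \<le> real B" "A * A * B \<le> C"
  shows "exp (2 * a + b) \<le> real C"
proof -
  have "exp (2 * a + b) = exp a * exp a * exp b" by (simp only: exp_add mult_2)
  also have "\<dots> \<le> real A * real A * real B" using assms by (intro mult_mono) auto
  also have "\<dots> = real (A * A * B)" by simp
  also have "\<dots> \<le> real C" using assms(3) by (rule of_nat_mono)
  finally show ?thesis .
qed

lemma mult_ln_le_square: "x \<ge> 1 \<Longrightarrow> x * ln x \<le> x\<^sup>2" for x :: real
  using ln_bound[of x] by (simp add: power2_eq_square mult_left_mono)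

lemma ln2_bounds: "0 \<le> ln (2::real)" "ln (2::real) \<le> 1"
  using ln_bound[of 2] ln_2_less_1 by auto

text \<open>Doubling m to n = 2m must turn the coefficient 3/8 into 4 * 3/8 = 3/2; two diagonal
  blocks and one Latin square provide 2 * 3/8 + 7/8 = 13/8. The term - 24 * n^2 pays for the
  lower-order losses: it is multiplied by 4 on the left and occurs about twice on the right, so it
  also covers the passage to order m + 1 for odd m.\<close>

lemma card_unipotent_ge:
  assumes "even n" "n \<ge> 2"
  shows "exp (3/8 * (real n)\<^sup>2 * ln n - 24 * (real n)\<^sup>2) \<le> card (unipotent_latin n)"
  using assms
proof (induction n rule: less_induct)
  case (less n)
  then obtain m where m: "n = 2 * m" "m \<ge> 1" by auto
  define M where "M = real m"
  have M1: "M \<ge> 1" using m by (simp add: M_def)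
  have nM: "real n = 2 * M" using m by (simp add: M_def)
  have target: "3/8 * (real n)\<^sup>2 * ln n - 24 * (real n)\<^sup>2 = 3/2 * M\<^sup>2 * (ln 2 + ln M) - 96 * M\<^sup>2"
    unfolding nM using M1 by (simp add: ln_mult power_mult_distrib algebra_simps)
  have lnM: "0 \<le> ln M" using M1 by simp
  have M2: "0 \<le> M\<^sup>2" "0 \<le> M\<^sup>2 * ln M" "M\<^sup>2 * ln 2 \<le> M\<^sup>2" using lnM ln2_bounds by (auto simp: mult_left_le)
  have e: "3/2 * M\<^sup>2 * (ln 2 + ln M) = 3/2 * (M\<^sup>2 * ln 2) + 3/2 * (M\<^sup>2 * ln M)"
      "7/8 * x\<^sup>2 * (ln x - 6) = 7/8 * (x\<^sup>2 * ln x) - 21/4 * x\<^sup>2"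
      "3/8 * x\<^sup>2 * ln x = 3/8 * (x\<^sup>2 * ln x)" for x :: real
    by (simp_all add: field_simps)
  have L: "exp (7/8 * M\<^sup>2 * (ln M - 6)) \<le> card (latin_funs m)"
    using card_latin_funs_ge[of m] m by (simp add: M_def)
  consider "m = 1" | "m \<ge> 2" "even m" | "m \<ge> 3" "odd m"
    using m by (metis One_nat_def Suc_1 Suc_leI le_neq_implies_less numeral_3_eq_3 odd_one even_numeral
      le_antisym not_less_eq_eq)
  then show ?case
  proof cases
    case 1
    \<comment> \<open>For n = 2 the bound is at most 1, so one square suffices, and doubling the
      square of order 1 provides it. The route for odd m would be circular here, since m + 1 =
      n.\<close>
    have "(\<lambda>_\<in>{..<1} \<times> {..<1}. 0) \<in> unipotent_latin 1"
      by (rule sym_latinI) (auto simp: PiE_iff)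
    then have "card (unipotent_latin 1) \<noteq> 0" by (metis card_0_eq empty_iff finite_sym_latin)
    then have "1 \<le> card (unipotent_latin 1)" by linarith
    moreover have "0 < real (card (latin_funs 1))" using less_le_trans[OF exp_gt_zero L] 1 by simp
    ultimately have "0 < card (unipotent_latin 1) * card (unipotent_latin 1) * card (latin_funs 1)" by simp
    then have "0 < card (unipotent_latin (2 * 1))"
      by (rule less_le_trans) (rule card_unipotent_double_even, simp)
    then have "exp 0 \<le> real (card (unipotent_latin n))" using m 1 by simp
    moreover have "3/8 * (real n)\<^sup>2 * ln n - 24 * (real n)\<^sup>2 \<le> 0"
      unfolding target using 1 ln2_bounds by (simp add: M_def)
    ultimately show ?thesis by (rule exp_le_weaken)
  next
    case 2
    let ?u = "3/8 * M\<^sup>2 * ln M - 24 * M\<^sup>2"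
    have "exp ?u \<le> card (unipotent_latin m)" using less.IH[of m] 2 m by (simp add: M_def)
    from exp_le_card_mult3[OF this L card_unipotent_double_even]
    have H: "exp (2 * ?u + 7/8 * M\<^sup>2 * (ln M - 6)) \<le> card (unipotent_latin n)" using m by simp
    have lin: "3/2 * Z + 3/2 * Y - 96 * X \<le> 2 * (3/8 * Y - 24 * X) + (7/8 * Y - 21/4 * X)"
      if "0 \<le> X" "0 \<le> Y" "Z \<le> X" for X Y Z :: real
      using that by (simp add: field_simps)
    have "3/8 * (real n)\<^sup>2 * ln n - 24 * (real n)\<^sup>2 \<le> 2 * ?u + 7/8 * M\<^sup>2 * (ln M - 6)"
      unfolding target unfolding e by (rule lin[OF M2])
    with H show ?thesis by (rule exp_le_weaken)
  next
    case 3
    \<comment> \<open>From m = 3 on, m + 1 is less than 2m, so the induction hypothesis applies, and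
      (m + 1)^2 is at most 16/9 * m^2, whose double is still below 4 * m^2.\<close>
    have M3: "M \<ge> 3" using 3 by (simp add: M_def)
    let ?K = "real (Suc m)"
    let ?u = "3/8 * ?K\<^sup>2 * ln ?K - 24 * ?K\<^sup>2"
    have "exp ?u \<le> card (unipotent_latin (Suc m))" using less.IH[of "Suc m"] 3 m by simp
    from exp_le_card_factor[OF this card_unipotent_le_idempotent]
    have J: "exp (?u - M * ln M) \<le> card (idempotent_latin m)" using m by (simp add: M_def)
    have D: "exp (7/8 * M\<^sup>2 * (ln M - 6) - M * ln M - M * ln M) \<le> card (constant_diagonal_latin m)"
      using exp_le_card_factor[OF exp_le_card_factor[OF L card_latin_le_constant_diagonal] order_refl] m
      by (simp add: M_def)
    from exp_le_card_mult3[OF J D card_unipotent_double_odd]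
    have "exp (2 * (?u - M * ln M) + (7/8 * M\<^sup>2 * (ln M - 6) - M * ln M - M * ln M)) \<le> card (unipotent_latin n)"
      using m by simp
    moreover have "3/8 * (real n)\<^sup>2 * ln n - 24 * (real n)\<^sup>2
        \<le> 2 * (?u - M * ln M) + (7/8 * M\<^sup>2 * (ln M - 6) - M * ln M - M * ln M)"
    proof -
      have K: "?K = M + 1" by (simp add: M_def)
      have "(M + 1)\<^sup>2 \<le> (4/3 * M)\<^sup>2" using M3 by (intro power_mono) auto
      then have K1: "?K\<^sup>2 \<le> 16/9 * M\<^sup>2" unfolding K by (simp add: power_mult_distrib power_divide)
      have K2: "M\<^sup>2 * ln M \<le> ?K\<^sup>2 * ln ?K"
        unfolding K using M1 by (intro mult_mono power_mono ln_mono) auto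
      have "1 \<le> ln M" using M3 exp_le by (subst ln_ge_iff) auto
      then have XY: "M\<^sup>2 \<le> M\<^sup>2 * ln M" using mult_left_mono[of 1 "ln M" "M\<^sup>2"] by simp
      \<comment> \<open>This is tight: the coefficient of X is -96 + 3/2 on the left and -48 * 16/9
        - 21/4 - 4 on the right, smaller by 1/12. The surplus Y/8 makes up for it, which is why X <=
        Y is supplied.\<close>
      have lin: "3/2 * Z + 3/2 * Y - 96 * X \<le> 2 * (3/8 * W - 24 * T - V) + (7/8 * Y - 21/4 * X - V - V)"
        if "0 \<le> X" "0 \<le> Y" "Z \<le> X" "X \<le> Y" "T \<le> 16/9 * X" "Y \<le> W" "V \<le> X" for X Y Z W T V :: real
        using that by (simp add: field_simps)
      show ?thesis unfolding target unfolding e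
        by (rule lin[OF M2 XY K1 K2 mult_ln_le_square[OF M1]])
    qed
    ultimately show ?thesis by (rule exp_le_weaken)
  qed
qed

text \<open>One column is lost from order m + 1. By (m + 1)^2 <= 4 * m^2 and m * ln m <= m^2 the
  constant 24 becomes 4 * 24 + 1 = 97, rounded up to 100.\<close>

lemma card_idempotent_ge:
  assumes "odd m"
  shows "exp (3/8 * (real m)\<^sup>2 * ln m - 100 * (real m)\<^sup>2) \<le> card (idempotent_latin m)"
proof -
  have m: "m > 0" using assms odd_pos by blast
  define M where "M = real m"
  have M1: "M \<ge> 1" using m by (simp add: M_def)
  let ?K = "real (Suc m)"
  let ?u = "3/8 * ?K\<^sup>2 * ln ?K - 24 * ?K\<^sup>2"
  have "exp ?u \<le> card (unipotent_latin (Suc m))" using card_unipotent_ge[of "Suc m"] assms m by simp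
  from exp_le_card_factor[OF this card_unipotent_le_idempotent]
  have J: "exp (?u - M * ln M) \<le> card (idempotent_latin m)" using m by (simp add: M_def)
  have K: "?K = M + 1" by (simp add: M_def)
  have "(M + 1)\<^sup>2 \<le> (2 * M)\<^sup>2" using M1 by (intro power_mono) auto
  then have K1: "?K\<^sup>2 \<le> 4 * M\<^sup>2" unfolding K by (simp add: power_mult_distrib)
  have K2: "M\<^sup>2 * ln M \<le> ?K\<^sup>2 * ln ?K"
    unfolding K using M1 by (intro mult_mono power_mono ln_mono) auto
  have e: "3/8 * x\<^sup>2 * ln x = 3/8 * (x\<^sup>2 * ln x)" for x :: real by simp
  have lin: "3/8 * Y - 100 * X \<le> 3/8 * W - 24 * T - V"
    if "T \<le> 4 * X" "Y \<le> W" "V \<le> X" "0 \<le> X" for X Y W T V :: real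
    using that by (simp add: field_simps)
  have "3/8 * M\<^sup>2 * ln M - 100 * M\<^sup>2 \<le> ?u - M * ln M"
    unfolding e by (rule lin[OF K1 K2 mult_ln_le_square[OF M1]]) simp
  with J show ?thesis unfolding M_def by (rule exp_le_weaken)
qed

text \<open>A single doubling, without induction: again 13/8 against 3/2, and 4 * 100 leaves ample
  room for the lower-order losses in either parity.\<close>

lemma card_half_idempotent_ge:
  assumes "t > 0"
  shows "exp (3/8 * (real (2 * t))\<^sup>2 * ln (real (2 * t)) - 100 * (real (2 * t))\<^sup>2) \<le> card (half_idempotent_latin t)"
proof -
  define M where "M = real t"
  have M1: "M \<ge> 1" using assms by (simp add: M_def)
  have nM: "real (2 * t) = 2 * M" by (simp add: M_def)
  have target: "3/8 * (real (2 * t))\<^sup>2 * ln (real (2 * t)) - 100 * (real (2 * t))\<^sup>2 = 3/2 * M\<^sup>2 * (ln 2 + ln M) - 400 * M\<^sup>2"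
    unfolding nM using M1 by (simp add: ln_mult power_mult_distrib algebra_simps)
  have lnM: "0 \<le> ln M" using M1 by simp
  have M2: "0 \<le> M\<^sup>2" "0 \<le> M\<^sup>2 * ln M" "M\<^sup>2 * ln 2 \<le> M\<^sup>2" using lnM ln2_bounds by (auto simp: mult_left_le)
  have e: "3/2 * M\<^sup>2 * (ln 2 + ln M) = 3/2 * (M\<^sup>2 * ln 2) + 3/2 * (M\<^sup>2 * ln M)"
      "7/8 * x\<^sup>2 * (ln x - 6) = 7/8 * (x\<^sup>2 * ln x) - 21/4 * x\<^sup>2"
      "3/8 * x\<^sup>2 * ln x = 3/8 * (x\<^sup>2 * ln x)" for x :: real
    by (simp_all add: field_simps)
  show ?thesis
  proof (cases "odd t")
    case True
    let ?u = "3/8 * M\<^sup>2 * ln M - 100 * M\<^sup>2"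
    have "exp ?u \<le> card (idempotent_latin t)" using card_idempotent_ge[OF True] by (simp add: M_def)
    moreover have "exp (7/8 * M\<^sup>2 * (ln M - 6)) \<le> card (latin_funs t)"
      using card_latin_funs_ge[of t] assms by (simp add: M_def)
    ultimately have H: "exp (2 * ?u + 7/8 * M\<^sup>2 * (ln M - 6)) \<le> card (half_idempotent_latin t)"
      by (rule exp_le_card_mult3) (rule card_half_idempotent_odd)
    have lin: "3/2 * Z + 3/2 * Y - 400 * X \<le> 2 * (3/8 * Y - 100 * X) + (7/8 * Y - 21/4 * X)"
      if "0 \<le> X" "0 \<le> Y" "Z \<le> X" for X Y Z :: real
      using that by (simp add: field_simps)
    have "3/2 * M\<^sup>2 * (ln 2 + ln M) - 400 * M\<^sup>2 \<le> 2 * ?u + 7/8 * M\<^sup>2 * (ln M - 6)"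
      unfolding e by (rule lin[OF M2])
    with H show ?thesis unfolding target by (rule exp_le_weaken)
  next
    case False
    then have t2: "t \<ge> 2" using assms by (metis One_nat_def Suc_1 Suc_leI le_neq_implies_less odd_one)
    let ?u = "3/8 * M\<^sup>2 * ln M - 24 * M\<^sup>2"
    let ?K = "real (Suc t)"
    have U: "exp ?u \<le> card (unipotent_latin t)" using card_unipotent_ge[OF _ t2] False by (simp add: M_def)
    have "exp (7/8 * ?K\<^sup>2 * (ln ?K - 6)) \<le> card (latin_funs (Suc t))"
      using card_latin_funs_ge[of "Suc t"] by simp
    from exp_le_card_factor[OF exp_le_card_factor[OF this card_latin_le_reduced] order_refl]
    have R: "exp (7/8 * ?K\<^sup>2 * (ln ?K - 6) - ?K * ln ?K - ?K * ln ?K)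
        \<le> card (reduced_latin t)" by simp
    from exp_le_card_mult3[OF U R card_half_idempotent_even[OF assms]]
    have "exp (2 * ?u + (7/8 * ?K\<^sup>2 * (ln ?K - 6) - ?K * ln ?K - ?K * ln ?K)) \<le> card (half_idempotent_latin t)" .
    moreover have "3/2 * M\<^sup>2 * (ln 2 + ln M) - 400 * M\<^sup>2
        \<le> 2 * ?u + (7/8 * ?K\<^sup>2 * (ln ?K - 6) - ?K * ln ?K - ?K * ln ?K)"
    proof -
      have K: "?K = M + 1" by (simp add: M_def)
      have "(M + 1)\<^sup>2 \<le> (2 * M)\<^sup>2" using M1 by (intro power_mono) auto
      then have K1: "?K\<^sup>2 \<le> 4 * M\<^sup>2" unfolding K by (simp add: power_mult_distrib)
      have K2: "M\<^sup>2 * ln M \<le> ?K\<^sup>2 * ln ?K"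
        unfolding K using M1 by (intro mult_mono power_mono ln_mono) auto
      have K3: "?K * ln ?K \<le> ?K\<^sup>2" by (rule mult_ln_le_square) simp
      have lin: "3/2 * Z + 3/2 * Y - 400 * X \<le> 2 * (3/8 * Y - 24 * X) + (7/8 * W - 21/4 * T - V - V)"
        if "0 \<le> X" "0 \<le> Y" "Z \<le> X" "T \<le> 4 * X" "Y \<le> W" "V \<le> T" for X Y Z W T V :: real
        using that by (simp add: field_simps)
      show ?thesis unfolding e by (rule lin[OF M2 K1 K2 K3])
    qed
    ultimately show ?thesis unfolding target by (rule exp_le_weaken)
  qed
qed

subsection \<open>The constructions of Bose and Skolem\<close>

text \<open>Each block covers three pairs, so with at most v * (v - 1) / 6 blocks no pair can be
  covered twice once every pair is covered. The constructions below therefore need to check only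
  covering and the number of blocks.\<close>

lemma steiner_triple_systemsI:
  assumes blocks: "\<And>b. b \<in> B \<Longrightarrow> b \<subseteq> {0..<v} \<and> card b = 3"
    and cover: "\<And>p q. p < v \<Longrightarrow> q < v \<Longrightarrow> p \<noteq> q \<Longrightarrow> \<exists>b\<in>B. p \<in> b \<and> q \<in> b"
    and few: "6 * card B \<le> v * (v - 1)"
  shows "B \<in> steiner_triple_systems v"
proof -
  let ?P = "{e. e \<subseteq> {0..<v} \<and> card e = 2}"
  let ?c = "\<lambda>e. card {b\<in>B. e \<subseteq> b}"
  have finB: "finite B" by (rule finite_subset[of _ "Pow {0..<v}"]) (use blocks in auto)
  have finP: "finite ?P" by (rule finite_subset[of _ "Pow {0..<v}"]) auto
  have ge: "1 \<le> ?c e" if eP: "e \<in> ?P" for e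
  proof -
    have "card e = 2" using eP by simp
    then obtain p q where e: "e = {p, q}" "p \<noteq> q" unfolding card_2_iff by blast
    then obtain b where "b \<in> B" "p \<in> b" "q \<in> b" using cover[of p q] eP by auto
    then have "b \<in> {b\<in>B. e \<subseteq> b}" using e by auto
    then have "0 < ?c e" using finB by (subst card_gt_0_iff) auto
    then show ?thesis by linarith
  qed
  have "(\<Sum>e\<in>?P. ?c e) = (\<Sum>e\<in>?P. \<Sum>b\<in>B. if e \<subseteq> b then 1 else 0)"
    using finB by (simp add: sum.If_cases Int_def)
  also have "\<dots> = (\<Sum>b\<in>B. \<Sum>e\<in>?P. if e \<subseteq> b then 1 else 0)" by (rule sum.swap)
  also have "\<dots> = (\<Sum>b\<in>B. 3)"
  proof (rule sum.cong[OF refl])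
    fix b assume b: "b \<in> B"
    have "(\<Sum>e\<in>?P. if e \<subseteq> b then 1 else 0) = card (?P \<inter> {e. e \<subseteq> b})"
      using finP by (simp add: sum.If_cases)
    also have "?P \<inter> {e. e \<subseteq> b} = {e. e \<subseteq> b \<and> card e = 2}" using blocks[OF b] by auto
    also have "card \<dots> = card b choose 2"
      using blocks[OF b] finite_subset[of b "{0..<v}"] by (intro n_subsets) auto
    finally show "(\<Sum>e\<in>?P. if e \<subseteq> b then 1 else 0) = (3::nat)" using blocks[OF b] by (simp add: choose_two)
  qed
  finally have total: "(\<Sum>e\<in>?P. ?c e) = 3 * card B" by simp
  have "card ?P = v choose 2" using n_subsets[of "{0..<v}" 2] by simp
  moreover have "even (v * (v - 1))" by (cases v) auto
  ultimately have cardP: "2 * card ?P = v * (v - 1)" by (simp add: choose_two)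
  have one: "?c e = 1" if e: "e \<in> ?P" for e
  proof (rule ccontr)
    assume "?c e \<noteq> 1"
    then have "1 < ?c e" using ge[OF e] by linarith
    then have "\<exists>e\<in>?P. 1 < ?c e" using e by blast
    then have "(\<Sum>e\<in>?P. 1) < (\<Sum>e\<in>?P. ?c e)"
      using ge by (intro sum_strict_mono_ex1[OF finP]) blast+
    then show False using total few cardP by simp
  qed
  show ?thesis
    unfolding steiner_triple_systems_def
  proof (intro CollectI conjI allI impI)
    show "\<forall>b\<in>B. b \<subseteq> {0..<v} \<and> card b = 3" using blocks by blast
    fix e assume "e \<subseteq> {0..<v} \<and> card e = 2"
    then have "card {b\<in>B. e \<subseteq> b} = 1" using one by blast
    then obtain b where "{b\<in>B. e \<subseteq> b} = {b}" by (auto simp: card_1_singleton_iff)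
    then show "\<exists>!b. b \<in> B \<and> e \<subseteq> b" by (metis (no_types, lifting) mem_Collect_eq singleton_iff)
  qed
qed

lemma steiner_blockD:
  assumes "B \<in> steiner_triple_systems v" "b \<in> B"
  shows "b \<subseteq> {0..<v}" "card b = 3"
  using assms by (simp_all add: steiner_triple_systems_def)

lemma steiner_block_ex1:
  assumes "B \<in> steiner_triple_systems v" "p < v" "q < v" "p \<noteq> q"
  shows "\<exists>!b. b \<in> B \<and> {p, q} \<subseteq> b"
proof -
  have "\<forall>e. e \<subseteq> {0..<v} \<and> card e = 2 \<longrightarrow> (\<exists>!b. b \<in> B \<and> e \<subseteq> b)"
    using assms(1) unfolding steiner_triple_systems_def by simp
  then show ?thesis using assms(2-4) by (elim allE[of _ "{p, q}"] mp) simp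
qed

lemma steiner_block_unique:
  assumes B: "B \<in> steiner_triple_systems v" and b: "b \<in> B" "b' \<in> B"
    and pq: "p \<noteq> q" "p \<in> b" "q \<in> b" "p \<in> b'" "q \<in> b'"
  shows "b = b'"
proof -
  have "p < v" "q < v" using steiner_blockD(1)[OF B b(1)] pq by auto
  from steiner_block_ex1[OF B this pq(1)] show ?thesis
    by (rule ex1E) (metis b pq empty_subsetI insert_subset)
qed

lemma finite_steiner_triple_systems: "finite (steiner_triple_systems v)"
proof (rule finite_subset)
  show "steiner_triple_systems v \<subseteq> Pow (Pow {0..<v})" by (auto simp: steiner_triple_systems_def)
qed simp

text \<open>The point \<open>(x, i)\<close> of the Bose and Skolem constructions is coded as \<open>i * n + x\<close>.\<close>

definition mixed_blocks :: "nat \<Rightarrow> (nat \<Rightarrow> nat \<times> nat \<Rightarrow> nat) \<Rightarrow> nat set set" where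
  "mixed_blocks n \<kappa> = {{i * n + x, i * n + y, (Suc i mod 3) * n + \<kappa> i (x, y)} | i x y. i < 3 \<and> x < y \<and> y < n}"

lemma level_point_eq_iff:
  fixes n :: nat
  assumes "x < n" "y < n"
  shows "i * n + x = j * n + y \<longleftrightarrow> i = j \<and> x = y"
proof
  assume eq: "i * n + x = j * n + y"
  have "(i * n + x) div n = i" "(j * n + y) div n = j" using assms by auto
  then have "i = j" using eq by metis
  then show "i = j \<and> x = y" using eq by simp
qed simp

lemma level_point_less:
  fixes n :: nat
  assumes "i < 3" "x < n"
  shows "i * n + x < 3 * n"
proof -
  have "i * n + x < Suc i * n" using assms(2) by simp
  also have "\<dots> \<le> 3 * n" using assms(1) by (intro mult_right_mono) auto
  finally show ?thesis .
qed

lemma level_point_cases: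
  fixes n :: nat
  assumes "p < 3 * n"
  obtains i x where "i < 3" "x < n" "p = i * n + x"
proof -
  have "n > 0" using assms by (cases n) auto
  then have "p div n < 3" "p mod n < n" "p = p div n * n + p mod n"
    using assms by (auto simp: less_mult_imp_div_less)
  then show ?thesis using that by blast
qed

lemma less_3_cases: "i < (3::nat) \<Longrightarrow> i = 0 \<or> i = 1 \<or> i = 2"
  by linarith

lemma Suc_mod_3_neq: "i < 3 \<Longrightarrow> Suc i mod 3 \<noteq> i" "i < 3 \<Longrightarrow> Suc i mod 3 < 3"
  using less_3_cases[of i] by auto

lemma Suc_mod_3_surj:
  assumes "i < (3::nat)"
  shows "\<exists>j<3. i = Suc j mod 3"
  using less_3_cases[OF assms]
proof (elim disjE)
  assume "i = 0"
  then show ?thesis by (intro exI[of _ 2]) simp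
next
  assume "i = 1"
  then show ?thesis by (intro exI[of _ 0]) simp
next
  assume "i = 2"
  then show ?thesis by (intro exI[of _ 1]) simp
qed

lemma mixed_blocksD:
  assumes k: "\<And>i. i < 3 \<Longrightarrow> \<kappa> i \<in> sym_latin n d" and b: "b \<in> mixed_blocks n \<kappa>"
  shows "b \<subseteq> {0..<3 * n} \<and> card b = 3"
proof -
  obtain i x y where b: "b = {i * n + x, i * n + y, (Suc i mod 3) * n + \<kappa> i (x, y)}" and i: "i < 3" "x < y" "y < n"
    using b unfolding mixed_blocks_def by blast
  have z: "\<kappa> i (x, y) < n" using sym_latinD(2)[OF k[OF i(1)], of x y] i by simp
  have "i * n + x \<noteq> i * n + y" using i by simp
  moreover have "i * n + x \<noteq> (Suc i mod 3) * n + \<kappa> i (x, y)"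
    using level_point_eq_iff[of x n "\<kappa> i (x, y)" i "Suc i mod 3"] z i Suc_mod_3_neq(1)[OF i(1)] by simp
  moreover have "i * n + y \<noteq> (Suc i mod 3) * n + \<kappa> i (x, y)"
    using level_point_eq_iff[of y n "\<kappa> i (x, y)" i "Suc i mod 3"] z i Suc_mod_3_neq(1)[OF i(1)] by simp
  ultimately have "card b = 3" unfolding b by simp
  moreover have "b \<subseteq> {0..<3 * n}"
    unfolding b using level_point_less[of i x n] level_point_less[of i y n]
      level_point_less[of "Suc i mod 3" "\<kappa> i (x, y)" n] i z by simp
  ultimately show ?thesis by blast
qed

lemma card_mixed_blocks: "6 * card (mixed_blocks n \<kappa>) \<le> 9 * n * (n - 1)"
proof -
  let ?I = "{..<3::nat} \<times> (SIGMA y:{..<n}. {..<y})"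
  let ?f = "\<lambda>(i, y, x). {i * n + x, i * n + y, (Suc i mod 3) * n + \<kappa> i (x, y)}"
  have eq: "mixed_blocks n \<kappa> = ?f ` ?I"
  proof (intro set_eqI iffI)
    fix b assume "b \<in> mixed_blocks n \<kappa>"
    then obtain i x y where "b = ?f (i, y, x)" "(i, y, x) \<in> ?I"
      unfolding mixed_blocks_def by auto
    then show "b \<in> ?f ` ?I" by blast
  next
    fix b assume "b \<in> ?f ` ?I"
    then show "b \<in> mixed_blocks n \<kappa>" unfolding mixed_blocks_def by auto
  qed
  have "card (SIGMA y:{..<n}. {..<y}) = (\<Sum>y<n. y)" by (subst card_SigmaI) auto
  moreover have "2 * (\<Sum>y<n. y) = n * (n - 1)"
    by (induction n) (auto simp: algebra_simps)
  ultimately have I: "2 * card ?I = 3 * (n * (n - 1))" by (simp add: card_cartesian_product)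
  have "card (mixed_blocks n \<kappa>) \<le> card ?I" unfolding eq by (rule card_image_le) auto
  then show ?thesis using I by simp
qed

lemma sym_latin_surj:
  assumes M: "M \<in> sym_latin n d" and "x < n" "z < n"
  shows "\<exists>y<n. M (x, y) = z"
  by (rule inj_self_map_surj, erule sym_latinD(2)[OF M \<open>x < n\<close>],
      erule (2) sym_latinD(3)[OF M \<open>x < n\<close>], fact)

text \<open>Points x on level i and y on the next level are joined through the z with \<kappa> i (x,
  z) = y. This fails only if z = x, that is, for y = d x; these exceptional pairs depend on the
  diagonal alone and are left to a fixed set of further blocks.\<close>

lemma mixed_blocks_cover:
  assumes k: "\<And>i. i < 3 \<Longrightarrow> \<kappa> i \<in> sym_latin n d" and p: "p < 3 * n" "q < 3 * n" "p \<noteq> q"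
  shows "(\<exists>b\<in>mixed_blocks n \<kappa>. p \<in> b \<and> q \<in> b) \<or>
    (\<exists>i x. i < 3 \<and> x < n \<and> {p, q} = {i * n + x, (Suc i mod 3) * n + d x})"
proof -
  have adj: "(\<exists>b\<in>mixed_blocks n \<kappa>. i * n + x \<in> b \<and> (Suc i mod 3) * n + y \<in> b) \<or> y = d x"
    if i: "i < 3" "x < n" "y < n" for i x y
  proof -
    obtain z where z: "z < n" "\<kappa> i (x, z) = y" using sym_latin_surj[OF k[OF i(1)] i(2,3)] by blast
    have z': "\<kappa> i (z, x) = y" using sym_latinD(4)[OF k[OF i(1)] i(2) z(1)] z by simp
    consider "x = z" | "x < z" | "z < x" by linarith
    then show ?thesis
    proof cases
      case 1
      then show ?thesis using z sym_latinD(5)[OF k[OF i(1)] i(2)] by simp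
    next
      case 2
      then have "{i * n + x, i * n + z, (Suc i mod 3) * n + \<kappa> i (x, z)} \<in> mixed_blocks n \<kappa>"
        unfolding mixed_blocks_def using i z by blast
      then have mem: "{i * n + x, i * n + z, (Suc i mod 3) * n + y} \<in> mixed_blocks n \<kappa>" unfolding z(2) .
      show ?thesis by (rule disjI1, rule bexI[OF _ mem]) simp
    next
      case 3
      then have "{i * n + z, i * n + x, (Suc i mod 3) * n + \<kappa> i (z, x)} \<in> mixed_blocks n \<kappa>"
        unfolding mixed_blocks_def using i z by blast
      then have mem: "{i * n + z, i * n + x, (Suc i mod 3) * n + y} \<in> mixed_blocks n \<kappa>" unfolding z' .
      show ?thesis by (rule disjI1, rule bexI[OF _ mem]) simp
    qed
  qed
  obtain i x where i: "i < 3" "x < n" "p = i * n + x" using level_point_cases[OF p(1)] by blast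
  obtain j y where j: "j < 3" "y < n" "q = j * n + y" using level_point_cases[OF p(2)] by blast
  consider "i = j" | "j = Suc i mod 3" | "i = Suc j mod 3"
    using less_3_cases[OF i(1)] less_3_cases[OF j(1)] by auto
  then show ?thesis
  proof cases
    case 1
    then have "x \<noteq> y" using p i j by auto
    then consider "x < y" | "y < x" by linarith
    then show ?thesis
    proof cases
      case a: 1
      then have mem: "{i * n + x, i * n + y, (Suc i mod 3) * n + \<kappa> i (x, y)} \<in> mixed_blocks n \<kappa>"
        unfolding mixed_blocks_def using i j by blast
      show ?thesis by (rule disjI1, rule bexI[OF _ mem]) (simp add: i j 1)
    next
      case a: 2
      then have mem: "{i * n + y, i * n + x, (Suc i mod 3) * n + \<kappa> i (y, x)} \<in> mixed_blocks n \<kappa>"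
        unfolding mixed_blocks_def using i j by blast
      show ?thesis by (rule disjI1, rule bexI[OF _ mem]) (simp add: i j 1)
    qed
  next
    case 2
    show ?thesis using adj[OF i(1,2) j(2)] i j 2 by blast
  next
    case 3
    have "{p, q} = {q, p}" by blast
    then show ?thesis using adj[OF j(1,2) i(2)] i j 3 by metis
  qed
qed

lemma mixed_blocks_determine:
  assumes B: "B \<in> steiner_triple_systems v" and sub: "mixed_blocks n \<kappa> \<subseteq> B" "mixed_blocks n \<kappa>' \<subseteq> B"
    and k: "\<And>i. i < 3 \<Longrightarrow> \<kappa> i \<in> sym_latin n d" "\<And>i. i < 3 \<Longrightarrow> \<kappa>' i \<in> sym_latin n d"
    and i: "i < 3"
  shows "\<kappa> i = \<kappa>' i"
proof -
  have less: "\<kappa> i (x, y) = \<kappa>' i (x, y)" if xy: "x < y" "y < n" for x y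
  proof -
    let ?b = "\<lambda>\<kappa>. {i * n + x, i * n + y, (Suc i mod 3) * n + \<kappa> i (x, y)}"
    have b: "?b \<kappa> \<in> mixed_blocks n \<kappa>" "?b \<kappa>' \<in> mixed_blocks n \<kappa>'"
      unfolding mixed_blocks_def using i xy by blast+
    then have bB: "?b \<kappa> \<in> B" "?b \<kappa>' \<in> B" using sub by auto
    have eq: "?b \<kappa> = ?b \<kappa>'"
      by (rule steiner_block_unique[OF B bB, of "i * n + x" "i * n + y"]) (use xy in simp_all)
    have z: "\<kappa> i (x, y) < n" "\<kappa>' i (x, y) < n"
      using sym_latinD(2)[OF k(1)[OF i], of x y] sym_latinD(2)[OF k(2)[OF i], of x y] xy by simp_all
    have "(Suc i mod 3) * n + \<kappa> i (x, y) \<in> ?b \<kappa>'" using eq by blast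
    moreover have "(Suc i mod 3) * n + \<kappa> i (x, y) \<noteq> i * n + x" "(Suc i mod 3) * n + \<kappa> i (x, y) \<noteq> i * n + y"
      using level_point_eq_iff[OF z(1), of x "Suc i mod 3" i] level_point_eq_iff[OF z(1), of y "Suc i mod 3" i]
        xy Suc_mod_3_neq(1)[OF i] by simp_all
    ultimately have "(Suc i mod 3) * n + \<kappa> i (x, y) = (Suc i mod 3) * n + \<kappa>' i (x, y)"
      by (metis insertE singletonD)
    then show ?thesis by simp
  qed
  show ?thesis
  proof (rule square_fun_ext[OF sym_latinD(1)[OF k(1)[OF i]] sym_latinD(1)[OF k(2)[OF i]]])
    fix x y assume xy: "x < n" "y < n"
    consider "x = y" | "x < y" | "y < x" by linarith
    then show "\<kappa> i (x, y) = \<kappa>' i (x, y)"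
    proof cases
      case 1
      then show ?thesis using sym_latinD(5)[OF k(1)[OF i] xy(1)] sym_latinD(5)[OF k(2)[OF i] xy(1)] by simp
    next
      case 2
      then show ?thesis using less xy by simp
    next
      case 3
      then show ?thesis
        using less[OF 3 xy(1)] sym_latinD(4)[OF k(1)[OF i] xy] sym_latinD(4)[OF k(2)[OF i] xy] by simp
    qed
  qed
qed

text \<open>The three levels use independent squares. With order n/3 this yields the exponent 3 *
  3/8 * (n/3)^2 = n^2/8.\<close>

lemma card_steiner_ge_cube:
  assumes "\<And>\<kappa>. (\<And>i. i < 3 \<Longrightarrow> \<kappa> i \<in> sym_latin n d) \<Longrightarrow> mixed_blocks n \<kappa> \<union> R \<in> steiner_triple_systems v"
  shows "card (sym_latin n d) ^ 3 \<le> card (steiner_triple_systems v)"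
proof -
  let ?K = "{..<3::nat} \<rightarrow>\<^sub>E sym_latin n d"
  have "card (sym_latin n d) ^ 3 = card ?K" by (simp add: card_funcsetE)
  also have "\<dots> \<le> card (steiner_triple_systems v)"
  proof (rule card_inj_on_le)
    show "(\<lambda>\<kappa>. mixed_blocks n \<kappa> \<union> R) ` ?K \<subseteq> steiner_triple_systems v"
      using assms by (auto simp: PiE_iff)
    show "inj_on (\<lambda>\<kappa>. mixed_blocks n \<kappa> \<union> R) ?K"
    proof (rule inj_onI)
      fix \<kappa> \<kappa>' assume k: "\<kappa> \<in> ?K" "\<kappa>' \<in> ?K" and eq: "mixed_blocks n \<kappa> \<union> R = mixed_blocks n \<kappa>' \<union> R"
      have kk: "\<kappa> i \<in> sym_latin n d" "\<kappa>' i \<in> sym_latin n d" if "i < 3" for i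
        using PiE_mem[OF k(1), of i] PiE_mem[OF k(2), of i] that by simp_all
      have "mixed_blocks n \<kappa> \<union> R \<in> steiner_triple_systems v" using kk(1) by (rule assms)
      moreover have "mixed_blocks n \<kappa> \<subseteq> mixed_blocks n \<kappa> \<union> R" "mixed_blocks n \<kappa>' \<subseteq> mixed_blocks n \<kappa> \<union> R"
        using eq by blast+
      ultimately have "\<kappa> i = \<kappa>' i" if "i < 3" for i
        using kk that by (rule mixed_blocks_determine)
      then show "\<kappa> = \<kappa>'" by (intro PiE_ext[OF k]) simp
    qed
  qed (rule finite_steiner_triple_systems)
  finally show ?thesis .
qed

text \<open>For an idempotent square the exceptional pairs are vertical, and the vertical triples
  absorb them. The number of blocks is right by 9n(n - 1) + 6n = 3n(3n - 1).\<close>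

lemma card_steiner_ge_Bose:
  "card (idempotent_latin n) ^ 3 \<le> card (steiner_triple_systems (3 * n))"
proof (rule card_steiner_ge_cube)
  let ?R = "(\<lambda>x. {0 * n + x, 1 * n + x, 2 * n + x}) ` {..<n}"
  fix \<kappa> :: "nat \<Rightarrow> nat \<times> nat \<Rightarrow> nat" assume k: "\<And>i. i < 3 \<Longrightarrow> \<kappa> i \<in> idempotent_latin n"
  show "mixed_blocks n \<kappa> \<union> ?R \<in> steiner_triple_systems (3 * n)"
  proof (rule steiner_triple_systemsI)
    show "b \<subseteq> {0..<3 * n} \<and> card b = 3" if "b \<in> mixed_blocks n \<kappa> \<union> ?R" for b
    proof (cases "b \<in> mixed_blocks n \<kappa>")
      case True
      show ?thesis by (rule mixed_blocksD[OF k True])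
    next
      case False
      then show ?thesis using that by auto
    qed
    show "\<exists>b\<in>mixed_blocks n \<kappa> \<union> ?R. p \<in> b \<and> q \<in> b" if pq: "p < 3 * n" "q < 3 * n" "p \<noteq> q" for p q
    proof -
      have adj: "\<exists>b\<in>mixed_blocks n \<kappa> \<union> ?R. p \<in> b \<and> q \<in> b"
        if i: "i < 3" "x < n" "{p, q} = {i * n + x, (Suc i mod 3) * n + x}" for i x
      proof -
        have "j * n + x \<in> {0 * n + x, 1 * n + x, 2 * n + x}" if "j < 3" for j
          using less_3_cases[OF that] by auto
        then have "{p, q} \<subseteq> {0 * n + x, 1 * n + x, 2 * n + x}"
          unfolding i(3) using i(1) Suc_mod_3_neq(2)[OF i(1)] by blast
        moreover have "{0 * n + x, 1 * n + x, 2 * n + x} \<in> ?R" using i(2) by blast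
        ultimately show ?thesis by blast
      qed
      from mixed_blocks_cover[OF k pq] show ?thesis
      proof
        assume "\<exists>b\<in>mixed_blocks n \<kappa>. p \<in> b \<and> q \<in> b"
        then show ?thesis by blast
      next
        assume "\<exists>i x. i < 3 \<and> x < n \<and> {p, q} = {i * n + x, (Suc i mod 3) * n + x}"
        then obtain i x where "i < 3" "x < n" "{p, q} = {i * n + x, (Suc i mod 3) * n + x}" by blast
        then show ?thesis by (rule adj)
      qed
    qed
    have "card (mixed_blocks n \<kappa> \<union> ?R) \<le> card (mixed_blocks n \<kappa>) + card ?R" by (rule card_Un_le)
    also have "card ?R \<le> n" using card_image_le[of "{..<n}"] by simp
    finally have "6 * card (mixed_blocks n \<kappa> \<union> ?R) \<le> 9 * n * (n - 1) + 6 * n"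
      using card_mixed_blocks[of n \<kappa>] by linarith
    also have "\<dots> = 3 * n * (3 * n - 1)" by (cases n) (simp_all add: algebra_simps)
    finally show "6 * card (mixed_blocks n \<kappa> \<union> ?R) \<le> 3 * n * (3 * n - 1)" .
  qed
qed

text \<open>The diagonal \<open>x mod t\<close> leaves two kinds of exceptional pairs. For x < t
  they are vertical and lie in the triples \<open>?R1\<close>; for t + x they join t + x on level i
  to x on the next level, and the blocks \<open>?R2\<close> complete them by the point at infinity,
  coded as 3 * 2t = 6t.\<close>

lemma card_steiner_ge_Skolem:
  assumes t: "t > 0"
  shows "card (half_idempotent_latin t) ^ 3 \<le> card (steiner_triple_systems (6 * t + 1))"
proof (rule card_steiner_ge_cube)
  let ?n = "2 * t"
  let ?R1 = "(\<lambda>x. {0 * ?n + x, 1 * ?n + x, 2 * ?n + x}) ` {..<t}"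
  let ?g = "\<lambda>(i, x). {3 * ?n, i * ?n + (t + x), (Suc i mod 3) * ?n + x}"
  let ?R2 = "?g ` ({..<3} \<times> {..<t})"
  fix \<kappa> :: "nat \<Rightarrow> nat \<times> nat \<Rightarrow> nat" assume k: "\<And>i. i < 3 \<Longrightarrow> \<kappa> i \<in> half_idempotent_latin t"
  let ?M = "mixed_blocks ?n \<kappa>"
  show "?M \<union> (?R1 \<union> ?R2) \<in> steiner_triple_systems (6 * t + 1)"
  proof (rule steiner_triple_systemsI)
    show "b \<subseteq> {0..<6 * t + 1} \<and> card b = 3" if b: "b \<in> ?M \<union> (?R1 \<union> ?R2)" for b
    proof -
      consider "b \<in> ?M" | "b \<in> ?R1" | "b \<in> ?R2" using b by blast
      then show ?thesis
      proof cases
        case 1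
        show ?thesis using mixed_blocksD[OF k 1] by auto
      next
        case 2
        then show ?thesis by auto
      next
        case 3
        then obtain i x where b: "b = {3 * ?n, i * ?n + (t + x), (Suc i mod 3) * ?n + x}" and i: "i < 3" "x < t" by auto
        have "i * ?n + (t + x) < 3 * ?n" "(Suc i mod 3) * ?n + x < 3 * ?n"
          using level_point_less[of i "t + x" ?n] level_point_less[of "Suc i mod 3" x ?n] i by auto
        moreover have "i * ?n + (t + x) \<noteq> (Suc i mod 3) * ?n + x"
          using level_point_eq_iff[of "t + x" ?n x i "Suc i mod 3"] i t by simp
        ultimately show ?thesis unfolding b by auto
      qed
    qed
    show "\<exists>b\<in>?M \<union> (?R1 \<union> ?R2). p \<in> b \<and> q \<in> b" if pq: "p < 6 * t + 1" "q < 6 * t + 1" "p \<noteq> q" for p q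
    proof -
      have R2: "?g (i, x) \<in> ?R2" if "i < 3" "x < t" for i x using that by blast
      \<comment> \<open>A point with x < t meets infinity as the lower end of a pair starting on the
        preceding level, a point with x >= t as the upper end of a pair starting on its own
        level.\<close>
      have inf: "\<exists>b\<in>?R2. 3 * ?n \<in> b \<and> r \<in> b" if "r < 3 * ?n" for r
      proof -
        obtain i x where r: "i < 3" "x < ?n" "r = i * ?n + x" using level_point_cases[OF \<open>r < 3 * ?n\<close>] by blast
        show ?thesis
        proof (cases "x < t")
          case True
          obtain j where "j < 3" "i = Suc j mod 3" using Suc_mod_3_surj[OF r(1)] by blast
          then show ?thesis using R2[of j x] True r by (intro bexI[of _ "?g (j, x)"]) auto
        next
          case False
          then have "x = t + (x - t)" "x - t < t" using r by auto
          then show ?thesis using R2[of i "x - t"] r by (intro bexI[of _ "?g (i, x - t)"]) auto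
        qed
      qed
      have adj: "\<exists>b\<in>?R1 \<union> ?R2. {p, q} \<subseteq> b"
        if i: "i < 3" "x < ?n" "{p, q} = {i * ?n + x, (Suc i mod 3) * ?n + x mod t}" for i x
      proof (cases "x < t")
        case True
        have "j * ?n + x \<in> {0 * ?n + x, 1 * ?n + x, 2 * ?n + x}" if "j < 3" for j
          using less_3_cases[OF that] by auto
        moreover have "x mod t = x" using True by simp
        ultimately have "{p, q} \<subseteq> {0 * ?n + x, 1 * ?n + x, 2 * ?n + x}"
          unfolding i(3) using i(1) Suc_mod_3_neq(2)[OF i(1)] by (metis empty_subsetI insert_subset)
        moreover have "{0 * ?n + x, 1 * ?n + x, 2 * ?n + x} \<in> ?R1" using True by blast
        ultimately show ?thesis by blast
      next
        case False
        then have x: "x = t + (x - t)" "x - t < t" using i by auto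
        then have "x mod t = x - t" by (metis mod_add_self1 mod_less)
        then have "{p, q} \<subseteq> ?g (i, x - t)" unfolding i(3) using x by auto
        then show ?thesis by (rule bexI) (rule UnI2[OF R2[OF i(1) x(2)]])
      qed
      have cov: ?thesis if "b \<in> ?R1 \<union> ?R2" "p \<in> b" "q \<in> b" for b
        by (rule bexI[OF _ UnI2[OF that(1)]]) (rule conjI[OF that(2,3)])
      consider "p = 3 * ?n" | "q = 3 * ?n" | "p < 3 * ?n" "q < 3 * ?n" using pq by linarith
      then show ?thesis
      proof cases
        case 1
        then have "q < 3 * ?n" using pq by linarith
        from inf[OF this] obtain b where b: "b \<in> ?R2" "3 * ?n \<in> b" "q \<in> b" by (elim bexE conjE)
        show ?thesis by (rule cov[OF UnI2[OF b(1)] _ b(3)]) (unfold 1, rule b(2))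
      next
        case 2
        then have "p < 3 * ?n" using pq by linarith
        from inf[OF this] obtain b where b: "b \<in> ?R2" "3 * ?n \<in> b" "p \<in> b" by (elim bexE conjE)
        show ?thesis by (rule cov[OF UnI2[OF b(1)] b(3)]) (unfold 2, rule b(2))
      next
        case 3
        from mixed_blocks_cover[OF k this pq(3)] show ?thesis
        proof
          assume "\<exists>b\<in>?M. p \<in> b \<and> q \<in> b"
          then show ?thesis by blast
        next
          assume "\<exists>i x. i < 3 \<and> x < ?n \<and> {p, q} = {i * ?n + x, (Suc i mod 3) * ?n + x mod t}"
          then obtain i x where "i < 3" "x < ?n" "{p, q} = {i * ?n + x, (Suc i mod 3) * ?n + x mod t}" by blast
          then have "\<exists>b\<in>?R1 \<union> ?R2. {p, q} \<subseteq> b" by (rule adj)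
          then obtain b where b: "b \<in> ?R1 \<union> ?R2" "{p, q} \<subseteq> b" by (elim bexE)
          show ?thesis by (rule cov[OF b(1)]) (use b(2) in simp_all)
        qed
      qed
    qed
    have "card (?M \<union> (?R1 \<union> ?R2)) \<le> card ?M + card (?R1 \<union> ?R2)" by (rule card_Un_le)
    also have "card (?R1 \<union> ?R2) \<le> card ?R1 + card ?R2" by (rule card_Un_le)
    also have "card ?R1 \<le> t" using card_image_le[of "{..<t}"] by simp
    also have "card ?R2 \<le> 3 * t" using card_image_le[of "{..<3::nat} \<times> {..<t}" ?g] by simp
    finally have "6 * card (?M \<union> (?R1 \<union> ?R2)) \<le> 9 * ?n * (?n - 1) + 24 * t"
      using card_mixed_blocks[of ?n \<kappa>] by linarith
    also have "\<dots> = (6 * t + 1) * (6 * t + 1 - 1)"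
      using t by (cases t) (simp_all add: algebra_simps)
    finally show "6 * card (?M \<union> (?R1 \<union> ?R2)) \<le> (6 * t + 1) * (6 * t + 1 - 1)" .
  qed
qed

subsection \<open>Linear triple families with an automorphism\<close>

text \<open>Give every subset A the weight n^(-|A|). The sets counted have weight at least
  n^(-\<mu>) each, and all weights sum to (1 + 1/n)^|\<Omega>|. With |\<Omega>| of order n^3 the
  loss is exp(O(n^2)), negligible for \<mu> of order n^2.\<close>

lemma card_bounded_subsets_le:
  fixes n :: nat
  assumes fin: "finite \<Omega>" and n: "n \<ge> 1"
  shows "real (card {A. A \<subseteq> \<Omega> \<and> real (card A) \<le> \<mu>}) \<le> exp (real (card \<Omega>) / n) * n powr \<mu>"
    (is "real (card ?S) \<le> _")
proof -
  have n0: "real n > 0" using n by simp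
  have finS: "finite ?S" by (rule finite_subset[of _ "Pow \<Omega>"]) (use fin in auto)
  have "real (card ?S) * n powr (- \<mu>) = (\<Sum>A\<in>?S. n powr (- \<mu>))" by simp
  also have "\<dots> \<le> (\<Sum>A\<in>?S. (1 / real n) ^ card A)"
  proof (rule sum_mono)
    fix A assume A: "A \<in> ?S"
    have "real n powr (- \<mu>) \<le> real n powr (- real (card A))" using A n by (intro powr_mono) auto
    also have "\<dots> = (1 / real n) ^ card A"
      using n0 by (simp add: powr_minus powr_realpow power_inverse divide_inverse)
    finally show "real n powr (- \<mu>) \<le> (1 / real n) ^ card A" .
  qed
  also have "\<dots> \<le> (\<Sum>A\<in>Pow \<Omega>. (1 / real n) ^ card A)"
    by (rule sum_mono2) (use fin in auto)
  also have "\<dots> = (\<Prod>x\<in>\<Omega>. 1 / real n + 1)"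
    using prod_add[OF fin, of "\<lambda>_. 1 / real n" "\<lambda>_. 1"] by simp
  also have "\<dots> = (1 + 1 / real n) ^ card \<Omega>" by (simp add: add.commute)
  also have "\<dots> \<le> exp (1 / real n) ^ card \<Omega>"
    by (intro power_mono exp_ge_add_one_self) auto
  also have "\<dots> = exp (real (card \<Omega>) / n)" by (simp flip: exp_of_nat_mult)
  finally show ?thesis using n0 by (simp add: powr_minus field_simps)
qed

text \<open>A generating set of minimal size contains no image of one of its non-fixed members.\<close>

lemma small_generating_set:
  assumes fin: "finite B" and inv: "\<phi> ` B = B"
  obtains A where "A \<subseteq> B" "B = {(\<phi> ^^ k) a | k a. a \<in> A}"
    "2 * card A \<le> card B + card {b\<in>B. \<phi> b = b}"
proof -
  define cl where "cl A = {(\<phi> ^^ k) a | k a. a \<in> A}" for A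
  have itB: "(\<phi> ^^ k) a \<in> B" if "a \<in> B" for k a
    using that inv by (induction k) auto
  let ?P = "\<lambda>A. A \<subseteq> B \<and> cl A = B"
  have "?P B"
  proof -
    have "B \<subseteq> cl B"
    proof
      fix b assume "b \<in> B"
      then have "b = (\<phi> ^^ 0) b \<and> b \<in> B" by simp
      then show "b \<in> cl B" unfolding cl_def by blast
    qed
    then show ?thesis using itB unfolding cl_def by auto
  qed
  then obtain A where A: "?P A" and min: "\<And>A'. ?P A' \<Longrightarrow> card A \<le> card A'"
    using ex_has_least_nat[of ?P B card] by blast
  have finA: "finite A" using A fin finite_subset by blast
  have inj: "inj_on \<phi> B" using fin inv by (simp add: eq_card_imp_inj_on)
  let ?M = "{a\<in>A. \<phi> a \<noteq> a}" and ?F = "{a\<in>A. \<phi> a = a}"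
  have notin: "\<phi> a \<notin> A" if a: "a \<in> A" "\<phi> a \<noteq> a" for a
  proof
    assume in': "\<phi> a \<in> A"
    let ?A = "A - {\<phi> a}"
    have "B \<subseteq> cl ?A"
    proof
      fix b assume "b \<in> B"
      then have "b \<in> cl A" using A by simp
      then obtain k x where x: "x \<in> A" "b = (\<phi> ^^ k) x" unfolding cl_def by blast
      show "b \<in> cl ?A"
      proof (cases "x = \<phi> a")
        case True
        then have "b = (\<phi> ^^ Suc k) a" using x by (simp add: funpow_swap1)
        moreover have "a \<in> ?A" using a by auto
        ultimately show ?thesis unfolding cl_def by blast
      next
        case False
        then show ?thesis using x unfolding cl_def by blast
      qed
    qed
    moreover have "cl ?A \<subseteq> B" using A itB unfolding cl_def by blast
    ultimately have "?P ?A" using A by blast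
    then have "card A \<le> card ?A" by (rule min)
    then show False using in' finA by (metis card_Diff1_less linorder_not_less)
  qed
  \<comment> \<open>\<phi> maps the non-fixed members of A injectively into B - A, so they number at
    most |B| - |A|; adding the fixed members gives the bound on 2 * |A|.\<close>
  have "card ?M = card (\<phi> ` ?M)"
    by (rule card_image[symmetric]) (rule inj_on_subset[OF inj], use A in auto)
  also have "\<dots> \<le> card (B - A)"
    by (rule card_mono) (use fin notin inv A in auto)
  also have "\<dots> = card B - card A" using A finA by (simp add: card_Diff_subset)
  finally have 1: "card ?M \<le> card B - card A" .
  have "card (?M \<union> ?F) = card ?M + card ?F" by (rule card_Un_disjoint) (use finA in auto)
  moreover have "?M \<union> ?F = A" by auto
  ultimately have "card A = card ?M + card ?F" by simp
  moreover have "card ?F \<le> card {b\<in>B. \<phi> b = b}" by (rule card_mono) (use fin A in auto)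
  moreover have "card A \<le> card B" by (rule card_mono) (use fin A in auto)
  ultimately have "2 * card A \<le> card B + card {b\<in>B. \<phi> b = b}" using 1 by linarith
  then show ?thesis using that[of A] A unfolding cl_def by blast
qed

definition linear_family :: "'a set set \<Rightarrow> bool" where
  "linear_family B \<longleftrightarrow> (\<forall>b\<in>B. \<forall>b'\<in>B. \<forall>x y. x \<noteq> y \<and> {x, y} \<subseteq> b \<and> {x, y} \<subseteq> b' \<longrightarrow> b = b')"

lemma linear_familyD:
  "linear_family B \<Longrightarrow> b \<in> B \<Longrightarrow> b' \<in> B \<Longrightarrow> x \<noteq> y \<Longrightarrow> x \<in> b \<Longrightarrow> y \<in> b \<Longrightarrow> x \<in> b' \<Longrightarrow> y \<in> b' \<Longrightarrow> b = b'"
  unfolding linear_family_def by blast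

definition fixed_blocks :: "('a \<Rightarrow> 'a) \<Rightarrow> 'a set set \<Rightarrow> 'a set set" where
  "fixed_blocks f B = {b\<in>B. \<forall>x\<in>b. f x = x}"

text \<open>A block that is fixed but not pointwise fixed contains some \<open>{x, f x}\<close> with \<open>f x \<noteq> x\<close>, hence is
  determined by \<open>x\<close>.\<close>

lemma card_invariant_blocks_le:
  assumes V: "finite V" and B: "\<And>b. b \<in> B \<Longrightarrow> b \<subseteq> V" and lin: "linear_family B"
  shows "card {b\<in>B. f ` b = b} \<le> card (fixed_blocks f B) + card V"
proof -
  let ?N = "{b\<in>B. f ` b = b} - fixed_blocks f B"
  have finB: "finite B" by (rule finite_subset[of _ "Pow V"]) (use B V in auto)
  have "\<forall>b\<in>?N. \<exists>x\<in>b. f x \<noteq> x" by (auto simp: fixed_blocks_def)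
  then obtain p where p: "\<And>b. b \<in> ?N \<Longrightarrow> p b \<in> b \<and> f (p b) \<noteq> p b" by metis
  have "card ?N \<le> card V"
  proof (rule card_inj_on_le)
    show "p ` ?N \<subseteq> V" using p B by blast
    show "inj_on p ?N"
    proof (rule inj_onI)
      fix b b' assume b: "b \<in> ?N" "b' \<in> ?N" "p b = p b'"
      have "f (p b) \<in> b" "f (p b) \<in> b'" using p[OF b(1)] p[OF b(2)] b by auto
      then show "b = b'"
        using p[OF b(1)] p[OF b(2)] b by (intro linear_familyD[OF lin, of b b' "f (p b)" "p b"]) auto
    qed
  qed (rule V)
  moreover have "{b\<in>B. f ` b = b} \<subseteq> ?N \<union> fixed_blocks f B" by blast
  then have "card {b\<in>B. f ` b = b} \<le> card (?N \<union> fixed_blocks f B)"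
    by (rule card_mono[rotated]) (use finB in \<open>auto simp: fixed_blocks_def\<close>)
  ultimately show ?thesis using card_Un_le[of ?N "fixed_blocks f B"] by linarith
qed

text \<open>By linearity different blocks contain disjoint sets of pairs from D. It is applied with
  k = 1 to pairs from two parts of a Latin square, with k = 6 to ordered pairs of points of a triple
  system, and with k = 2 to pairs of a point and a parallel class.\<close>

lemma card_pairs_in_linear_family:
  assumes D: "finite D" "\<And>x y. (x, y) \<in> D \<Longrightarrow> x \<noteq> y" and fin: "finite B" and lin: "linear_family B"
    and k: "\<And>b. b \<in> B \<Longrightarrow> k \<le> card {(x, y)\<in>D. x \<in> b \<and> y \<in> b}"
  shows "k * card B \<le> card D"
proof -
  let ?S = "\<lambda>b. {(x, y)\<in>D. x \<in> b \<and> y \<in> b}"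
  have "k * card B \<le> (\<Sum>b\<in>B. card (?S b))" using sum_mono[of B "\<lambda>_. k"] k by (simp add: mult.commute)
  also have "\<dots> = card (\<Union>b\<in>B. ?S b)"
  proof (rule card_UN_disjoint[symmetric])
    show "finite B" by (rule fin)
    show "\<forall>b\<in>B. finite (?S b)" using D(1) by (auto intro: finite_subset[of _ D])
    show "\<forall>b\<in>B. \<forall>b'\<in>B. b \<noteq> b' \<longrightarrow> ?S b \<inter> ?S b' = {}"
    proof (intro ballI impI)
      fix b b' assume b: "b \<in> B" "b' \<in> B" "b \<noteq> b'"
      show "?S b \<inter> ?S b' = {}"
        using linear_familyD[OF lin b(1,2)] b(3) D(2) by blast
    qed
  qed
  also have "\<dots> \<le> card D" by (rule card_mono) (use D(1) in auto)
  finally show ?thesis .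
qed

text \<open>If \<open>x\<close> is moved and \<open>y\<close> is fixed, then the third point of the block through \<open>x\<close> and \<open>y\<close> is moved.\<close>

lemma card_fixed_points_le:
  assumes lin: "linear_family B" and inv: "(\<lambda>b. f ` b) ` B = B" and x: "f x \<noteq> x"
    and Y: "\<And>y. y \<in> Y \<Longrightarrow> f y = y"
    and W: "finite W" "\<And>y. y \<in> Y \<Longrightarrow> \<exists>z\<in>W. z \<noteq> x \<and> z \<noteq> y \<and> {x, y, z} \<in> B"
  shows "card Y \<le> card {z\<in>W. f z \<noteq> z}"
proof -
  obtain z where z: "\<And>y. y \<in> Y \<Longrightarrow> z y \<in> W \<and> z y \<noteq> x \<and> z y \<noteq> y \<and> {x, y, z y} \<in> B"
    using W(2) by metis
  show ?thesis
  proof (rule card_inj_on_le)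
    show "z ` Y \<subseteq> {z\<in>W. f z \<noteq> z}"
    proof (rule image_subsetI, rule CollectI, rule conjI)
      fix y assume y: "y \<in> Y"
      show "z y \<in> W" using z[OF y] by blast
      show "f (z y) \<noteq> z y"
      proof
        assume fz: "f (z y) = z y"
        let ?b = "{x, y, z y}"
        have b: "?b \<in> B" using z[OF y] by blast
        then have fb: "f ` ?b \<in> B" using inv by blast
        have fb_eq: "f ` ?b = {f x, y, z y}" using Y[OF y] fz by auto
        have "y \<in> f ` ?b" "z y \<in> f ` ?b" unfolding fb_eq by simp_all
        moreover have "y \<noteq> z y" using z[OF y] by metis
        ultimately have "f ` ?b = ?b" by (intro linear_familyD[OF lin fb b]) (assumption | simp)+
        then have "x \<in> {f x, y, z y}" unfolding fb_eq by blast
        moreover have "x \<noteq> y" using x Y[OF y] by metis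
        ultimately have "f x = x" using z[OF y] by (metis insertE singletonD)
        then show False using x by simp
      qed
    qed
    show "inj_on z Y"
    proof (rule inj_onI)
      fix y y' assume y: "y \<in> Y" "y' \<in> Y" "z y = z y'"
      have "{x, y, z y} = {x, y', z y'}"
        by (rule linear_familyD[OF lin, of _ _ x "z y"]) (use z[OF y(1)] z[OF y(2)] y in auto)
      moreover have "y \<noteq> x" "y' \<noteq> x" using x Y y by metis+
      ultimately show "y = y'" using z[OF y(1)] z[OF y(2)] y(3) by (metis insertCI insertE singletonD)
    qed
  qed (use W(1) in auto)
qed

lemma card_3_subsets_le:
  assumes "finite V" "card V \<le> 3 * n"
  shows "card {b. b \<subseteq> V \<and> card b = 3} \<le> 27 * n ^ 3"
proof -
  have "card {b. b \<subseteq> V \<and> card b = 3} = card V choose 3" using assms(1) by (rule n_subsets)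
  also have "\<dots> \<le> card V ^ 3" 
    using binomial_le_pow[of 3 "card V"] by (cases "3 \<le> card V") (simp_all add: binomial_eq_0)
  also have "\<dots> \<le> (3 * n) ^ 3" using assms(2) by (rule power_mono) simp
  finally show ?thesis by (simp add: power_mult_distrib)
qed

text \<open>The first factor bounds the self-maps of a set of at most 3n points, the others the
  possible generating sets. Here s * n^2 bounds all blocks plus the pointwise fixed ones, 3n the
  remaining invariant blocks, and 27 comes from having at most 27 * n^3 triples.\<close>

definition aut_bound :: "real \<Rightarrow> nat \<Rightarrow> real" where
  "aut_bound s n = (3 * real n) powr (3 * real n) * (exp (27 * (real n)\<^sup>2) * real n powr ((s * (real n)\<^sup>2 + 3 * real n) / 2))"

text \<open>A family is recovered from the restriction of f to V and a generating set, whose size is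
  at most half of all blocks plus invariant blocks.\<close>

lemma card_families_with_automorphism_le:
  fixes V :: "'a set"
  assumes V: "finite V" "card V \<le> 3 * n" and n: "n \<ge> 1"
    and blocks: "\<And>B b. B \<in> \<F> \<Longrightarrow> b \<in> B \<Longrightarrow> b \<subseteq> V \<and> card b = 3"
    and lin: "\<And>B. B \<in> \<F> \<Longrightarrow> linear_family B"
    and aut: "\<And>B. B \<in> \<F> \<Longrightarrow> \<exists>f. f ` V \<subseteq> V \<and> (\<lambda>b. f ` b) ` B = B \<and>
       real (card B) + real (card (fixed_blocks f B)) \<le> s * (real n)\<^sup>2"
  shows "real (card \<F>) \<le> aut_bound s n"
proof -
  let ?\<Omega> = "{b. b \<subseteq> V \<and> card b = 3}"
  let ?S = "{A. A \<subseteq> ?\<Omega> \<and> real (card A) \<le> (s * (real n)\<^sup>2 + 3 * n) / 2}"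
  have fin\<Omega>: "finite ?\<Omega>" by (rule finite_subset[of _ "Pow V"]) (use V in auto)
  have finS: "finite ?S" by (rule finite_subset[of _ "Pow ?\<Omega>"]) (use fin\<Omega> in auto)
  let ?G = "\<lambda>(f, A). {((\<lambda>b. f ` b) ^^ k) a | k a. a \<in> A}"
  have "\<F> \<subseteq> ?G ` ((V \<rightarrow>\<^sub>E V) \<times> ?S)"
  proof
    fix B assume B: "B \<in> \<F>"
    have BV: "b \<subseteq> V" "card b = 3" if "b \<in> B" for b using blocks[OF B that] by auto
    have finB: "finite B" by (rule finite_subset[OF _ fin\<Omega>]) (use BV in auto)
    obtain f where f: "f ` V \<subseteq> V" "(\<lambda>b. f ` b) ` B = B" "real (card B) + real (card (fixed_blocks f B)) \<le> s * (real n)\<^sup>2"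
      using aut[OF B] by blast
    let ?f = "restrict f V"
    have img: "?f ` b = f ` b" if "b \<in> B" for b
      using BV(1)[OF that] by (intro image_cong) auto
    have "(\<lambda>b. ?f ` b) ` B = (\<lambda>b. f ` b) ` B" by (rule image_cong[OF refl img])
    then have inv: "(\<lambda>b. ?f ` b) ` B = B" using f(2) by simp
    obtain A where A: "A \<subseteq> B" "B = {((\<lambda>b. ?f ` b) ^^ k) a | k a. a \<in> A}"
      "2 * card A \<le> card B + card {b\<in>B. ?f ` b = b}"
      using small_generating_set[OF finB inv] by blast
    have "{b\<in>B. ?f ` b = b} = {b\<in>B. f ` b = b}" using img by (intro Collect_cong) metis
    then have "card {b\<in>B. ?f ` b = b} \<le> card (fixed_blocks f B) + card V"
      using card_invariant_blocks_le[OF V(1) BV(1) lin[OF B], of f] by simp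
    then have "2 * card A \<le> card B + card (fixed_blocks f B) + 3 * n" using A(3) V(2) by linarith
    then have "real (2 * card A) \<le> real (card B + card (fixed_blocks f B) + 3 * n)" by (rule of_nat_mono)
    then have "real (card A) \<le> (s * (real n)\<^sup>2 + 3 * n) / 2" using f(3) by simp
    moreover have "A \<subseteq> ?\<Omega>" using A(1) BV by auto
    moreover have "?f \<in> V \<rightarrow>\<^sub>E V" using f(1) by auto
    ultimately have "(?f, A) \<in> (V \<rightarrow>\<^sub>E V) \<times> ?S" by blast
    moreover have "B = ?G (?f, A)" by (simp only: prod.case) (rule A(2))
    ultimately show "B \<in> ?G ` ((V \<rightarrow>\<^sub>E V) \<times> ?S)" by blast
  qed
  then have "card \<F> \<le> card ((V \<rightarrow>\<^sub>E V) \<times> ?S)"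
    by (rule surj_card_le[rotated]) (use V finS in \<open>auto intro!: finite_PiE\<close>)
  also have "\<dots> = card V ^ card V * card ?S"
    using V by (simp add: card_cartesian_product card_funcsetE)
  finally have "real (card \<F>) \<le> real (card V ^ card V * card ?S)" by (rule of_nat_mono)
  also have "\<dots> = real (card V) ^ card V * real (card ?S)" by simp
  also have "\<dots> \<le> (3 * n) powr (3 * n) * (exp (27 * (real n)\<^sup>2) * n powr ((s * (real n)\<^sup>2 + 3 * n) / 2))"
  proof (rule mult_mono)
    have "real (card V) ^ card V \<le> real (3 * n) ^ card V" using V(2) by (intro power_mono of_nat_mono) auto
    also have "\<dots> \<le> real (3 * n) ^ (3 * n)" using V(2) n by (intro power_increasing) auto
    also have "\<dots> = (3 * n) powr (3 * n)" using n by (subst powr_realpow) auto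
    finally show "real (card V) ^ card V \<le> (3 * n) powr (3 * n)" .
    have "real (card ?S) \<le> exp (real (card ?\<Omega>) / n) * n powr ((s * (real n)\<^sup>2 + 3 * n) / 2)"
      by (rule card_bounded_subsets_le[OF fin\<Omega> n])
    also have "\<dots> \<le> exp (27 * (real n)\<^sup>2) * n powr ((s * (real n)\<^sup>2 + 3 * n) / 2)"
    proof -
      have "real (card ?\<Omega>) \<le> real (27 * n ^ 3)" by (rule of_nat_mono[OF card_3_subsets_le[OF V]])
      then have "real (card ?\<Omega>) / n \<le> 27 * (real n)\<^sup>2"
        using n by (simp add: field_simps power3_eq_cube power2_eq_square)
      then show ?thesis by (intro mult_right_mono) auto
    qed
    finally show "real (card ?S) \<le> exp (27 * (real n)\<^sup>2) * n powr ((s * (real n)\<^sup>2 + 3 * n) / 2)" .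
  qed auto
  finally show ?thesis by (simp add: aut_bound_def)
qed

subsection \<open>Latin squares with a nontrivial automorphism\<close>

lemma finite_latin_squares: "finite (latin_squares n)"
  by (rule finite_subset[of _ "Pow ({0..<n} \<times> {0..<n} \<times> {0..<n})"]) (auto simp: latin_squares_def)

lemma card_latin_funs_le_latin_squares: "card (latin_funs n) \<le> card (latin_squares n)"
proof (rule card_inj_on_le)
  let ?g = "\<lambda>M. {(x, y, z). x < n \<and> y < n \<and> z = M (x, y)}"
  show "?g ` latin_funs n \<subseteq> latin_squares n"
  proof (rule image_subsetI)
    fix M assume M: "M \<in> latin_funs n"
    have 1: "\<exists>!j. (i, j, k) \<in> ?g M" if ik: "i < n" "k < n" for i k
    proof -
      obtain y where y: "y < n" "M (i, y) = k" using latin_funs_surj(1)[OF M ik] by blast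
      show ?thesis
      proof (rule ex1I[of _ y])
        show "(i, y, k) \<in> ?g M" using y ik by simp
        show "j = y" if "(i, j, k) \<in> ?g M" for j
          using latin_funsD(3)[OF M, of i j y] that y \<open>i < n\<close> by simp
      qed
    qed
    have 2: "\<exists>!i. (i, j, k) \<in> ?g M" if jk: "j < n" "k < n" for j k
    proof -
      obtain y where y: "y < n" "M (y, j) = k" using latin_funs_surj(2)[OF M jk] by blast
      show ?thesis
      proof (rule ex1I[of _ y])
        show "(y, j, k) \<in> ?g M" using y jk by simp
        show "i = y" if "(i, j, k) \<in> ?g M" for i
          using latin_funsD(4)[OF M, of i y j] that y \<open>j < n\<close> by simp
      qed
    qed
    have "?g M \<subseteq> {0..<n} \<times> {0..<n} \<times> {0..<n}" using latin_funsD(2)[OF M] by auto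
    then show "?g M \<in> latin_squares n" unfolding latin_squares_def using 1 2 by simp
  qed
  show "inj_on ?g (latin_funs n)"
  proof (rule inj_onI)
    fix M M' assume M: "M \<in> latin_funs n" "M' \<in> latin_funs n" and eq: "?g M = ?g M'"
    show "M = M'"
    proof (rule square_fun_ext[OF latin_funsD(1)[OF M(1)] latin_funsD(1)[OF M(2)]])
      fix x y assume "x < n" "y < n"
      then have "(x, y, M (x, y)) \<in> ?g M" by simp
      then show "M (x, y) = M' (x, y)" unfolding eq by simp
    qed
  qed
qed (rule finite_latin_squares)

lemma latin_square_subset: "S \<in> latin_squares n \<Longrightarrow> S \<subseteq> {0..<n} \<times> {0..<n} \<times> {0..<n}"
  by (simp add: latin_squares_def)

lemma latin_square_unique:
  assumes S: "S \<in> latin_squares n" and 1: "(i, j, k) \<in> S" and 2: "(i', j', k') \<in> S"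
  shows "i = i' \<Longrightarrow> j = j' \<Longrightarrow> k = k'" "i = i' \<Longrightarrow> k = k' \<Longrightarrow> j = j'" "j = j' \<Longrightarrow> k = k' \<Longrightarrow> i = i'"
proof -
  have sub: "S \<subseteq> {0..<n} \<times> {0..<n} \<times> {0..<n}"
    and a: "\<forall>i<n. \<forall>j<n. \<exists>!k. (i, j, k) \<in> S" and b: "\<forall>i<n. \<forall>k<n. \<exists>!j. (i, j, k) \<in> S"
    and c: "\<forall>j<n. \<forall>k<n. \<exists>!i. (i, j, k) \<in> S"
    using S by (simp_all add: latin_squares_def)
  have lt: "i < n" "j < n" "k < n" using sub 1 by auto
  show "k = k'" if "i = i'" "j = j'" using a lt 1 2 that by blast
  show "j = j'" if "i = i'" "k = k'" using b lt 1 2 that by blast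
  show "i = i'" if "j = j'" "k = k'" using c lt 1 2 that by blast
qed

lemma ls_cells_mem: "(i, j, k) \<in> S \<Longrightarrow> {(0, i), (1, j), (2, k)} \<in> ls_cells S"
  unfolding ls_cells_def by blast

lemma ls_cellsE:
  assumes "b \<in> ls_cells S"
  obtains i j k where "b = {(0, i), (1, j), (2, k)}" "(i, j, k) \<in> S"
  using assms unfolding ls_cells_def by blast

lemma inj_ls_cells: "inj ls_cells"
proof -
  have sub: "S \<subseteq> S'" if eq: "ls_cells S = ls_cells S'" for S S'
  proof (rule subsetI)
    fix p assume p: "p \<in> S"
    obtain i j k where p': "p = (i, j, k)" by (metis surj_pair)
    have "{(0, i), (1, j), (2, k)} \<in> ls_cells S'" using ls_cells_mem[of i j k S] p p' eq by simp
    then obtain i' j' k' where e: "{(0, i), (1, j), (2, k)} = {(0::nat, i'), (1, j'), (2, k')}" "(i', j', k') \<in> S'"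
      by (rule ls_cellsE)
    have "(0, i) \<in> {(0::nat, i'), (1, j'), (2, k')}" "(1, j) \<in> {(0::nat, i'), (1, j'), (2, k')}"
      "(2, k) \<in> {(0::nat, i'), (1, j'), (2, k')}" unfolding e(1)[symmetric] by simp_all
    then show "p \<in> S'" using e(2) p' by simp
  qed
  show ?thesis by (rule injI) (use sub in blast)
qed

lemma ls_cells_linear:
  assumes S: "S \<in> latin_squares n"
  shows "linear_family (ls_cells S)"
  unfolding linear_family_def
proof (intro ballI allI impI)
  fix b b' x y assume b: "b \<in> ls_cells S" and b': "b' \<in> ls_cells S" and xy: "x \<noteq> y \<and> {x, y} \<subseteq> b \<and> {x, y} \<subseteq> b'"
  obtain i j k where 1: "b = {(0, i), (1, j), (2, k)}" "(i, j, k) \<in> S" using b by (rule ls_cellsE)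
  obtain i' j' k' where 2: "b' = {(0, i'), (1, j'), (2, k')}" "(i', j', k') \<in> S" using b' by (rule ls_cellsE)
  have "i = i' \<and> j = j' \<or> i = i' \<and> k = k' \<or> j = j' \<and> k = k'"
  proof -
    have x: "x \<in> b" "x \<in> b'" and y: "y \<in> b" "y \<in> b'" and ne: "x \<noteq> y" using xy by blast+
    have "x = (0, i) \<and> i = i' \<or> x = (1, j) \<and> j = j' \<or> x = (2, k) \<and> k = k'"
      using x unfolding 1(1) 2(1) by (elim insertE emptyE) simp_all
    moreover have "y = (0, i) \<and> i = i' \<or> y = (1, j) \<and> j = j' \<or> y = (2, k) \<and> k = k'"
      using y unfolding 1(1) 2(1) by (elim insertE emptyE) simp_all
    ultimately show ?thesis using ne by blast
  qed
  then have "i = i' \<and> j = j' \<and> k = k'" using latin_square_unique[OF S 1(2) 2(2)] by blast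
  then show "b = b'" using 1 2 by simp
qed

text \<open>The three cyclic orders of rows, columns and symbols are treated at once, so that a
  moved point may afterwards be taken in any part.\<close>

lemma ls_cells_cover:
  assumes S: "S \<in> latin_squares n" and ac: "a < n" "c < n"
    and pqr: "(p, q, r) \<in> {(0, 1, 2), (1, 2, 0), (2, 0, 1)}"
  shows "\<exists>k<n. {(p, a), (q, c), (r, k)} \<in> ls_cells S"
proof -
  have sub: "S \<subseteq> {0..<n} \<times> {0..<n} \<times> {0..<n}"
    and ex: "\<forall>i<n. \<forall>j<n. \<exists>!k. (i, j, k) \<in> S" "\<forall>i<n. \<forall>k<n. \<exists>!j. (i, j, k) \<in> S"
      "\<forall>j<n. \<forall>k<n. \<exists>!i. (i, j, k) \<in> S"
    using S by (simp_all add: latin_squares_def)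
  consider "(p, q, r) = (0, 1, 2)" | "(p, q, r) = (1, 2, 0)" | "(p, q, r) = (2, 0, 1)" using pqr by blast
  then show ?thesis
  proof cases
    case 1
    obtain k where k: "(a, c, k) \<in> S" using ex(1) ac by blast
    then have "k < n" using sub by auto
    then show ?thesis using ls_cells_mem[OF k] 1 by auto
  next
    case 2
    obtain k where k: "(k, a, c) \<in> S" using ex(3) ac by blast
    then have "k < n" using sub by auto
    moreover have "{(1, a), (2, c), (0, k)} = {(0, k), (1, a), (2::nat, c)}" by auto
    ultimately show ?thesis using ls_cells_mem[OF k] 2 by auto
  next
    case 3
    obtain k where k: "(c, k, a) \<in> S" using ex(2) ac by blast
    then have "k < n" using sub by auto
    moreover have "{(2, a), (0, c), (1, k)} = {(0, c), (1, k), (2::nat, a)}" by auto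
    ultimately show ?thesis using ls_cells_mem[OF k] 3 by auto
  qed
qed

lemma linear_family_subset: "linear_family B \<Longrightarrow> A \<subseteq> B \<Longrightarrow> linear_family A"
  unfolding linear_family_def by blast

lemma mult_le_quarter_square:
  fixes a b n :: nat
  assumes "a + b \<le> n"
  shows "4 * (a * b) \<le> n\<^sup>2"
proof -
  have "4 * (int a * int b) \<le> (int a + int b)\<^sup>2"
    using zero_le_power2[of "int a - int b"] by (simp add: power2_eq_square algebra_simps)
  also have "\<dots> \<le> (int n)\<^sup>2" using assms by (intro power_mono) auto
  finally have "int (4 * (a * b)) \<le> int (n\<^sup>2)" by simp
  then show ?thesis by (simp only: of_nat_le_iff)
qed

lemma card_fixed_plus_moved: "finite W \<Longrightarrow> card {z\<in>W. f z = z} + card {z\<in>W. f z \<noteq> z} = card W"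
proof -
  assume "finite W"
  then have "card ({z\<in>W. f z = z} \<union> {z\<in>W. f z \<noteq> z}) = card {z\<in>W. f z = z} + card {z\<in>W. f z \<noteq> z}"
    by (intro card_Un_disjoint) auto
  moreover have "{z\<in>W. f z = z} \<union> {z\<in>W. f z \<noteq> z} = W" by auto
  ultimately show ?thesis by simp
qed

lemma ls_cells_block:
  assumes "S \<in> latin_squares n" "b \<in> ls_cells S"
  shows "b \<subseteq> ls_points n \<and> card b = 3"
proof -
  obtain i j k where b: "b = {(0, i), (1, j), (2, k)}" "(i, j, k) \<in> S" using assms(2) by (rule ls_cellsE)
  have "(i, j, k) \<in> {0..<n} \<times> {0..<n} \<times> {0..<n}" using subsetD[OF latin_square_subset[OF assms(1)] b(2)] .
  then show ?thesis unfolding b(1) ls_points_def by simp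
qed

lemma ls_cells_meets_parts:
  assumes "S \<in> latin_squares n" "b \<in> ls_cells S" "p < 3"
  shows "\<exists>x\<in>b. x \<in> ls_part n p"
proof -
  obtain i j k where b: "b = {(0, i), (1, j), (2, k)}" "(i, j, k) \<in> S" using assms(2) by (rule ls_cellsE)
  have "(i, j, k) \<in> {0..<n} \<times> {0..<n} \<times> {0..<n}" using subsetD[OF latin_square_subset[OF assms(1)] b(2)] .
  then show ?thesis unfolding b(1) ls_part_def using less_3_cases[OF assms(3)] by auto
qed

lemma one_le_card_pairs:
  assumes "finite D" "(x, y) \<in> D" "x \<in> b" "y \<in> b"
  shows "1 \<le> card {(x, y)\<in>D. x \<in> b \<and> y \<in> b}"
proof -
  have "finite {(x, y)\<in>D. x \<in> b \<and> y \<in> b}" by (rule finite_subset[OF _ assms(1)]) auto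
  moreover have "{(x, y)\<in>D. x \<in> b \<and> y \<in> b} \<noteq> {}" using assms by blast
  ultimately have "0 < card {(x, y)\<in>D. x \<in> b \<and> y \<in> b}" unfolding card_gt_0_iff by (rule conjI[rotated])
  then show ?thesis by simp
qed

text \<open>Let x be moved and lie in part p. Joining x to the fixed points of part q gives distinct
  moved points of part r, so the numbers of fixed points in q and r add up to at most n. A pointwise
  fixed cell is determined by its points in q and r, so there are at most n^2/4 of them.
  Automorphisms that permute the parts are covered by the same count.\<close>

lemma ls_cells_automorphism_count:
  assumes S: "S \<in> latin_squares n" and inv: "(\<lambda>c. f ` c) ` ls_cells S = ls_cells S"
    and x: "x \<in> ls_points n" "f x \<noteq> x"
  shows "real (card (ls_cells S)) + real (card (fixed_blocks f (ls_cells S))) \<le> 5/4 * (real n)\<^sup>2"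
proof -
  let ?B = "ls_cells S"
  have lin: "linear_family ?B" by (rule ls_cells_linear[OF S])
  have finP: "finite (ls_points n)" by (simp add: ls_points_def)
  have finB: "finite ?B" by (rule finite_subset[of _ "Pow (ls_points n)"]) (use ls_cells_block[OF S] finP in auto)
  have fin_part: "finite (ls_part n p)" "card (ls_part n p) = n" for p by (simp_all add: ls_part_def)
  have "1 * card ?B \<le> card (ls_part n 0 \<times> ls_part n 1)"
  proof (rule card_pairs_in_linear_family[OF _ _ finB lin])
    fix b assume b: "b \<in> ?B"
    obtain u w where "u \<in> b" "u \<in> ls_part n 0" "w \<in> b" "w \<in> ls_part n 1"
      using ls_cells_meets_parts[OF S b, of 0] ls_cells_meets_parts[OF S b, of 1] by auto
    then show "1 \<le> card {(x, y)\<in>ls_part n 0 \<times> ls_part n 1. x \<in> b \<and> y \<in> b}"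
      by (intro one_le_card_pairs[of _ u w]) (simp_all add: fin_part)
  qed (auto simp: fin_part ls_part_def)
  then have cB: "card ?B \<le> n\<^sup>2" by (simp add: card_cartesian_product fin_part power2_eq_square)
  obtain p a where xp: "x = (p, a)" "p < 3" "a < n" using x(1) by (auto simp: ls_points_def)
  obtain q r :: nat where pqr: "(p, q, r) \<in> {(0, 1, 2), (1, 2, 0), (2, 0, 1)}" using less_3_cases[OF xp(2)] by blast
  then have ne: "p \<noteq> q" "q \<noteq> r" "p \<noteq> r" "q < 3" "r < 3" by auto
  let ?Y = "{y\<in>ls_part n q. f y = y}" and ?Z = "{z\<in>ls_part n r. f z = z}"
  have "card ?Y \<le> card {z\<in>ls_part n r. f z \<noteq> z}"
  proof (rule card_fixed_points_le[OF lin inv x(2)])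
    fix y assume "y \<in> ?Y"
    then obtain c where c: "y = (q, c)" "c < n" by (auto simp: ls_part_def)
    obtain k where k: "k < n" "{(p, a), (q, c), (r, k)} \<in> ?B" using ls_cells_cover[OF S xp(3) c(2) pqr] by blast
    show "\<exists>z\<in>ls_part n r. z \<noteq> x \<and> z \<noteq> y \<and> {x, y, z} \<in> ?B"
      by (rule bexI[of _ "(r, k)"]) (use k xp c ne in \<open>simp_all add: ls_part_def\<close>)
  qed (auto simp: fin_part)
  then have YZ: "card ?Y + card ?Z \<le> n" using card_fixed_plus_moved[OF fin_part(1)[of r], of f] fin_part(2)[of r] by linarith
  have "1 * card (fixed_blocks f ?B) \<le> card (?Y \<times> ?Z)"
  proof (rule card_pairs_in_linear_family)
    show "linear_family (fixed_blocks f ?B)"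
      by (rule linear_family_subset[OF lin]) (auto simp: fixed_blocks_def)
    show "finite (fixed_blocks f ?B)" by (rule finite_subset[OF _ finB]) (auto simp: fixed_blocks_def)
    show fYZ: "finite (?Y \<times> ?Z)" by (simp add: fin_part)
    show "u \<noteq> w" if "(u, w) \<in> ?Y \<times> ?Z" for u w using that ne by (auto simp: ls_part_def)
    fix b assume "b \<in> fixed_blocks f ?B"
    then have b: "b \<in> ?B" "\<forall>x\<in>b. f x = x" by (auto simp: fixed_blocks_def)
    obtain u w where "u \<in> b" "u \<in> ls_part n q" "w \<in> b" "w \<in> ls_part n r"
      using ls_cells_meets_parts[OF S b(1) ne(4)] ls_cells_meets_parts[OF S b(1) ne(5)] by blast
    then show "1 \<le> card {(x, y)\<in>?Y \<times> ?Z. x \<in> b \<and> y \<in> b}"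
      using b(2) by (intro one_le_card_pairs[OF fYZ, of u w]) simp_all
  qed
  then have "card (fixed_blocks f ?B) \<le> card ?Y * card ?Z" by (simp add: card_cartesian_product)
  then have "4 * card (fixed_blocks f ?B) \<le> n\<^sup>2" using mult_le_quarter_square[OF YZ] by linarith
  then have "4 * card ?B + 4 * card (fixed_blocks f ?B) \<le> 5 * n\<^sup>2" using cB by linarith
  then have "real (4 * card ?B + 4 * card (fixed_blocks f ?B)) \<le> real (5 * n\<^sup>2)" by (rule of_nat_mono)
  then show ?thesis by simp
qed

lemma card_latin_squares_nontriv_aut_le:
  assumes "n \<ge> 1"
  shows "real (card (latin_squares_nontriv_aut n)) \<le> aut_bound (5/4) n"
proof -
  let ?A = "latin_squares_nontriv_aut n"
  have "card (ls_cells ` ?A) = card ?A" by (rule card_image) (rule inj_on_subset[OF inj_ls_cells], simp)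
  moreover have "real (card (ls_cells ` ?A)) \<le> aut_bound (5/4) n"
  proof (rule card_families_with_automorphism_le[where V = "ls_points n"])
    show "finite (ls_points n)" "card (ls_points n) \<le> 3 * n" by (simp_all add: ls_points_def)
    show "n \<ge> 1" by fact
    fix B assume "B \<in> ls_cells ` ?A"
    then obtain S where B: "B = ls_cells S" and "S \<in> ?A" by blast
    then obtain f x where S: "S \<in> latin_squares n" and f: "ls_automorphism n S f" and x: "x \<in> ls_points n" "f x \<noteq> x"
      unfolding latin_squares_nontriv_aut_def by blast
    show "linear_family B" unfolding B by (rule ls_cells_linear[OF S])
    show "b \<subseteq> ls_points n \<and> card b = 3" if "b \<in> B" for b
      using ls_cells_block[OF S] that unfolding B by blast
    have inv: "(\<lambda>c. f ` c) ` ls_cells S = ls_cells S" using f by (simp add: ls_automorphism_def)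
    have "f ` ls_points n \<subseteq> ls_points n" using f by (simp add: ls_automorphism_def bij_betw_def)
    then show "\<exists>f. f ` ls_points n \<subseteq> ls_points n \<and> (\<lambda>b. f ` b) ` B = B \<and>
        real (card B) + real (card (fixed_blocks f B)) \<le> 5/4 * (real n)\<^sup>2"
      unfolding B using inv ls_cells_automorphism_count[OF S inv x] by blast
  qed
  ultimately show ?thesis by simp
qed

subsection \<open>Steiner triple systems with a nontrivial automorphism\<close>

lemma steiner_linear:
  assumes B: "B \<in> steiner_triple_systems n"
  shows "linear_family B"
  unfolding linear_family_def
proof (intro ballI allI impI)
  fix b b' x y assume "b \<in> B" "b' \<in> B" "x \<noteq> y \<and> {x, y} \<subseteq> b \<and> {x, y} \<subseteq> b'"
  then show "b = b'" by (intro steiner_block_unique[OF B, of b b' x y]) simp_all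
qed

lemma card_off_diagonal_3:
  assumes "card b = 3"
  shows "card {(x, y). x \<in> b \<and> y \<in> b \<and> x \<noteq> y} = 6"
proof -
  have fin: "finite b" using assms by (metis card.infinite zero_neq_numeral)
  have eq: "{(x, y). x \<in> b \<and> y \<in> b \<and> x \<noteq> y} = b \<times> b - (\<lambda>x. (x, x)) ` b" by auto
  have "card ((\<lambda>x. (x, x)) ` b) = 3" using assms by (simp add: card_image inj_on_def)
  then show ?thesis unfolding eq using fin assms
    by (subst card_Diff_subset) (auto simp: card_cartesian_product)
qed

lemma card_linear_triples_le:
  assumes lin: "linear_family B" and F: "finite F" and b: "\<And>b. b \<in> B \<Longrightarrow> b \<subseteq> F \<and> card b = 3"
  shows "6 * card B \<le> (card F)\<^sup>2"
proof -
  have finB: "finite B" by (rule finite_subset[of _ "Pow F"]) (use b F in auto)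
  let ?D = "{(x, y). x \<in> F \<and> y \<in> F \<and> x \<noteq> y}"
  have sub: "?D \<subseteq> F \<times> F" by auto
  then have finD: "finite ?D" by (rule finite_subset) (use F in simp)
  have "6 * card B \<le> card ?D"
  proof (rule card_pairs_in_linear_family[OF finD _ finB lin])
    fix c assume c: "c \<in> B"
    have "{(x, y)\<in>?D. x \<in> c \<and> y \<in> c} = {(x, y). x \<in> c \<and> y \<in> c \<and> x \<noteq> y}" using b[OF c] by auto
    then show "6 \<le> card {(x, y)\<in>?D. x \<in> c \<and> y \<in> c}" using card_off_diagonal_3[of c] b[OF c] by simp
  qed auto
  also have "\<dots> \<le> card (F \<times> F)" by (rule card_mono[OF _ sub]) (use F in simp)
  finally show ?thesis by (simp add: card_cartesian_product power2_eq_square)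
qed

text \<open>Joining a moved point to the fixed points gives distinct moved points, so at most n/2
  points are fixed. The triples inside them number at most (n/2)^2 / 6, and 1/6 + 1/24 =
  5/24.\<close>

lemma steiner_automorphism_count:
  assumes B: "B \<in> steiner_triple_systems n" and inv: "(\<lambda>b. f ` b) ` B = B" and x: "x < n" "f x \<noteq> x"
  shows "real (card B) + real (card (fixed_blocks f B)) \<le> 5/24 * (real n)\<^sup>2"
proof -
  let ?F = "{y\<in>{0..<n}. f y = y}"
  have lin: "linear_family B" by (rule steiner_linear[OF B])
  have "card ?F \<le> card {z\<in>{0..<n}. f z \<noteq> z}"
  proof (rule card_fixed_points_le[OF lin inv x(2)])
    fix y assume y: "y \<in> ?F"
    then have yx: "y < n" "x \<noteq> y" using x by auto
    obtain b where b: "b \<in> B" "{x, y} \<subseteq> b" using steiner_block_ex1[OF B x(1) yx] by blast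
    have b3: "card b = 3" "b \<subseteq> {0..<n}" using steiner_blockD[OF B b(1)] by auto
    have finb: "finite b" using b3(2) by (rule finite_subset) simp
    have "card (b - {x, y}) = 1" using b b3 finb yx by (subst card_Diff_subset) auto
    then obtain z where z: "b - {x, y} = {z}" by (auto simp: card_1_singleton_iff)
    have bz: "b = {x, y, z}" using b(2) z by blast
    show "\<exists>z\<in>{0..<n}. z \<noteq> x \<and> z \<noteq> y \<and> {x, y, z} \<in> B"
      by (rule bexI[of _ z]) (use z b bz b3 in auto)
  qed auto
  then have "2 * card ?F \<le> n" using card_fixed_plus_moved[of "{0..<n}" f] by simp
  then have "(2 * card ?F)\<^sup>2 \<le> n\<^sup>2" by (rule power_mono) simp
  then have F: "4 * (card ?F)\<^sup>2 \<le> n\<^sup>2" by (simp add: power_mult_distrib)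
  have "6 * card (fixed_blocks f B) \<le> (card ?F)\<^sup>2"
  proof (rule card_linear_triples_le)
    show "linear_family (fixed_blocks f B)"
      by (rule linear_family_subset[OF lin]) (auto simp: fixed_blocks_def)
    fix b assume "b \<in> fixed_blocks f B"
    then have b: "b \<in> B" "\<forall>x\<in>b. f x = x" by (auto simp: fixed_blocks_def)
    then show "b \<subseteq> ?F \<and> card b = 3" using steiner_blockD[OF B b(1)] by auto
  qed simp
  moreover have "6 * card B \<le> (card {0..<n})\<^sup>2"
    by (rule card_linear_triples_le[OF lin]) (use steiner_blockD[OF B] in auto)
  ultimately have "24 * card B + 24 * card (fixed_blocks f B) \<le> 5 * n\<^sup>2" using F by simp
  then have "real (24 * card B + 24 * card (fixed_blocks f B)) \<le> real (5 * n\<^sup>2)" by (rule of_nat_mono)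
  then show ?thesis by simp
qed

lemma card_sts_nontriv_aut_le:
  assumes "n \<ge> 1"
  shows "real (card (sts_nontriv_aut n)) \<le> aut_bound (5/24) n"
proof (rule card_families_with_automorphism_le[where V = "{0..<n}"])
  show "finite {0..<n}" "card {0..<n} \<le> 3 * n" "n \<ge> 1" using assms by simp_all
  fix B assume "B \<in> sts_nontriv_aut n"
  then obtain f x where B: "B \<in> steiner_triple_systems n" and f: "sts_automorphism n B f" and x: "x \<in> {0..<n}" "f x \<noteq> x"
    unfolding sts_nontriv_aut_def by blast
  show "linear_family B" by (rule steiner_linear[OF B])
  show "b \<subseteq> {0..<n} \<and> card b = 3" if "b \<in> B" for b using steiner_blockD[OF B that] by simp
  have inv: "(\<lambda>b. f ` b) ` B = B" using f by (simp add: sts_automorphism_def)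
  have "f ` {0..<n} \<subseteq> {0..<n}" using f by (simp add: sts_automorphism_def bij_betw_def)
  moreover have "real (card B) + real (card (fixed_blocks f B)) \<le> 5/24 * (real n)\<^sup>2"
    using steiner_automorphism_count[OF B inv] x by simp
  ultimately show "\<exists>f. f ` {0..<n} \<subseteq> {0..<n} \<and> (\<lambda>b. f ` b) ` B = B \<and>
      real (card B) + real (card (fixed_blocks f B)) \<le> 5/24 * (real n)\<^sup>2" using inv by blast
qed

subsection \<open>Edge-parallelisms\<close>

lemma parallelismD:
  assumes P: "P \<in> edge_parallelisms n"
  shows "\<And>M e. M \<in> P \<Longrightarrow> e \<in> M \<Longrightarrow> e \<subseteq> {0..<n} \<and> card e = 2"
    "\<And>M x. M \<in> P \<Longrightarrow> x < n \<Longrightarrow> \<exists>!e. e \<in> M \<and> x \<in> e"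
    "\<And>M. M \<in> P \<Longrightarrow> M \<noteq> {}"
    "\<And>e. e \<subseteq> {0..<n} \<Longrightarrow> card e = 2 \<Longrightarrow> \<exists>!M. M \<in> P \<and> e \<in> M"
  using P by (simp_all add: edge_parallelisms_def perfect_matching_def)

lemma parallelism_unique:
  assumes P: "P \<in> edge_parallelisms n"
  shows "\<And>M e e' x. M \<in> P \<Longrightarrow> e \<in> M \<Longrightarrow> e' \<in> M \<Longrightarrow> x \<in> e \<Longrightarrow> x \<in> e' \<Longrightarrow> e = e'"
    "\<And>M M' e. M \<in> P \<Longrightarrow> M' \<in> P \<Longrightarrow> e \<in> M \<Longrightarrow> e \<in> M' \<Longrightarrow> M = M'"
proof -
  fix M e e' x assume a: "M \<in> P" "e \<in> M" "e' \<in> M" "x \<in> e" "x \<in> e'"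
  have "x < n" using parallelismD(1)[OF P a(1,2)] a(4) by auto
  from parallelismD(2)[OF P a(1) this] show "e = e'" by (rule ex1E) (metis a)
next
  fix M M' e assume a: "M \<in> P" "M' \<in> P" "e \<in> M" "e \<in> M'"
  have "e \<subseteq> {0..<n}" "card e = 2" using parallelismD(1)[OF P a(1,3)] by auto
  from parallelismD(4)[OF P this] show "M = M'" by (rule ex1E) (metis a)
qed

lemma finite_edge_parallelisms: "finite (edge_parallelisms n)"
proof (rule finite_subset)
  show "edge_parallelisms n \<subseteq> Pow (Pow (Pow {0..<n}))"
  proof (intro subsetI PowI)
    fix P M e x assume "P \<in> edge_parallelisms n" "M \<in> P" "e \<in> M" "x \<in> e"
    then show "x \<in> {0..<n}" using parallelismD(1) by blast
  qed
qed simp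

lemma finite_parallelism:
  assumes P: "P \<in> edge_parallelisms n"
  shows "finite P"
proof (rule finite_subset)
  show "P \<subseteq> Pow (Pow {0..<n})"
  proof (intro subsetI PowI)
    fix M e x assume "M \<in> P" "e \<in> M" "x \<in> e"
    then show "x \<in> {0..<n}" using parallelismD(1)[OF P] by blast
  qed
qed simp

lemma card_parallelism_le:
  assumes P: "P \<in> edge_parallelisms n" and n: "n \<ge> 1"
  shows "card P \<le> n"
proof -
  have "\<forall>M\<in>P. \<exists>e. e \<in> M \<and> 0 \<in> e" using parallelismD(2)[OF P, of _ 0] n by fastforce
  then obtain s where s: "\<And>M. M \<in> P \<Longrightarrow> s M \<in> M \<and> 0 \<in> s M" by metis
  \<comment> \<open>A class is represented by its edge at the point 0. Admitting y = 0 costs one,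
    and the bound n is enough for labelling the classes by n further points.\<close>
  have "card P \<le> card ((\<lambda>y. {0, y}) ` {0..<n})"
  proof (rule card_inj_on_le)
    show "inj_on s P"
      using s parallelism_unique(2)[OF P] by (intro inj_onI) metis
    show "s ` P \<subseteq> (\<lambda>y. {0, y}) ` {0..<n}"
    proof (rule image_subsetI)
      fix M assume M: "M \<in> P"
      have e: "s M \<subseteq> {0..<n}" "card (s M) = 2" "0 \<in> s M"
        using parallelismD(1)[OF P M, of "s M"] s[OF M] by auto
      from e(2) obtain p q where pq: "s M = {p, q}" unfolding card_2_iff by blast
      then have "s M = {0, p} \<or> s M = {0, q}" using e(3) by auto
      then show "s M \<in> (\<lambda>y. {0, y}) ` {0..<n}" using pq e(1) by auto
    qed
  qed simp
  also have "\<dots> \<le> n" using card_image_le[of "{0..<n}" "\<lambda>y. {0, y}"] by simp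
  finally show ?thesis .
qed

text \<open>The parallel classes become additional points, so that a parallelism is encoded by the triples
  consisting of an edge and the class containing it.\<close>

definition class_triples :: "(nat set set \<Rightarrow> nat) \<Rightarrow> nat set set set \<Rightarrow> nat set set" where
  "class_triples l P = {insert (l M) e | M e. M \<in> P \<and> e \<in> M}"

lemma class_triplesI: "M \<in> P \<Longrightarrow> e \<in> M \<Longrightarrow> insert (l M) e \<in> class_triples l P"
  unfolding class_triples_def by blast

lemma class_triplesE:
  assumes "b \<in> class_triples l P"
  obtains M e where "M \<in> P" "e \<in> M" "b = insert (l M) e"
  using assms unfolding class_triples_def by blast

lemma insert_colour_eq:
  fixes n :: nat
  assumes "insert c e = insert c' e'" "e \<subseteq> {0..<n}" "e' \<subseteq> {0..<n}" "n \<le> c" "n \<le> c'"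
  shows "c = c' \<and> e = e'"
proof -
  have ne: "c \<notin> e'" "c' \<notin> e" "c \<notin> e" "c' \<notin> e'" using assms(2-5) by auto
  have "c \<in> insert c' e'" using assms(1) by blast
  then have "c = c'" using ne by blast
  moreover have "e = e'" using assms(1) ne \<open>c = c'\<close> by (metis insert_ident)
  ultimately show ?thesis by blast
qed

lemma class_triples_recover:
  assumes P: "P \<in> edge_parallelisms n" and l: "inj_on l P" "l ` P \<subseteq> {n..<2 * n}" and M: "M \<in> P"
  shows "{e. e \<subseteq> {0..<n} \<and> insert (l M) e \<in> class_triples l P} = M"
proof (intro set_eqI iffI)
  fix e assume "e \<in> {e. e \<subseteq> {0..<n} \<and> insert (l M) e \<in> class_triples l P}"
  then have e: "e \<subseteq> {0..<n}" "insert (l M) e \<in> class_triples l P" by auto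
  from e(2) obtain M' e' where M': "M' \<in> P" "e' \<in> M'" "insert (l M) e = insert (l M') e'" by (rule class_triplesE)
  have "l M = l M' \<and> e = e'"
    by (rule insert_colour_eq[OF M'(3) e(1)]) (use parallelismD(1)[OF P M'(1,2)] l(2) M M'(1) in auto)
  then show "e \<in> M" using inj_onD[OF l(1) _ M M'(1)] M'(2) by blast
next
  fix e assume "e \<in> M"
  then show "e \<in> {e. e \<subseteq> {0..<n} \<and> insert (l M) e \<in> class_triples l P}"
    using class_triplesI[OF M] parallelismD(1)[OF P M] by blast
qed

text \<open>Labellings are chosen separately for each parallelism, so two of them may be encoded
  with different l; the set of triples still determines the parallelism, since a class consists of
  the edges completed by one label.\<close>

lemma class_triples_determine_subset:
  assumes P: "P \<in> edge_parallelisms n" "inj_on l P" "l ` P \<subseteq> {n..<2 * n}"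
    and P': "P' \<in> edge_parallelisms n" "inj_on l' P'" "l' ` P' \<subseteq> {n..<2 * n}"
    and eq: "class_triples l P = class_triples l' P'"
  shows "P \<subseteq> P'"
proof
  fix M assume M: "M \<in> P"
  obtain e where e: "e \<in> M" using parallelismD(3)[OF P(1) M] by blast
  have "insert (l M) e \<in> class_triples l' P'" using class_triplesI[OF M e, of l] eq by simp
  then obtain M' e' where M': "M' \<in> P'" "e' \<in> M'" "insert (l M) e = insert (l' M') e'" by (rule class_triplesE)
  have "l M = l' M' \<and> e = e'"
    by (rule insert_colour_eq[OF M'(3)])
      (use parallelismD(1)[OF P(1) M e] parallelismD(1)[OF P'(1) M'(1,2)] P(3) P'(3) M M'(1) in auto)
  then have "M = M'"
    using class_triples_recover[OF P M] class_triples_recover[OF P' M'(1)] eq by simp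
  then show "M \<in> P'" using M'(1) by simp
qed

lemma class_triples_block:
  assumes P: "P \<in> edge_parallelisms n" and l: "l ` P \<subseteq> {n..<2 * n}" and b: "b \<in> class_triples l P"
  shows "b \<subseteq> {0..<2 * n} \<and> card b = 3"
proof -
  obtain M e where M: "M \<in> P" "e \<in> M" "b = insert (l M) e" using b by (rule class_triplesE)
  have e: "e \<subseteq> {0..<n}" "card e = 2" using parallelismD(1)[OF P M(1,2)] by auto
  have lM: "n \<le> l M" "l M < 2 * n" using l M(1) by auto
  have "finite e" using e(1) by (rule finite_subset) simp
  moreover have "l M \<notin> e" using e(1) lM by auto
  ultimately have "card b = 3" using e(2) M(3) by simp
  moreover have "b \<subseteq> {0..<2 * n}" using e(1) lM M(3) by auto
  ultimately show ?thesis by blast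
qed

text \<open>Two points below n form the edge, and an edge lies in one class; a point and a label
  determine the edge, because a class is a matching; a triple contains only one label.\<close>

lemma class_triples_linear:
  assumes P: "P \<in> edge_parallelisms n" and l: "inj_on l P" "l ` P \<subseteq> {n..<2 * n}"
  shows "linear_family (class_triples l P)"
  unfolding linear_family_def
proof (intro ballI allI impI)
  fix b b' x y assume b: "b \<in> class_triples l P" and b': "b' \<in> class_triples l P"
    and xy: "x \<noteq> y \<and> {x, y} \<subseteq> b \<and> {x, y} \<subseteq> b'"
  obtain M e where M: "M \<in> P" "e \<in> M" "b = insert (l M) e" using b by (rule class_triplesE)
  obtain M' e' where M': "M' \<in> P" "e' \<in> M'" "b' = insert (l M') e'" using b' by (rule class_triplesE)
  have e: "e \<subseteq> {0..<n}" "card e = 2" and e': "e' \<subseteq> {0..<n}" "card e' = 2"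
    using parallelismD(1)[OF P M(1,2)] parallelismD(1)[OF P M'(1,2)] by auto
  have lM: "n \<le> l M" "n \<le> l M'" using l(2) M(1) M'(1) by auto
  have low: "z \<in> e \<and> z \<in> e'" if "z \<in> b" "z \<in> b'" "z < n" for z
    using that lM unfolding M(3) M'(3) by auto
  have high: "z = l M \<and> z = l M'" if "z \<in> b" "z \<in> b'" "\<not> z < n" for z
    using that e(1) e'(1) unfolding M(3) M'(3) by auto
  have x: "x \<in> b" "x \<in> b'" and y: "y \<in> b" "y \<in> b'" and ne: "x \<noteq> y" using xy by blast+
  have same: "b = b'" if "z < n" "z \<in> b" "z \<in> b'" "\<not> w < n" "w \<in> b" "w \<in> b'" for z w
  proof -
    have "l M = l M'" using high[of w] that by simp
    then have "M = M'" using inj_onD[OF l(1) _ M(1) M'(1)] by blast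
    moreover have "z \<in> e" "z \<in> e'" using low[of z] that by simp_all
    ultimately have "e = e'" using parallelism_unique(1)[OF P M(1,2)] M'(2) by blast
    then show ?thesis using M(3) M'(3) \<open>M = M'\<close> by simp
  qed
  consider "x < n" "y < n" | "x < n" "\<not> y < n" | "\<not> x < n" "y < n" | "\<not> x < n" "\<not> y < n" by blast
  then show "b = b'"
  proof cases
    case 1
    have sub: "{x, y} \<subseteq> e" "{x, y} \<subseteq> e'" using low[OF x] low[OF y] 1 by auto
    have "finite e" "finite e'" using e(1) e'(1) finite_subset by blast+
    then have "{x, y} = e" "{x, y} = e'"
      using card_subset_eq[OF _ sub(1)] card_subset_eq[OF _ sub(2)] e(2) e'(2) ne by simp_all
    then have ee: "e = e'" by simp
    then have "M = M'" using parallelism_unique(2)[OF P M(1) M'(1) M(2)] M'(2) by simp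
    then show ?thesis using M(3) M'(3) ee by simp
  next
    case 2 show ?thesis by (rule same[OF 2(1) x 2(2) y])
  next
    case 3 show ?thesis by (rule same[OF 3(2) y 3(1) x])
  next
    case 4
    then have "x = y" using high[OF x] high[OF y] by simp
    then show ?thesis using ne by simp
  qed
qed

lemma two_le_card_pairs:
  assumes "finite D" "(x, z) \<in> D" "(y, z) \<in> D" "x \<noteq> y" "x \<in> b" "y \<in> b" "z \<in> b"
  shows "2 \<le> card {(x, y)\<in>D. x \<in> b \<and> y \<in> b}"
proof -
  have "finite {(x, y)\<in>D. x \<in> b \<and> y \<in> b}" by (rule finite_subset[OF _ assms(1)]) auto
  moreover have "{(x, z), (y, z)} \<subseteq> {(x, y)\<in>D. x \<in> b \<and> y \<in> b}" using assms by simp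
  ultimately have "card {(x, z), (y, z)} \<le> card {(x, y)\<in>D. x \<in> b \<and> y \<in> b}" by (rule card_mono)
  then show ?thesis using assms(4) by simp
qed

text \<open>Points and labels play the roles of two parts of a Latin square, and each triple
  contains two pairs of a point and a label. Hence there are at most n^2/2 triples and at most n^2/8
  pointwise fixed ones, together 5/8 * n^2.\<close>

lemma parallelism_automorphism_count:
  assumes P: "P \<in> edge_parallelisms n" and l: "inj_on l P" "l ` P \<subseteq> {n..<2 * n}"
    and inv: "(\<lambda>b. f ` b) ` class_triples l P = class_triples l P" and x: "x < n" "f x \<noteq> x"
  shows "real (card (class_triples l P)) + real (card (fixed_blocks f (class_triples l P))) \<le> 5/8 * (real n)\<^sup>2"
proof -
  let ?B = "class_triples l P" and ?C = "l ` P"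
  have lin: "linear_family ?B" by (rule class_triples_linear[OF P l])
  have finB: "finite ?B"
    by (rule finite_subset[of _ "Pow {0..<2 * n}"]) (use class_triples_block[OF P l(2)] in auto)
  have finC: "finite ?C" using finite_parallelism[OF P] by simp
  have cC: "card ?C \<le> n" using card_mono[OF _ l(2)] by simp
  have split: "\<exists>p q c. p \<in> b \<and> q \<in> b \<and> c \<in> b \<and> p \<noteq> q \<and> p < n \<and> q < n \<and> c \<in> ?C" if b: "b \<in> ?B" for b
  proof -
    obtain M e where M: "M \<in> P" "e \<in> M" "b = insert (l M) e" using b by (rule class_triplesE)
    have e: "e \<subseteq> {0..<n}" "card e = 2" using parallelismD(1)[OF P M(1,2)] by auto
    from e(2) obtain p q where pq: "e = {p, q}" "p \<noteq> q" unfolding card_2_iff by blast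
    have "p \<in> b \<and> q \<in> b \<and> l M \<in> b \<and> p \<noteq> q \<and> p < n \<and> q < n \<and> l M \<in> ?C"
      using M(1) e(1) pq unfolding M(3) by simp
    then show ?thesis by (intro exI)
  qed
  have "2 * card ?B \<le> card ({0..<n} \<times> ?C)"
  proof (rule card_pairs_in_linear_family[OF _ _ finB lin])
    show fin: "finite ({0..<n} \<times> ?C)" using finC by simp
    show "u \<noteq> w" if "(u, w) \<in> {0..<n} \<times> ?C" for u w using that l(2) by force
    fix b assume "b \<in> ?B"
    from split[OF this] obtain p q c where
      pqc: "p \<in> b" "q \<in> b" "c \<in> b" "p \<noteq> q" "p < n" "q < n" "c \<in> ?C" by blast
    show "2 \<le> card {(x, y)\<in>{0..<n} \<times> ?C. x \<in> b \<and> y \<in> b}"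
      by (rule two_le_card_pairs[OF fin, of p c q]) (use pqc in simp_all)
  qed
  also have "\<dots> \<le> n * n" using cC by (simp add: card_cartesian_product)
  finally have cB: "2 * card ?B \<le> n\<^sup>2" by (simp add: power2_eq_square)
  let ?Y = "{y\<in>{0..<n}. f y = y}" and ?Z = "{z\<in>?C. f z = z}"
  have "card ?Y \<le> card {z\<in>?C. f z \<noteq> z}"
  proof (rule card_fixed_points_le[OF lin inv x(2)])
    fix y assume "y \<in> ?Y"
    then have y: "y < n" "x \<noteq> y" using x by auto
    have "{x, y} \<subseteq> {0..<n}" "card {x, y} = 2" using x y by simp_all
    from parallelismD(4)[OF P this] obtain M where M: "M \<in> P" "{x, y} \<in> M" by blast
    have "insert (l M) {x, y} \<in> ?B" by (rule class_triplesI[OF M])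
    moreover have "insert (l M) {x, y} = {x, y, l M}" by blast
    moreover have "n \<le> l M" using l(2) M(1) by auto
    ultimately show "\<exists>z\<in>?C. z \<noteq> x \<and> z \<noteq> y \<and> {x, y, z} \<in> ?B"
      using M(1) x y by (intro bexI[of _ "l M"]) auto
  qed (use finC in auto)
  then have YZ: "card ?Y + card ?Z \<le> n" using card_fixed_plus_moved[OF finC, of f] cC by linarith
  have "2 * card (fixed_blocks f ?B) \<le> card (?Y \<times> ?Z)"
  proof (rule card_pairs_in_linear_family)
    show "linear_family (fixed_blocks f ?B)"
      by (rule linear_family_subset[OF lin]) (auto simp: fixed_blocks_def)
    show "finite (fixed_blocks f ?B)" by (rule finite_subset[OF _ finB]) (auto simp: fixed_blocks_def)
    show fYZ: "finite (?Y \<times> ?Z)" using finC by simp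
    show "u \<noteq> w" if "(u, w) \<in> ?Y \<times> ?Z" for u w using that l(2) by force
    fix b assume "b \<in> fixed_blocks f ?B"
    then have b: "b \<in> ?B" "\<forall>x\<in>b. f x = x" by (auto simp: fixed_blocks_def)
    from split[OF b(1)] obtain p q c where
      pqc: "p \<in> b" "q \<in> b" "c \<in> b" "p \<noteq> q" "p < n" "q < n" "c \<in> ?C" by blast
    show "2 \<le> card {(x, y)\<in>?Y \<times> ?Z. x \<in> b \<and> y \<in> b}"
      by (rule two_le_card_pairs[OF fYZ, of p c q]) (use pqc b(2) in simp_all)
  qed
  then have "2 * card (fixed_blocks f ?B) \<le> card ?Y * card ?Z" by (simp add: card_cartesian_product)
  then have "8 * card (fixed_blocks f ?B) \<le> n\<^sup>2" using mult_le_quarter_square[OF YZ] by linarith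
  then have "8 * card ?B + 8 * card (fixed_blocks f ?B) \<le> 5 * n\<^sup>2" using cB by linarith
  then have "real (8 * card ?B + 8 * card (fixed_blocks f ?B)) \<le> real (5 * n\<^sup>2)" by (rule of_nat_mono)
  then show ?thesis by simp
qed

lemma parallelism_automorphism_extends:
  assumes P: "P \<in> edge_parallelisms n" and l: "inj_on l P" "l ` P \<subseteq> {n..<2 * n}"
    and f: "par_automorphism n P f"
  obtains g where "g ` {0..<2 * n} \<subseteq> {0..<2 * n}" "(\<lambda>b. g ` b) ` class_triples l P = class_triples l P"
    "\<And>x. x < n \<Longrightarrow> g x = f x"
proof -
  let ?B = "class_triples l P"
  have fb: "bij_betw f {0..<n} {0..<n}" and fP: "\<And>M. M \<in> P \<Longrightarrow> (\<lambda>e. f ` e) ` M \<in> P"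
    using f by (simp_all add: par_automorphism_def)
  have finj: "inj_on f {0..<n}" using fb by (rule bij_betw_imp_inj_on)
  define F where "F M = (\<lambda>e. f ` e) ` M" for M
  \<comment> \<open>A label moves as its class does. Labels that belong to no class stay in place,
    so that g maps all 2n points into themselves.\<close>
  define g where "g x = (if x < n then f x else if x \<in> l ` P then l (F (inv_into P l x)) else x)" for x
  have g_low: "g x = f x" if "x < n" for x using that by (simp add: g_def)
  have g_l: "g (l M) = l (F M)" if "M \<in> P" for M
  proof -
    have "\<not> l M < n" using l(2) that by auto
    then show ?thesis using that l(1) by (simp add: g_def)
  qed
  have F_inj: "inj_on F P"
  proof (rule inj_onI)
    fix M M' assume M: "M \<in> P" "M' \<in> P" and eq: "F M = F M'"
    obtain e where e: "e \<in> M" using parallelismD(3)[OF P M(1)] by blast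
    then have "f ` e \<in> F M'" using eq unfolding F_def by blast
    then obtain e' where e': "e' \<in> M'" "f ` e = f ` e'" unfolding F_def by blast
    have "e = e'"
      using inj_on_image_eq_iff[OF finj, of e e'] parallelismD(1)[OF P M(1) e] parallelismD(1)[OF P M(2) e'(1)] e'(2)
      by blast
    then show "M = M'" using parallelism_unique(2)[OF P M e] e'(1) by simp
  qed
  have img: "g ` insert (l M) e = insert (l (F M)) (f ` e)" if "M \<in> P" "e \<in> M" for M e
  proof -
    have "g ` e = f ` e" using parallelismD(1)[OF P that] g_low by (intro image_cong) auto
    then show ?thesis using g_l[OF that(1)] by simp
  qed
  have into: "(\<lambda>b. g ` b) ` ?B \<subseteq> ?B"
  proof (rule image_subsetI)
    fix b assume "b \<in> ?B"
    then obtain M e where M: "M \<in> P" "e \<in> M" "b = insert (l M) e" by (rule class_triplesE)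
    have "f ` e \<in> F M" using M(2) by (simp add: F_def)
    moreover have "F M \<in> P" using fP[OF M(1)] by (simp add: F_def)
    ultimately show "g ` b \<in> ?B" unfolding M(3) img[OF M(1,2)] by (intro class_triplesI)
  qed
  have inj: "inj_on (\<lambda>b. g ` b) ?B"
  proof (rule inj_onI)
    fix b b' assume b: "b \<in> ?B" "b' \<in> ?B" and eq: "g ` b = g ` b'"
    obtain M e where M: "M \<in> P" "e \<in> M" "b = insert (l M) e" using b(1) by (rule class_triplesE)
    obtain M' e' where M': "M' \<in> P" "e' \<in> M'" "b' = insert (l M') e'" using b(2) by (rule class_triplesE)
    have e: "e \<subseteq> {0..<n}" "e' \<subseteq> {0..<n}" using parallelismD(1)[OF P M(1,2)] parallelismD(1)[OF P M'(1,2)] by auto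
    have FP: "F M \<in> P" "F M' \<in> P" using fP[OF M(1)] fP[OF M'(1)] by (simp_all add: F_def)
    have "insert (l (F M)) (f ` e) = insert (l (F M')) (f ` e')"
      using eq unfolding M(3) M'(3) img[OF M(1,2)] img[OF M'(1,2)] .
    then have "l (F M) = l (F M') \<and> f ` e = f ` e'"
      by (rule insert_colour_eq[of _ _ _ _ n])
        (use e bij_betw_imp_surj_on[OF fb] FP l(2) in \<open>auto dest: subsetD\<close>)
    then have "F M = F M'" "f ` e = f ` e'" using inj_onD[OF l(1) _ FP] by blast+
    then have "M = M'" "e = e'"
      using inj_onD[OF F_inj _ M(1) M'(1)] inj_on_image_eq_iff[OF finj e] by blast+
    then show "b = b'" using M(3) M'(3) by simp
  qed
  have finB: "finite ?B"
    by (rule finite_subset[of _ "Pow {0..<2 * n}"]) (use class_triples_block[OF P l(2)] in auto)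
  \<comment> \<open>\<open>par_automorphism\<close> asks only that images of classes be classes; an
    injective self-map of a finite set of triples is onto.\<close>
  have surj: "(\<lambda>b. g ` b) ` ?B = ?B" by (rule endo_inj_surj[OF finB into inj])
  have "g ` {0..<2 * n} \<subseteq> {0..<2 * n}"
  proof (rule image_subsetI)
    fix x assume x: "x \<in> {0..<2 * n}"
    consider "x < n" | "\<not> x < n" "x \<in> l ` P" | "\<not> x < n" "x \<notin> l ` P" by blast
    then show "g x \<in> {0..<2 * n}"
    proof cases
      case 1
      then have "f x \<in> {0..<n}" using bij_betw_apply[OF fb, of x] by simp
      then show ?thesis using g_low[OF 1] by simp
    next
      case 2
      then obtain M where M: "M \<in> P" "x = l M" by blast
      have "F M \<in> P" using fP[OF M(1)] by (simp add: F_def)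
      then have "l (F M) \<in> {n..<2 * n}" using l(2) by blast
      then show ?thesis using g_l[OF M(1)] M(2) by simp
    next
      case 3
      then show ?thesis using x by (simp add: g_def)
    qed
  qed
  then show ?thesis using that surj g_low by blast
qed

lemma card_par_nontriv_aut_le:
  assumes n: "n \<ge> 1"
  shows "real (card (par_nontriv_aut n)) \<le> aut_bound (5/8) n"
proof -
  let ?A = "par_nontriv_aut n"
  have "\<exists>l. inj_on l P \<and> l ` P \<subseteq> {n..<2 * n}" if P: "P \<in> edge_parallelisms n" for P :: "nat set set set"
    using inj_on_iff_card_le[OF finite_parallelism[OF P], of "{n..<2 * n}"] card_parallelism_le[OF P n] by simp
  then obtain l where l: "\<And>P. P \<in> edge_parallelisms n \<Longrightarrow> inj_on (l P) P"
      "\<And>P. P \<in> edge_parallelisms n \<Longrightarrow> l P ` P \<subseteq> {n..<2 * n}" by metis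
  let ?T = "\<lambda>P. class_triples (l P) P"
  have A: "P \<in> edge_parallelisms n" if "P \<in> ?A" for P using that by (simp add: par_nontriv_aut_def)
  have "inj_on ?T ?A"
  proof (rule inj_onI)
    fix P Q assume "P \<in> ?A" "Q \<in> ?A" and eq: "?T P = ?T Q"
    then have PQ: "P \<in> edge_parallelisms n" "Q \<in> edge_parallelisms n" using A by auto
    show "P = Q"
      using class_triples_determine_subset[OF PQ(1) l[OF PQ(1)] PQ(2) l[OF PQ(2)] eq]
        class_triples_determine_subset[OF PQ(2) l[OF PQ(2)] PQ(1) l[OF PQ(1)] eq[symmetric]] by (rule equalityI)
  qed
  then have "card ?A = card (?T ` ?A)" by (rule card_image[symmetric])
  moreover have "real (card (?T ` ?A)) \<le> aut_bound (5/8) n"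
  proof (rule card_families_with_automorphism_le[where V = "{0..<2 * n}"])
    show "finite {0..<2 * n}" "card {0..<2 * n} \<le> 3 * n" "n \<ge> 1" using n by simp_all
    fix B assume "B \<in> ?T ` ?A"
    then obtain P where P': "P \<in> ?A" and B: "B = ?T P" by blast
    then obtain f x where f: "par_automorphism n P f" and x: "x < n" "f x \<noteq> x"
      unfolding par_nontriv_aut_def by auto
    have P: "P \<in> edge_parallelisms n" by (rule A[OF P'])
    show "linear_family B" unfolding B by (rule class_triples_linear[OF P l[OF P]])
    show "b \<subseteq> {0..<2 * n} \<and> card b = 3" if "b \<in> B" for b
      using class_triples_block[OF P l(2)[OF P]] that unfolding B by blast
    obtain g where g: "g ` {0..<2 * n} \<subseteq> {0..<2 * n}" "(\<lambda>b. g ` b) ` ?T P = ?T P" "\<And>x. x < n \<Longrightarrow> g x = f x"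
      using parallelism_automorphism_extends[OF P l[OF P] f] by blast
    have "g x \<noteq> x" using g(3)[OF x(1)] x(2) by simp
    from parallelism_automorphism_count[OF P l[OF P] g(2) x(1) this]
    show "\<exists>f. f ` {0..<2 * n} \<subseteq> {0..<2 * n} \<and> (\<lambda>b. f ` b) ` B = B \<and>
        real (card B) + real (card (fixed_blocks f B)) \<le> 5/8 * (real n)\<^sup>2"
      unfolding B using g(1,2) by blast
  qed
  ultimately show ?thesis by simp
qed

text \<open>The square colours the edges {x, y} below m. Since row x has x on its diagonal, the
  colour x is missing at the point x, and the edge from x to the extra point m takes it.\<close>

lemma card_idempotent_le_parallelisms:
  "card (idempotent_latin m) \<le> card (edge_parallelisms (Suc m))"
proof (rule card_inj_on_le)
  define cls where "cls \<kappa> c = insert {c, m} {{x, y} | x y. x < m \<and> y < m \<and> x \<noteq> y \<and> \<kappa> (x, y) = c}"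
    for \<kappa> :: "nat \<times> nat \<Rightarrow> nat" and c
  let ?g = "\<lambda>\<kappa>. cls \<kappa> ` {..<m}"
  have edge_iff: "{x, y} \<in> cls \<kappa> c \<longleftrightarrow> \<kappa> (x, y) = c"
    if k: "\<kappa> \<in> idempotent_latin m" and xy: "x < m" "y < m" "x \<noteq> y" "c < m" for \<kappa> x y c
  proof
    assume "{x, y} \<in> cls \<kappa> c"
    moreover have "{x, y} \<noteq> {c, m}" using xy by (auto simp: doubleton_eq_iff)
    ultimately obtain x' y' where e: "{x, y} = {x', y'}" "\<kappa> (x', y') = c"
      unfolding cls_def by blast
    then have "x = x' \<and> y = y' \<or> x = y' \<and> y = x'" by (auto simp: doubleton_eq_iff)
    then show "\<kappa> (x, y) = c" using e(2) sym_latinD(4)[OF k xy(1,2)] by auto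
  next
    assume "\<kappa> (x, y) = c"
    then show "{x, y} \<in> cls \<kappa> c" unfolding cls_def using xy by blast
  qed
  have last_iff: "{x, m} \<in> cls \<kappa> c \<longleftrightarrow> x = c" if "x < m" for \<kappa> x c
    using that by (auto simp: cls_def doubleton_eq_iff)
  have cls_edge: "(\<exists>x y. x < m \<and> y < m \<and> x \<noteq> y \<and> e = {x, y}) \<or> e = {c, m}" if "e \<in> cls \<kappa> c" for \<kappa> c e
    using that unfolding cls_def by blast
  have matching: "perfect_matching (Suc m) (cls \<kappa> c)" if k: "\<kappa> \<in> idempotent_latin m" and c: "c < m" for \<kappa> c
    unfolding perfect_matching_def
  proof (intro conjI ballI)
    fix e assume "e \<in> cls \<kappa> c"
    from cls_edge[OF this] show "e \<subseteq> {0..<Suc m}" "card e = 2" using c by auto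
  next
    fix x assume "x \<in> {0..<Suc m}"
    then consider "x < m" | "x = m" by fastforce
    then show "\<exists>!e. e \<in> cls \<kappa> c \<and> x \<in> e"
    proof cases
      case 1
      obtain y where y: "y < m" "\<kappa> (x, y) = c" using sym_latin_surj[OF k 1 c] by blast
      show ?thesis
      proof (cases "x = y")
        case True
        then have xc: "x = c" using sym_latinD(5)[OF k 1] y by simp
        show ?thesis
        proof (rule ex1I[of _ "{x, m}"])
          show "{x, m} \<in> cls \<kappa> c \<and> x \<in> {x, m}" using last_iff[OF 1] xc by simp
          fix e assume e: "e \<in> cls \<kappa> c \<and> x \<in> e"
          from cls_edge[of e \<kappa> c] e consider p q where "p < m" "q < m" "p \<noteq> q" "e = {p, q}" | "e = {c, m}" by blast
          then show "e = {x, m}"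
          proof cases
            case a: 1
            then obtain z where z: "z < m" "z \<noteq> x" "e = {x, z}" using e by auto
            then have "\<kappa> (x, z) = c" using edge_iff[OF k 1 z(1) _ c] e by auto
            then have "z = x" using sym_latinD(3)[OF k 1 z(1) 1] sym_latinD(5)[OF k 1] xc by simp
            then show ?thesis using z by simp
          next
            case 2
            then show ?thesis using xc by simp
          qed
        qed
      next
        case False
        show ?thesis
        proof (rule ex1I[of _ "{x, y}"])
          show "{x, y} \<in> cls \<kappa> c \<and> x \<in> {x, y}" using edge_iff[OF k 1 y(1) False c] y by simp
          fix e assume e: "e \<in> cls \<kappa> c \<and> x \<in> e"
          from cls_edge[of e \<kappa> c] e consider p q where "p < m" "q < m" "p \<noteq> q" "e = {p, q}" | "e = {c, m}" by blast
          then show "e = {x, y}"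
          proof cases
            case a: 1
            then obtain z where z: "z < m" "z \<noteq> x" "e = {x, z}" using e by auto
            then have "\<kappa> (x, z) = c" using edge_iff[OF k 1 z(1) _ c] e by auto
            then have "z = y" using sym_latinD(3)[OF k 1 z(1) y(1)] y(2) by simp
            then show ?thesis using z by simp
          next
            case 2
            then have "x = c" using e 1 by auto
            then have "\<kappa> (x, x) = \<kappa> (x, y)" using sym_latinD(5)[OF k 1] y by simp
            then have "x = y" by (rule sym_latinD(3)[OF k 1 1 y(1)])
            then show ?thesis using False by simp
          qed
        qed
      qed
    next
      case 2
      show ?thesis
      proof (rule ex1I[of _ "{c, m}"])
        show "{c, m} \<in> cls \<kappa> c \<and> x \<in> {c, m}" using 2 by (simp add: cls_def)
        fix e assume "e \<in> cls \<kappa> c \<and> x \<in> e"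
        then show "e = {c, m}" using cls_edge[of e \<kappa> c] 2 by auto
      qed
    qed
  qed
  have in_par: "?g \<kappa> \<in> edge_parallelisms (Suc m)" if k: "\<kappa> \<in> idempotent_latin m" for \<kappa>
    unfolding edge_parallelisms_def
  proof (intro CollectI conjI ballI allI impI)
    fix M assume "M \<in> ?g \<kappa>"
    then obtain c where "c < m" "M = cls \<kappa> c" by auto
    then show "perfect_matching (Suc m) M" "M \<noteq> {}" using matching[OF k] by (simp_all add: cls_def)
  next
    fix e assume "e \<subseteq> {0..<Suc m} \<and> card e = 2"
    then have "e \<subseteq> {0..<Suc m}" "card e = 2" by auto
    from this(2) obtain p q where e: "e = {p, q}" "p \<noteq> q" unfolding card_2_iff by blast
    then have pq: "p < Suc m" "q < Suc m" using \<open>e \<subseteq> {0..<Suc m}\<close> by auto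
    have "(\<exists>x y. x < m \<and> y < m \<and> x \<noteq> y \<and> e = {x, y}) \<or> (\<exists>x. x < m \<and> e = {x, m})"
    proof -
      consider "p < m" "q < m" | "p < m" "q = m" | "p = m" "q < m" using pq e(2) by linarith
      then show ?thesis using e by cases auto
    qed
    then consider x y where "x < m" "y < m" "x \<noteq> y" "e = {x, y}" | x where "x < m" "e = {x, m}" by blast
    then show "\<exists>!M. M \<in> ?g \<kappa> \<and> e \<in> M"
    proof cases
      case 1
      show ?thesis
      proof (rule ex1I[of _ "cls \<kappa> (\<kappa> (x, y))"])
        have lt: "\<kappa> (x, y) < m" by (rule sym_latinD(2)[OF k 1(1,2)])
        then show "cls \<kappa> (\<kappa> (x, y)) \<in> ?g \<kappa> \<and> e \<in> cls \<kappa> (\<kappa> (x, y))"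
          using edge_iff[OF k 1(1-3) lt] 1(4) by simp
        fix M assume "M \<in> ?g \<kappa> \<and> e \<in> M"
        then obtain c where "c < m" "M = cls \<kappa> c" "e \<in> cls \<kappa> c" by auto
        then show "M = cls \<kappa> (\<kappa> (x, y))" using edge_iff[OF k 1(1-3), of c] 1(4) by simp
      qed
    next
      case 2
      show ?thesis
      proof (rule ex1I[of _ "cls \<kappa> x"])
        show "cls \<kappa> x \<in> ?g \<kappa> \<and> e \<in> cls \<kappa> x" using last_iff[OF 2(1)] 2 by simp
        fix M assume "M \<in> ?g \<kappa> \<and> e \<in> M"
        then obtain c where "c < m" "M = cls \<kappa> c" "e \<in> cls \<kappa> c" by auto
        then show "M = cls \<kappa> x" using last_iff[OF 2(1)] 2(2) by simp
      qed
    qed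
  qed
  then show "?g ` idempotent_latin m \<subseteq> edge_parallelisms (Suc m)" by blast
  show "inj_on ?g (idempotent_latin m)"
  proof (rule inj_onI)
    fix \<kappa> \<kappa>' assume k: "\<kappa> \<in> idempotent_latin m" and k': "\<kappa>' \<in> idempotent_latin m" and eq: "?g \<kappa> = ?g \<kappa>'"
    show "\<kappa> = \<kappa>'"
    proof (rule square_fun_ext[OF sym_latinD(1)[OF k] sym_latinD(1)[OF k']])
      fix x y assume xy: "x < m" "y < m"
      show "\<kappa> (x, y) = \<kappa>' (x, y)"
      proof (cases "x = y")
        case True
        then show ?thesis using sym_latinD(5)[OF k xy(1)] sym_latinD(5)[OF k' xy(1)] by simp
      next
        case False
        let ?c = "\<kappa> (x, y)"
        have c: "?c < m" by (rule sym_latinD(2)[OF k xy])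
        then have "cls \<kappa> ?c \<in> ?g \<kappa>'" using eq by blast
        then obtain c' where c': "c' < m" "cls \<kappa> ?c = cls \<kappa>' c'" by auto
        \<comment> \<open>The edge joining c to m lies in no class but that of colour c, so equal
          sets of classes match colour by colour.\<close>
        have "{?c, m} \<in> cls \<kappa>' c'" using last_iff[OF c, of \<kappa> ?c] c'(2) by simp
        then have "?c = c'" using last_iff[OF c, of \<kappa>' c'] by simp
        moreover have "{x, y} \<in> cls \<kappa>' c'" using edge_iff[OF k xy False c] c'(2) by simp
        then have "\<kappa>' (x, y) = c'" using edge_iff[OF k' xy False c'(1)] by simp
        ultimately show ?thesis by simp
      qed
    qed
  qed
qed (rule finite_edge_parallelisms)

subsection \<open>Comparison of the two bounds\<close>

lemma ratio_le:
  fixes a b u l :: real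
  assumes "a \<le> u" "l \<le> b" "0 < l" "0 \<le> a"
  shows "a / b \<le> u / l"
  using assms by (intro frac_le) auto

text \<open>The comparison is made between exponents. The minorant l' allows a lower bound in n/3 or
  (n - 1)/3 to be replaced first by a simpler expression with the same leading term.\<close>

lemma aut_bound_ratio_tendsto:
  assumes le: "\<forall>\<^sub>F n in sequentially. l' n \<le> l n"
    and lim: "filterlim (\<lambda>n. 3 * real n * ln (3 * real n) + 27 * (real n)\<^sup>2 +
      (s * (real n)\<^sup>2 + 3 * real n) / 2 * ln (real n) - l' n) at_bot sequentially"
  shows "(\<lambda>n. aut_bound s n / exp (l n)) \<longlonglongrightarrow> 0"
proof -
  let ?a = "\<lambda>n. 3 * real n * ln (3 * real n) + 27 * (real n)\<^sup>2 + (s * (real n)\<^sup>2 + 3 * real n) / 2 * ln (real n)"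
  have "\<forall>\<^sub>F n in sequentially. exp (?a n - l n) = aut_bound s n / exp (l n)"
    using eventually_gt_at_top[of 0]
  proof eventually_elim
    case (elim n)
    then show ?case by (simp add: aut_bound_def powr_def exp_diff exp_add)
  qed
  moreover have "filterlim (\<lambda>n. ?a n - l n) at_bot sequentially"
    using lim by (rule filterlim_at_bot_mono) (use le in \<open>eventually_elim, simp\<close>)
  then have "(\<lambda>n. exp (?a n - l n)) \<longlonglongrightarrow> 0"
    by (rule filterlim_compose[OF exp_at_bot])
  ultimately show ?thesis by (rule Lim_transform_eventually[rotated])
qed

lemma latin_bound_tendsto:
  "(\<lambda>n. aut_bound (5/4) n / exp (7/8 * (real n)\<^sup>2 * (ln (real n) - 6))) \<longlonglongrightarrow> 0"
  by (rule aut_bound_ratio_tendsto[OF always_eventually[OF allI[OF order_refl]]]) real_asymp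

lemma parallelism_bound_tendsto:
  "(\<lambda>n. aut_bound (5/8) n / exp (3/8 * (real n - 1)\<^sup>2 * ln (real n - 1) - 100 * (real n - 1)\<^sup>2)) \<longlonglongrightarrow> 0"
  by (rule aut_bound_ratio_tendsto[OF always_eventually[OF allI[OF order_refl]]]) real_asymp

text \<open>Here ln 3 is rounded up to 2 and 3 * 100 / 9 to 34.\<close>

lemma third_bound_ge:
  fixes x :: real
  assumes "x > 0"
  shows "1/8 * x\<^sup>2 * (ln x - 2) - 34 * x\<^sup>2 \<le> 3 * (3/8 * (x / 3)\<^sup>2 * ln (x / 3) - 100 * (x / 3)\<^sup>2)"
proof -
  have "ln (3::real) \<le> 2" using ln_bound[of "3::real"] ln_add_one_self_le_self[of "2::real"] by simp
  then have "1/8 * x\<^sup>2 * (ln x - 2) - 34 * x\<^sup>2 \<le> 1/8 * x\<^sup>2 * (ln x - ln 3) - 100/3 * x\<^sup>2"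
    by (intro diff_mono mult_left_mono mult_right_mono) auto
  also have "\<dots> = 3 * (3/8 * (x / 3)\<^sup>2 * ln (x / 3) - 100 * (x / 3)\<^sup>2)"
    using assms by (simp add: ln_div power_divide field_simps)
  finally show ?thesis .
qed

lemma Bose_bound_tendsto:
  "(\<lambda>n. aut_bound (5/24) n / exp (3 * (3/8 * (real n / 3)\<^sup>2 * ln (real n / 3) - 100 * (real n / 3)\<^sup>2))) \<longlonglongrightarrow> 0"
proof (rule aut_bound_ratio_tendsto)
  show "\<forall>\<^sub>F n in sequentially. 1/8 * (real n)\<^sup>2 * (ln (real n) - 2) - 34 * (real n)\<^sup>2
      \<le> 3 * (3/8 * (real n / 3)\<^sup>2 * ln (real n / 3) - 100 * (real n / 3)\<^sup>2)"
    using eventually_gt_at_top[of 0] by eventually_elim (rule third_bound_ge, simp)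
qed real_asymp

lemma Skolem_bound_tendsto:
  "(\<lambda>n. aut_bound (5/24) n / exp (3 * (3/8 * ((real n - 1) / 3)\<^sup>2 * ln ((real n - 1) / 3) - 100 * ((real n - 1) / 3)\<^sup>2))) \<longlonglongrightarrow> 0"
proof (rule aut_bound_ratio_tendsto)
  show "\<forall>\<^sub>F n in sequentially. 1/8 * (real n - 1)\<^sup>2 * (ln (real n - 1) - 2) - 34 * (real n - 1)\<^sup>2
      \<le> 3 * (3/8 * ((real n - 1) / 3)\<^sup>2 * ln ((real n - 1) / 3) - 100 * ((real n - 1) / 3)\<^sup>2)"
    using eventually_gt_at_top[of 1] by eventually_elim (rule third_bound_ge, simp)
qed real_asymp

section \<open>The three limits\<close>

lemma exp_cube_le:
  assumes "exp a \<le> real A" "A ^ 3 \<le> B"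
  shows "exp (3 * a) \<le> real B"
proof -
  have "exp (3 * a) = exp a ^ 3" using exp_of_nat_mult[of 3 a] by simp
  also have "\<dots> \<le> real A ^ 3" using assms(1) by (intro power_mono) auto
  also have "\<dots> = real (A ^ 3)" by simp
  also have "\<dots> \<le> real B" using assms(2) by (rule of_nat_mono)
  finally show ?thesis .
qed

lemma latin_ratio_tendsto:
  "(\<lambda>n. real (card (latin_squares_nontriv_aut n)) / real (card (latin_squares n))) \<longlonglongrightarrow> 0"
proof (rule tendsto_sandwich[OF _ _ tendsto_const latin_bound_tendsto])
  show "\<forall>\<^sub>F n in sequentially. real (card (latin_squares_nontriv_aut n)) / real (card (latin_squares n))
      \<le> aut_bound (5/4) n / exp (7/8 * (real n)\<^sup>2 * (ln (real n) - 6))"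
    using eventually_ge_at_top[of 1]
  proof eventually_elim
    case (elim n)
    have "exp (7/8 * (real n)\<^sup>2 * (ln n - 6)) \<le> real (card (latin_squares n))"
      using card_latin_funs_ge[OF elim] card_latin_funs_le_latin_squares[of n]
      by (meson of_nat_mono order_trans)
    then show ?case
      using card_latin_squares_nontriv_aut_le[OF elim] by (intro ratio_le) auto
  qed
qed auto

lemma steiner_ratio_small:
  assumes "\<epsilon> > 0"
  shows "\<exists>N. \<forall>n\<ge>N. (n mod 6 = 1 \<or> n mod 6 = 3) \<longrightarrow>
    real (card (sts_nontriv_aut n)) / real (card (steiner_triple_systems n)) < \<epsilon>"
proof -
  let ?b = "\<lambda>x. exp (3 * (3/8 * x\<^sup>2 * ln x - 100 * x\<^sup>2)) :: real"
  have "\<forall>\<^sub>F n in sequentially. aut_bound (5/24) n / ?b (real n / 3) < \<epsilon> \<and>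
      aut_bound (5/24) n / ?b ((real n - 1) / 3) < \<epsilon> \<and> n \<ge> 2"
    using order_tendstoD(2)[OF Bose_bound_tendsto assms] order_tendstoD(2)[OF Skolem_bound_tendsto assms]
      eventually_ge_at_top[of 2] by eventually_elim simp
  then obtain N where N: "\<And>n. n \<ge> N \<Longrightarrow> aut_bound (5/24) n / ?b (real n / 3) < \<epsilon> \<and>
      aut_bound (5/24) n / ?b ((real n - 1) / 3) < \<epsilon> \<and> n \<ge> 2"
    unfolding eventually_sequentially by blast
  show ?thesis
  proof (intro exI[of _ N] allI impI)
    fix n assume n: "n \<ge> N" "n mod 6 = 1 \<or> n mod 6 = 3"
    have n2: "n \<ge> 2" using N[OF n(1)] by simp
    have up: "real (card (sts_nontriv_aut n)) \<le> aut_bound (5/24) n"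
      using card_sts_nontriv_aut_le[of n] n2 by simp
    from n(2) show "real (card (sts_nontriv_aut n)) / real (card (steiner_triple_systems n)) < \<epsilon>"
    proof
      assume "n mod 6 = 1"
      then obtain t where t: "n = 6 * t + 1" by (metis mult_div_mod_eq)
      have t0: "t > 0" using t n2 by simp
      have e: "real (2 * t) = (real n - 1) / 3" using t by simp
      have "?b (real (2 * t)) \<le> real (card (steiner_triple_systems n))"
        unfolding t by (rule exp_cube_le[OF card_half_idempotent_ge[OF t0] card_steiner_ge_Skolem[OF t0]])
      then have "real (card (sts_nontriv_aut n)) / real (card (steiner_triple_systems n))
          \<le> aut_bound (5/24) n / ?b ((real n - 1) / 3)"
        unfolding e by (intro ratio_le up) auto
      then show ?thesis using N[OF n(1)] by linarith
    next
      assume "n mod 6 = 3"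
      then obtain t where t: "n = 6 * t + 3" by (metis mult_div_mod_eq)
      define m where "m = 2 * t + 1"
      have m: "n = 3 * m" "odd m" using t by (simp_all add: m_def)
      have e: "real m = real n / 3" using m by simp
      have "?b (real m) \<le> real (card (steiner_triple_systems n))"
        unfolding m(1) by (rule exp_cube_le[OF card_idempotent_ge[OF m(2)] card_steiner_ge_Bose])
      then have "real (card (sts_nontriv_aut n)) / real (card (steiner_triple_systems n))
          \<le> aut_bound (5/24) n / ?b (real n / 3)"
        unfolding e by (intro ratio_le up) auto
      then show ?thesis using N[OF n(1)] by linarith
    qed
  qed
qed

lemma parallelism_ratio_small:
  assumes "\<epsilon> > 0"
  shows "\<exists>N. \<forall>n\<ge>N. even n \<longrightarrow>
    real (card (par_nontriv_aut n)) / real (card (edge_parallelisms n)) < \<epsilon>"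
proof -
  let ?b = "\<lambda>x. exp (3/8 * x\<^sup>2 * ln x - 100 * x\<^sup>2) :: real"
  have "\<forall>\<^sub>F n in sequentially. aut_bound (5/8) n / ?b (real n - 1) < \<epsilon> \<and> n \<ge> 2"
    using order_tendstoD(2)[OF parallelism_bound_tendsto assms] eventually_ge_at_top[of 2]
    by eventually_elim simp
  then obtain N where N: "\<And>n. n \<ge> N \<Longrightarrow> aut_bound (5/8) n / ?b (real n - 1) < \<epsilon> \<and> n \<ge> 2"
    unfolding eventually_sequentially by blast
  show ?thesis
  proof (intro exI[of _ N] allI impI)
    fix n assume n: "n \<ge> N" "even n"
    have n2: "n \<ge> 2" using N[OF n(1)] by simp
    define m where "m = n - 1"
    have m: "n = Suc m" "odd m" "real m = real n - 1" using n n2 by (simp_all add: m_def of_nat_diff)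
    have "?b (real m) \<le> real (card (edge_parallelisms n))"
      using card_idempotent_ge[OF m(2)] card_idempotent_le_parallelisms[of m] unfolding m(1)
      by (meson of_nat_mono order_trans)
    then have "real (card (par_nontriv_aut n)) / real (card (edge_parallelisms n))
        \<le> aut_bound (5/8) n / ?b (real n - 1)"
      unfolding m(3) using card_par_nontriv_aut_le[of n] n2
      by (intro ratio_le) auto
    then show "real (card (par_nontriv_aut n)) / real (card (edge_parallelisms n)) < \<epsilon>"
      using N[OF n(1)] by linarith
  qed
qed

theorem mainTheorem1:
  shows "((\<lambda>n. real (card (latin_squares_nontriv_aut n)) / real (card (latin_squares n)))
            \<longlonglongrightarrow> 0) \<and>
         (\<forall>\<epsilon>>0. \<exists>N. \<forall>n\<ge>N. (n mod 6 = 1 \<or> n mod 6 = 3) \<longrightarrow>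
            real (card (sts_nontriv_aut n)) / real (card (steiner_triple_systems n)) < \<epsilon>) \<and>
         (\<forall>\<epsilon>>0. \<exists>N. \<forall>n\<ge>N. even n \<longrightarrow>
            real (card (par_nontriv_aut n)) / real (card (edge_parallelisms n)) < \<epsilon>)"
  using latin_ratio_tendsto steiner_ratio_small parallelism_ratio_small by blast

end
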